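(* Let $K$ be a field and $f\in K[t]$. Let $\mathcal{H}(f)$ be the generalized Heisenberg algebra associated to $f$, i.e. the $K$-algebra with generators $x,y,t$ and defining relations $$tx=xf,\qquad yt=fy,\qquad yx-xy=f-t .$$ Then the following are equivalent: (i) $\mathcal{H}(f)$ is a bijective skew PBW extension of endomorphism type of $R=K[t]$; (ii) $\mathcal{H}(f)$ is a skew PBW extension of $K$; (iii) $\mathcal{H}(f)$ is left or right noetherian; (iv) $\deg f=1$.
   Context: Algebras are associative unital $K$-algebras; $\mathbb{N}$ denotes the nonnegative integers. Skew PBW extension: let $R$ and $A$ be rings. $A$ is a skew PBW extension of (or over) $R$, written $A=\sigma(R)\langle x_1,\dots,x_n\rangle$, if: (1) $R$ is a subring of $A$ with the same identity; (2) there are finitely many elements $x_1,\dots,x_n\in A$ such that $A$ is a free left $R$-module with basis $\{x_1^{\alpha_1}\cdots x_n^{\alpha_n}\mid \alpha\in\mathbb{N}^n\}$; (3) for each $1\le i\le n$ and each $r\in R\setminus\{0\}$ there is $c_{i,r}\in R\setminus\{0\}$ with $x_ir-c_{i,r}x_i\in R$; (4) for all $1\le i,j\le n$ there is $d_{i,j}\in R\setminus\{0\}$ with $x_jx_i-d_{i,j}x_ix_j\in R+Rx_1+\cdots+Rx_n$. In this case there are, for each $i$, an injective endomorphism $\sigma_i$ of $R$ and a $\sigma_i$-derivation $\delta_i$ of $R$ with $x_ir=\sigma_i(r)x_i+\delta_i(r)$ for all $r\in R$. The extension is bijective if every $\sigma_i$ is bijective and $d_{i,j}$ is invertible for all $1\le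 i<j\le n$; it is of endomorphism type if $\delta_i=0$ for all $i$. In (i), $K[t]$ is the subalgebra of $\mathcal{H}(f)$ generated by $t$. *)

theory Defs
  imports
    "HOL-Library.Poly_Mapping"
    "HOL-Algebra.Generated_Rings"
    "HOL-Algebra.Algebraic_Closure_Type"
begin

section \<open>Skew PBW extensions\<close>

text \<open>The family \<open>b\<close>, indexed by \<open>I\<close>, is a basis of \<open>A\<close> as a left module over its subring \<open>R\<close>.\<close>

definition free_left_basis ::
    "('a, 'm) ring_scheme \<Rightarrow> 'a set \<Rightarrow> 'i set \<Rightarrow> ('i \<Rightarrow> 'a) \<Rightarrow> bool" where
  "free_left_basis A R I b \<longleftrightarrow>
     b \<in> I \<rightarrow> carrier A \<and>
     (\<forall>a\<in>carrier A. \<exists>F c. finite F \<and> F \<subseteq> I \<and> c \<in> F \<rightarrow> R \<and>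
        a = (\<Oplus>\<^bsub>A\<^esub>i\<in>F. c i \<otimes>\<^bsub>A\<^esub> b i)) \<and>
     (\<forall>F c. finite F \<longrightarrow> F \<subseteq> I \<longrightarrow> c \<in> F \<rightarrow> R \<longrightarrow>
        (\<Oplus>\<^bsub>A\<^esub>i\<in>F. c i \<otimes>\<^bsub>A\<^esub> b i) = \<zero>\<^bsub>A\<^esub> \<longrightarrow> (\<forall>i\<in>F. c i = \<zero>\<^bsub>A\<^esub>))"

text \<open>The elements \<open>x\<^sub>1, \<dots>, x\<^sub>n\<close> form a list \<open>xs\<close>, and an exponent \<open>\<alpha> \<in> \<nat>\<^sup>n\<close> is a list of
  naturals of the same length; list positions are counted from 0.\<close>

definition PBW_monomial :: "('a, 'm) ring_scheme \<Rightarrow> 'a list \<Rightarrow> nat list \<Rightarrow> 'a" where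
  "PBW_monomial A xs \<alpha> =
     foldr (\<lambda>a b. a \<otimes>\<^bsub>A\<^esub> b) (map2 (\<lambda>x k. x [^]\<^bsub>A\<^esub> k) xs \<alpha>) \<one>\<^bsub>A\<^esub>"

text \<open>The set \<open>R + R x\<^sub>1 + \<dots> + R x\<^sub>n\<close>.\<close>

definition PBW_affine :: "('a, 'm) ring_scheme \<Rightarrow> 'a set \<Rightarrow> 'a list \<Rightarrow> 'a set" where
  "PBW_affine A R xs =
     {r0 \<oplus>\<^bsub>A\<^esub> (\<Oplus>\<^bsub>A\<^esub>k\<in>{..<length xs}. r k \<otimes>\<^bsub>A\<^esub> xs ! k) | r0 r.
        r0 \<in> R \<and> r \<in> {..<length xs} \<rightarrow> R}"

text \<open>\<open>d\<close> is a possible value of the coefficient \<open>d\<^sub>i\<^sub>,\<^sub>j\<close>; for \<open>i < j\<close> the basis property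
  makes it unique.\<close>

definition PBW_coeff ::
    "('a, 'm) ring_scheme \<Rightarrow> 'a set \<Rightarrow> 'a list \<Rightarrow> nat \<Rightarrow> nat \<Rightarrow> 'a \<Rightarrow> bool" where
  "PBW_coeff A R xs i j d \<longleftrightarrow>
     d \<in> R - {\<zero>\<^bsub>A\<^esub>} \<and>
     xs ! j \<otimes>\<^bsub>A\<^esub> xs ! i \<ominus>\<^bsub>A\<^esub> d \<otimes>\<^bsub>A\<^esub> (xs ! i \<otimes>\<^bsub>A\<^esub> xs ! j) \<in> PBW_affine A R xs"

definition skew_PBW :: "('a, 'm) ring_scheme \<Rightarrow> 'a set \<Rightarrow> 'a list \<Rightarrow> bool" where
  "skew_PBW A R xs \<longleftrightarrow>
     ring A \<and> subring R A \<and> set xs \<subseteq> carrier A \<and>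
     free_left_basis A R {\<alpha>. length \<alpha> = length xs} (PBW_monomial A xs) \<and>
     (\<forall>i<length xs. \<forall>r\<in>R - {\<zero>\<^bsub>A\<^esub>}. \<exists>c\<in>R - {\<zero>\<^bsub>A\<^esub>}.
        xs ! i \<otimes>\<^bsub>A\<^esub> r \<ominus>\<^bsub>A\<^esub> c \<otimes>\<^bsub>A\<^esub> xs ! i \<in> R) \<and>
     (\<forall>i<length xs. \<forall>j<length xs. \<exists>d. PBW_coeff A R xs i j d)"

definition is_skew_PBW_extension :: "('a, 'm) ring_scheme \<Rightarrow> 'a set \<Rightarrow> bool" where
  "is_skew_PBW_extension A R \<longleftrightarrow> (\<exists>xs. skew_PBW A R xs)"

text \<open>\<open>\<sigma>\<close> is an injective endomorphism of \<open>R\<close>, \<open>\<delta>\<close> is a \<open>\<sigma>\<close>-derivation of \<open>R\<close>, and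
  \<open>x r = \<sigma>(r) x + \<delta>(r)\<close> for all \<open>r \<in> R\<close>. In a skew PBW extension the restrictions to \<open>R\<close> of
  the maps \<open>\<sigma>\<close> and \<open>\<delta>\<close> belonging to \<open>x = x\<^sub>i\<close> exist and are unique, so that the existential
  quantifiers in the next two definitions refer to these maps.\<close>

definition skew_maps ::
    "('a, 'm) ring_scheme \<Rightarrow> 'a set \<Rightarrow> 'a \<Rightarrow> ('a \<Rightarrow> 'a) \<Rightarrow> ('a \<Rightarrow> 'a) \<Rightarrow> bool" where
  "skew_maps A R x \<sigma> \<delta> \<longleftrightarrow>
     \<sigma> \<in> ring_hom (A\<lparr>carrier := R\<rparr>) (A\<lparr>carrier := R\<rparr>) \<and> inj_on \<sigma> R \<and>
     \<delta> \<in> R \<rightarrow> R \<and>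
     (\<forall>r\<in>R. \<forall>s\<in>R. \<delta> (r \<oplus>\<^bsub>A\<^esub> s) = \<delta> r \<oplus>\<^bsub>A\<^esub> \<delta> s) \<and>
     (\<forall>r\<in>R. \<forall>s\<in>R. \<delta> (r \<otimes>\<^bsub>A\<^esub> s) = \<sigma> r \<otimes>\<^bsub>A\<^esub> \<delta> s \<oplus>\<^bsub>A\<^esub> \<delta> r \<otimes>\<^bsub>A\<^esub> s) \<and>
     (\<forall>r\<in>R. x \<otimes>\<^bsub>A\<^esub> r = \<sigma> r \<otimes>\<^bsub>A\<^esub> x \<oplus>\<^bsub>A\<^esub> \<delta> r)"

definition PBW_bijective :: "('a, 'm) ring_scheme \<Rightarrow> 'a set \<Rightarrow> 'a list \<Rightarrow> bool" where
  "PBW_bijective A R xs \<longleftrightarrow>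
     (\<forall>i<length xs. \<exists>\<sigma> \<delta>. skew_maps A R (xs ! i) \<sigma> \<delta> \<and> bij_betw \<sigma> R R) \<and>
     (\<forall>j<length xs. \<forall>i<j. \<exists>d. PBW_coeff A R xs i j d \<and> d \<in> Units (A\<lparr>carrier := R\<rparr>))"

definition PBW_endomorphism_type :: "('a, 'm) ring_scheme \<Rightarrow> 'a set \<Rightarrow> 'a list \<Rightarrow> bool" where
  "PBW_endomorphism_type A R xs \<longleftrightarrow>
     (\<forall>i<length xs. \<exists>\<sigma> \<delta>. skew_maps A R (xs ! i) \<sigma> \<delta> \<and> (\<forall>r\<in>R. \<delta> r = \<zero>\<^bsub>A\<^esub>))"

definition is_bijective_endo_skew_PBW_extension ::
    "('a, 'm) ring_scheme \<Rightarrow> 'a set \<Rightarrow> bool" where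
  "is_bijective_endo_skew_PBW_extension A R \<longleftrightarrow>
     (\<exists>xs. skew_PBW A R xs \<and> PBW_bijective A R xs \<and> PBW_endomorphism_type A R xs)"


section \<open>One-sided noetherian rings\<close>

text \<open>\<^locale>\<open>noetherian_ring\<close> of HOL-Algebra concerns two-sided ideals, so it does not apply here.\<close>

definition left_ideal :: "'a set \<Rightarrow> ('a, 'm) ring_scheme \<Rightarrow> bool" where
  "left_ideal I A \<longleftrightarrow>
     additive_subgroup I A \<and> (\<forall>a\<in>carrier A. \<forall>u\<in>I. a \<otimes>\<^bsub>A\<^esub> u \<in> I)"

definition right_ideal :: "'a set \<Rightarrow> ('a, 'm) ring_scheme \<Rightarrow> bool" where
  "right_ideal I A \<longleftrightarrow>
     additive_subgroup I A \<and> (\<forall>a\<in>carrier A. \<forall>u\<in>I. u \<otimes>\<^bsub>A\<^esub> a \<in> I)"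

definition left_noetherian :: "('a, 'm) ring_scheme \<Rightarrow> bool" where
  "left_noetherian A \<longleftrightarrow> ring A \<and>
     (\<forall>I :: nat \<Rightarrow> 'a set. (\<forall>n. left_ideal (I n) A) \<and> (\<forall>n. I n \<subseteq> I (Suc n)) \<longrightarrow>
        (\<exists>N. \<forall>n\<ge>N. I n = I N))"

definition right_noetherian :: "('a, 'm) ring_scheme \<Rightarrow> bool" where
  "right_noetherian A \<longleftrightarrow> ring A \<and>
     (\<forall>I :: nat \<Rightarrow> 'a set. (\<forall>n. right_ideal (I n) A) \<and> (\<forall>n. I n \<subseteq> I (Suc n)) \<longrightarrow>
        (\<exists>N. \<forall>n\<ge>N. I n = I N))"


section \<open>Free algebras\<close>

text \<open>The free algebra on generators of type \<open>'g\<close> is the monoid algebra of the free monoid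
  of words. Words are wrapped lists, written additively, because multiplication
  of \<open>'w \<Rightarrow>\<^sub>0 'k\<close> is convolution with respect to the (here noncommutative) addition of \<open>'w\<close>.\<close>

datatype 'g free_word = Word (letters: "'g list")

instantiation free_word :: (type) monoid_add
begin

definition zero_free_word :: "'a free_word" where
  "zero_free_word = Word []"

definition plus_free_word :: "'a free_word \<Rightarrow> 'a free_word \<Rightarrow> 'a free_word" where
  "plus_free_word u v = Word (letters u @ letters v)"

instance
  by standard (simp_all add: zero_free_word_def plus_free_word_def)

end

type_synonym ('g, 'k) free_alg = "'g free_word \<Rightarrow>\<^sub>0 'k"

definition fvar :: "'g \<Rightarrow> ('g, 'k :: field) free_alg" where
  "fvar g = Poly_Mapping.single (Word [g]) 1"

definition fconst :: "'k \<Rightarrow> ('g, 'k :: field) free_alg" where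
  "fconst c = Poly_Mapping.single 0 c"

definition feval :: "'k :: field poly \<Rightarrow> ('g, 'k) free_alg \<Rightarrow> ('g, 'k) free_alg" where
  "feval p a = (\<Sum>i\<le>Polynomial.degree p. fconst (Polynomial.coeff p i) * a ^ i)"


section \<open>Generalized Heisenberg algebras\<close>

datatype heis_gen = GX | GY | GT

definition heis_relators :: "'k :: field poly \<Rightarrow> (heis_gen, 'k) free_alg set" where
  "heis_relators f =
     (let x = fvar GX; y = fvar GY; t = fvar GT; ft = feval f t in
      {t * x - x * ft, y * t - ft * y, (y * x - x * y) - (ft - t)})"

definition heis_ideal :: "'k :: field poly \<Rightarrow> (heis_gen, 'k) free_alg set" where
  "heis_ideal f = Idl\<^bsub>ring_of_type_algebra\<^esub> (heis_relators f)"

definition gen_heisenberg :: "'k :: field poly \<Rightarrow> (heis_gen, 'k) free_alg set ring" where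
  "gen_heisenberg f = ring_of_type_algebra Quot heis_ideal f"

definition heis_class ::
    "'k :: field poly \<Rightarrow> (heis_gen, 'k) free_alg \<Rightarrow> (heis_gen, 'k) free_alg set" where
  "heis_class f a = heis_ideal f +>\<^bsub>ring_of_type_algebra\<^esub> a"

text \<open>The image of the ground field, and the subalgebra generated by \<open>t\<close>, which is the subring
  generated by the scalars and \<open>t\<close>.\<close>

definition heis_K :: "'k :: field poly \<Rightarrow> (heis_gen, 'k) free_alg set set" where
  "heis_K f = range (\<lambda>c. heis_class f (fconst c))"

definition heis_Kt :: "'k :: field poly \<Rightarrow> (heis_gen, 'k) free_alg set set" where
  "heis_Kt f = generate_ring (gen_heisenberg f) (insert (heis_class f (fvar GT)) (heis_K f))"

end

theory Submission
  imports Defs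
begin

text \<open>If \<open>deg f = 1\<close>, both PBW presentations can be read off the relations. A bijective skew PBW
  extension of a right noetherian ring is right noetherian by a Hilbert basis argument: the leading
  coefficients, with respect to the degree-lexicographic order, of the elements of a right ideal form
  right ideals of the coefficient ring, increasing in the exponent because the coefficients
  \<open>d\<^sub>i\<^sub>,\<^sub>j\<close> are units. As \<open>K\<close> is a central field, every skew PBW extension of \<open>K\<close> is
  bijective.

  The elements \<open>x\<^sup>a t\<^sup>j y\<^sup>k\<close> form a basis of \<open>\<H>(f)\<close> for every \<open>f\<close>; linear independence comes from
  an explicit representation. If \<open>deg f \<noteq> 1\<close>, then \<open>p = f - t\<close> divides \<open>p(f(t))\<close> but not conversely,
  and since \<open>y p = p(f(t)) y\<close>, the left ideals generated by \<open>p, p y, \<dots>, p y\<^sup>n\<close> increase strictly;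
  so do the right ideals generated by \<open>p, x p, \<dots>, x\<^sup>n p\<close>.\<close>

section \<open>Left spans\<close>

text \<open>Coefficients stand to the left of the PBW monomials, and this decides the side: right
  multiplication of \<open>r x^\<alpha> + ...\<close> by \<open>s\<close> turns the leading
  coefficient into \<open>r \<sigma>^\<alpha>(s)\<close>, so surjectivity of the maps
  \<open>\<sigma>\<^sub>i\<close> is what makes leading coefficients a right ideal. The obstacle in
  the Hilbert argument is that there are infinitely many exponents: it is not enough that every
  chain of leading coefficient ideals becomes constant, one index has to serve all exponents at
  once. It comes from an induction on the number of variables along a diagonal. Normal forms have
  two halves. Straightening rules in the free algebra show that the elements span; operators on
  arrays of polynomials that satisfy the relations show that different arrays give different
  elements. The strictly increasing ideals are given by divisibility instead of generators: with
  \<open>f^i\<close> the \<open>i\<close>-th iterate under composition,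
  \<open>y^i p = p(f^i) y^i\<close>, so in the \<open>n\<close>-th ideal the coefficient in front of
  \<open>y^k\<close> is a multiple of \<open>p(f^(k-n))\<close>. Strictness is a matter of degrees,
  \<open>d^2\<close> against \<open>d\<close>, except that a constant \<open>f\<close> gives
  \<open>p(f) = 0\<close>.\<close>

inductive_set lspan :: "('a, 'm) ring_scheme \<Rightarrow> 'a set \<Rightarrow> 'a set \<Rightarrow> 'a set"
  for A :: "('a, 'm) ring_scheme" (structure) and R B where
    zero: "\<zero> \<in> lspan A R B"
  | step: "\<lbrakk>r \<in> R; x \<in> B; u \<in> lspan A R B\<rbrakk> \<Longrightarrow> r \<otimes> x \<oplus> u \<in> lspan A R B"

context ring
begin

lemma lspan_carrier:
  assumes "u \<in> lspan R S B" "S \<subseteq> carrier R" "B \<subseteq> carrier R"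
  shows "u \<in> carrier R"
  using assms by (induction) auto

lemma lspan_mono: "u \<in> lspan R S B \<Longrightarrow> B \<subseteq> Y \<Longrightarrow> u \<in> lspan R S Y"
  by (induction rule: lspan.induct) (auto intro: lspan.intros)

lemma lspan_base:
  assumes "r \<in> S" "x \<in> B" "S \<subseteq> carrier R" "B \<subseteq> carrier R"
  shows "r \<otimes> x \<in> lspan R S B"
  using lspan.step[OF assms(1,2) lspan.zero[of R]] assms by (auto simp: subset_iff)

lemma lspan_add:
  assumes "u \<in> lspan R S B" "v \<in> lspan R S B" "S \<subseteq> carrier R" "B \<subseteq> carrier R"
  shows "u \<oplus> v \<in> lspan R S B"
  using assms(1)
proof induction
  case zero
  then show ?case using assms lspan_carrier by simp
next
  case (step r x u)
  have "r \<otimes> x \<oplus> u \<oplus> v = r \<otimes> x \<oplus> (u \<oplus> v)"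
    using step assms lspan_carrier by (intro a_assoc) (auto simp: subset_iff)
  then show ?case using step lspan.step by metis
qed

lemma lspan_lmult:
  assumes "u \<in> lspan R S B" "s \<in> S" "subring S R" "B \<subseteq> carrier R"
  shows "s \<otimes> u \<in> lspan R S B"
  using assms(1)
proof induction
  case zero
  then show ?case using assms subringE(1)[OF assms(3)] by (auto simp: subset_iff intro: lspan.zero)
next
  case (step r x u)
  have S: "S \<subseteq> carrier R" by (rule subringE(1)[OF assms(3)])
  have "s \<otimes> (r \<otimes> x \<oplus> u) = (s \<otimes> r) \<otimes> x \<oplus> s \<otimes> u"
    using step assms S lspan_carrier[OF step(3)] by (auto simp: subset_iff r_distr m_assoc)
  then show ?case using step lspan.step subringE(6)[OF assms(3)] assms by metis
qed

lemma lspan_minus: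
  assumes "u \<in> lspan R S B" "subring S R" "B \<subseteq> carrier R"
  shows "\<ominus> u \<in> lspan R S B"
proof -
  have S: "S \<subseteq> carrier R" by (rule subringE(1)[OF assms(2)])
  have "\<ominus> \<one> \<in> S" using subringE(3,5)[OF assms(2)] by auto
  then have "\<ominus> \<one> \<otimes> u \<in> lspan R S B" using assms by (intro lspan_lmult)
  then show ?thesis using lspan_carrier[OF assms(1) S assms(3)] by (simp add: l_minus)
qed

text \<open>The coefficients act from the left and \<open>b\<close> from the right, so by
  associativity it suffices to test the generators. Every later statement about right multiplication
  of a filtration step is reduced to monomials in this way.\<close>

lemma lspan_rmult:
  assumes "u \<in> lspan R S B" "b \<in> carrier R" "subring S R" "B \<subseteq> carrier R" "Y \<subseteq> carrier R"
    and "\<And>x. x \<in> B \<Longrightarrow> x \<otimes> b \<in> lspan R S Y"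
  shows "u \<otimes> b \<in> lspan R S Y"
  using assms(1)
proof induction
  case zero
  then show ?case using assms by (auto intro: lspan.zero)
next
  case (step r x u)
  have S: "S \<subseteq> carrier R" by (rule subringE(1)[OF assms(3)])
  have "(r \<otimes> x \<oplus> u) \<otimes> b = r \<otimes> (x \<otimes> b) \<oplus> u \<otimes> b"
    using step assms S lspan_carrier[OF step(3)] by (auto simp: subset_iff l_distr m_assoc)
  then show ?case using lspan_add lspan_lmult step assms S by metis
qed

lemma lspan_subset:
  assumes "u \<in> lspan R S B" "subring S R" "B \<subseteq> carrier R" "Y \<subseteq> carrier R"
    and "B \<subseteq> lspan R S Y"
  shows "u \<in> lspan R S Y"
  using lspan_rmult[OF assms(1) one_closed assms(2-4)] assms subringE(1)[OF assms(2)]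
  by (auto simp: subset_iff lspan_carrier)

lemma lspan_finsum:
  assumes "finite F" "\<And>i. i \<in> F \<Longrightarrow> c i \<in> S" "\<And>i. i \<in> F \<Longrightarrow> b i \<in> B"
    "S \<subseteq> carrier R" "B \<subseteq> carrier R"
  shows "(\<Oplus>i\<in>F. c i \<otimes> b i) \<in> lspan R S B"
  using assms(1-3)
proof (induction F)
  case empty
  then show ?case by (simp add: lspan.zero)
next
  case (insert i F)
  have "(\<lambda>i. c i \<otimes> b i) \<in> insert i F \<rightarrow> carrier R" using insert assms by blast
  then show ?case using insert by (auto intro!: lspan.step)
qed

lemma foldr_mult_closed: "set l \<subseteq> carrier R \<Longrightarrow> foldr (\<otimes>) l \<one> \<in> carrier R"
  by (induction l) auto

lemma foldr_mult_append:
  "set l \<subseteq> carrier R \<Longrightarrow> set l' \<subseteq> carrier R \<Longrightarrow>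
   foldr (\<otimes>) (l @ l') \<one> = foldr (\<otimes>) l \<one> \<otimes> foldr (\<otimes>) l' \<one>"
  by (induction l) (auto simp: m_assoc foldr_mult_closed[simplified])

lemma foldr_mult_replicate: "x \<in> carrier R \<Longrightarrow> foldr (\<otimes>) (replicate k x) \<one> = x [^] k"
  by (induction k) (auto simp: nat_pow_Suc2[simplified])

lemma foldr_mult_concat:
  "(\<And>l. l \<in> set ls \<Longrightarrow> set l \<subseteq> carrier R) \<Longrightarrow>
   foldr (\<otimes>) (concat ls) \<one> = foldr (\<otimes>) (map (\<lambda>l. foldr (\<otimes>) l \<one>) ls) \<one>"
proof (induction ls)
  case (Cons l ls)
  then have "set (concat ls) \<subseteq> carrier R" by fastforce
  then show ?case using Cons by (simp add: foldr_mult_append del: set_concat foldr_append)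
qed simp

end


section \<open>Exponents and sorted words\<close>

text \<open>\<open>lex\<close> relates only lists of equal length, which keeps the order
  well-founded on all lists; totality holds only among exponents of one fixed length.\<close>

definition deg_lex :: "(nat list \<times> nat list) set" where
  "deg_lex = inv_image (less_than <*lex*> lex less_than) (\<lambda>\<alpha>. (sum_list \<alpha>, \<alpha>))"

lemma wf_deg_lex: "wf deg_lex"
  unfolding deg_lex_def by (intro wf_inv_image wf_lex_prod wf_less_than wf_lex)

lemma trans_deg_lex: "trans deg_lex"
  unfolding deg_lex_def by (intro trans_inv_image trans_lex_prod lex_transI trans_less_than)

lemma deg_lexI: "sum_list \<alpha> < sum_list \<beta> \<Longrightarrow> (\<alpha>, \<beta>) \<in> deg_lex"
  by (simp add: deg_lex_def)

lemma lex_less_than_iff: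
  "(\<alpha>, \<beta>) \<in> lex less_than \<longleftrightarrow>
     length \<alpha> = length \<beta> \<and> (\<exists>p<length \<alpha>. (\<forall>q<p. \<alpha> ! q = \<beta> ! q) \<and> \<alpha> ! p < \<beta> ! p)"
proof
  assume "(\<alpha>, \<beta>) \<in> lex less_than"
  then show "length \<alpha> = length \<beta> \<and> (\<exists>p<length \<alpha>. (\<forall>q<p. \<alpha> ! q = \<beta> ! q) \<and> \<alpha> ! p < \<beta> ! p)"
    by (fastforce simp: lex_conv nth_append)
next
  assume *: "length \<alpha> = length \<beta> \<and> (\<exists>p<length \<alpha>. (\<forall>q<p. \<alpha> ! q = \<beta> ! q) \<and> \<alpha> ! p < \<beta> ! p)"
  then obtain p where p: "p < length \<alpha>" "\<forall>q<p. \<alpha> ! q = \<beta> ! q" "\<alpha> ! p < \<beta> ! p" by blast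
  have "take p \<alpha> = take p \<beta>" using p * by (intro nth_equalityI) auto
  then show "(\<alpha>, \<beta>) \<in> lex less_than" using p * unfolding lex_conv
    by (auto intro!: exI[of _ "take p \<alpha>"] simp: id_take_nth_drop[of p \<alpha>, symmetric]
        id_take_nth_drop[of p \<beta>, symmetric])
       (metis id_take_nth_drop)
qed

text \<open>Borrowed from \<open>lenlex\<close>, which is total and agrees with \<open>lex\<close>
  on lists of equal length.\<close>

lemma total_deg_lex:
  assumes "length \<alpha> = length \<beta>" "\<alpha> \<noteq> \<beta>"
  shows "(\<alpha>, \<beta>) \<in> deg_lex \<or> (\<beta>, \<alpha>) \<in> deg_lex"
proof -
  have "total (lenlex less_than)" by (intro total_lenlex total_less_than)
  then have "(\<alpha>, \<beta>) \<in> lenlex less_than \<or> (\<beta>, \<alpha>) \<in> lenlex less_than"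
    using assms(2) unfolding total_on_def by blast
  then have "(\<alpha>, \<beta>) \<in> lex less_than \<or> (\<beta>, \<alpha>) \<in> lex less_than"
    using assms(1) unfolding lenlex_conv by simp
  with assms(1) show ?thesis by (cases "sum_list \<alpha>" "sum_list \<beta>" rule: linorder_cases) (auto simp: deg_lex_def)
qed

abbreviation incr :: "nat \<Rightarrow> nat list \<Rightarrow> nat list" where
  "incr i \<alpha> \<equiv> \<alpha>[i := Suc (\<alpha> ! i)]"

lemma sum_list_incr: "i < length \<alpha> \<Longrightarrow> sum_list (incr i \<alpha>) = Suc (sum_list \<alpha>)"
  by (simp add: sum_list_update)

text \<open>Compatibility of the monomial order with multiplication by a variable: all degrees grow
  by one, and the first position of disagreement stays where it is.\<close>

lemma deg_lex_incr:
  assumes "(\<alpha>, \<beta>) \<in> deg_lex" "length \<alpha> = length \<beta>" "i < length \<alpha>"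
  shows "(incr i \<alpha>, incr i \<beta>) \<in> deg_lex"
proof (cases "sum_list \<alpha> < sum_list \<beta>")
  case True
  then show ?thesis using assms by (intro deg_lexI) (simp add: sum_list_incr del: sum_list_update)
next
  case False
  then have "(\<alpha>, \<beta>) \<in> lex less_than" "sum_list \<alpha> = sum_list \<beta>" using assms by (auto simp: deg_lex_def)
  then obtain p where p: "p < length \<alpha>" "\<forall>q<p. \<alpha> ! q = \<beta> ! q" "\<alpha> ! p < \<beta> ! p"
    unfolding lex_less_than_iff by blast
  have "incr i \<alpha> ! q = incr i \<beta> ! q" if "q < p" for q
    using that p assms by (cases "q = i") auto
  moreover have "incr i \<alpha> ! p < incr i \<beta> ! p"
    using p assms by (cases "p = i") auto
  ultimately have "(incr i \<alpha>, incr i \<beta>) \<in> lex less_than"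
    using p(1) assms(2) unfolding lex_less_than_iff by auto
  then show ?thesis
    using \<open>sum_list \<alpha> = sum_list \<beta>\<close> assms by (simp add: deg_lex_def sum_list_incr)
qed

text \<open>An exponent becomes the nondecreasing word in which letter \<open>i\<close> occurs
  \<open>\<alpha> ! i\<close> times. PBW monomials are then the sorted words, and rewriting a
  product into PBW form is sorting.\<close>

definition word_of :: "nat list \<Rightarrow> nat list" where
  "word_of \<alpha> = concat (map2 (\<lambda>i k. replicate k i) [0..<length \<alpha>] \<alpha>)"

lemma word_of_Nil [simp]: "word_of [] = []"
  by (simp add: word_of_def)

lemma word_of_snoc [simp]: "word_of (\<alpha> @ [k]) = word_of \<alpha> @ replicate k (length \<alpha>)"
  by (simp add: word_of_def)

lemma set_word_of: "set (word_of \<alpha>) \<subseteq> {..<length \<alpha>}"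
  by (induction \<alpha> rule: rev_induct) auto

lemma length_word_of [simp]: "length (word_of \<alpha>) = sum_list \<alpha>"
  by (induction \<alpha> rule: rev_induct) auto

lemma sorted_word_of: "sorted (word_of \<alpha>)"
  using set_word_of by (induction \<alpha> rule: rev_induct) (fastforce simp: sorted_append)+

lemma count_word_of: "count (mset (word_of \<alpha>)) i = (if i < length \<alpha> then \<alpha> ! i else 0)"
proof (induction \<alpha> rule: rev_induct)
  case (snoc k \<alpha>)
  then show ?case by (auto simp: nth_append)
qed simp

text \<open>A sorted word is determined by its letter counts, so sorting any word over the variables
  ends at a PBW exponent.\<close>

lemma sort_eq_word_of:
  assumes "set w \<subseteq> {..<n}"
  shows "sort w = word_of (map (count (mset w)) [0..<n])"
proof (rule properties_for_sort)
  have "count (mset w) i = 0" if "\<not> i < n" for i using assms that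
    by (auto simp: count_eq_zero_iff)
  then show "mset (word_of (map (count (mset w)) [0..<n])) = mset w"
    by (intro multiset_eqI) (auto simp: count_word_of)
qed (rule sorted_word_of)

lemma sort_word_of_snoc:
  assumes "i < length \<alpha>"
  shows "sort (word_of \<alpha> @ [i]) = word_of (incr i \<alpha>)"
  using assms
  by (intro properties_for_sort multiset_eqI sorted_word_of) (auto simp: count_word_of nth_list_update)

text \<open>Takes the place of Dickson's lemma. Splitting off the first exponent \<open>k\<close>,
  the family is constant as soon as \<open>k\<close> and the chain index \<open>m\<close> are both
  large; the finitely many remaining values of \<open>k\<close> are families in one variable
  less.\<close>

lemma chain_stabilizes_uniformly:
  fixes L :: "nat list \<Rightarrow> nat \<Rightarrow> 'b set"
  assumes acc: "\<And>I :: nat \<Rightarrow> 'b set. (\<forall>n. Q (I n)) \<Longrightarrow> (\<forall>n. I n \<subseteq> I (Suc n)) \<Longrightarrow>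
      \<exists>N. \<forall>n\<ge>N. I n = I N"
    and "\<And>\<alpha> m. length \<alpha> = n \<Longrightarrow> Q (L \<alpha> m)"
    and "\<And>\<alpha> m. length \<alpha> = n \<Longrightarrow> L \<alpha> m \<subseteq> L \<alpha> (Suc m)"
    and "\<And>\<alpha> m i. length \<alpha> = n \<Longrightarrow> i < n \<Longrightarrow> L \<alpha> m \<subseteq> L (incr i \<alpha>) m"
  shows "\<exists>M. \<forall>\<alpha>. length \<alpha> = n \<longrightarrow> (\<forall>m\<ge>M. L \<alpha> m = L \<alpha> M)"
  using assms(2-4)
proof (induction n arbitrary: L)
  case 0
  then show ?case using acc[of "L []"] by simp
next
  case (Suc n)
  have mono_m: "L \<alpha> m \<subseteq> L \<alpha> m'" if "length \<alpha> = Suc n" "m \<le> m'" for \<alpha> m m'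
    using lift_Suc_mono_le[of "L \<alpha>", OF Suc.prems(2)] that by blast
  have step_k: "L (k # \<alpha>) m \<subseteq> L (Suc k # \<alpha>) m" if "length \<alpha> = n" for k \<alpha> m
    using Suc.prems(3)[of "k # \<alpha>" 0] that by simp
  have mono_k: "L (k # \<alpha>) m \<subseteq> L (k' # \<alpha>) m" if "length \<alpha> = n" "k \<le> k'" for k k' \<alpha> m
    using lift_Suc_mono_le[of "\<lambda>k. L (k # \<alpha>) m", OF step_k] that by blast
  have step_i: "L (k # \<alpha>) m \<subseteq> L (k # incr i \<alpha>) m" if "length \<alpha> = n" "i < n" for k \<alpha> m i
    using Suc.prems(3)[of "k # \<alpha>" "Suc i"] that by simp
  \<comment> \<open>On the diagonal the first exponent and the chain index grow together, so this is
    again a chain of families in \<open>n\<close> variables.\<close>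
  have "\<exists>K. \<forall>\<alpha>. length \<alpha> = n \<longrightarrow> (\<forall>k\<ge>K. L (k # \<alpha>) k = L (K # \<alpha>) K)"
  proof (rule Suc.IH[of "\<lambda>\<alpha> k. L (k # \<alpha>) k"])
    show "L (k # \<alpha>) k \<subseteq> L (Suc k # \<alpha>) (Suc k)" if "length \<alpha> = n" for \<alpha> k
      using step_k mono_m[of "Suc k # \<alpha>" k "Suc k"] that by fastforce
  qed (use Suc.prems(1) step_i in auto)
  then obtain K where K: "\<And>\<alpha> k. length \<alpha> = n \<Longrightarrow> k \<ge> K \<Longrightarrow> L (k # \<alpha>) k = L (K # \<alpha>) K"
    by blast
  \<comment> \<open>A bound for each fixed first exponent. These bounds may be unbounded in
    \<open>k\<close>, but only those with \<open>k < K\<close> will be used.\<close>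
  have "\<exists>M. \<forall>\<alpha>. length \<alpha> = n \<longrightarrow> (\<forall>m\<ge>M. L (k # \<alpha>) m = L (k # \<alpha>) M)" for k
    by (rule Suc.IH[of "\<lambda>\<alpha>. L (k # \<alpha>)"]) (use Suc.prems(1,2) step_i in auto)
  then obtain M where M: "\<And>k \<alpha> m. length \<alpha> = n \<Longrightarrow> m \<ge> M k \<Longrightarrow> L (k # \<alpha>) m = L (k # \<alpha>) (M k)"
    by metis
  \<comment> \<open>Off the diagonal the set is squeezed between two diagonal members, at
    \<open>K\<close> and at \<open>max k m\<close>, which are equal.\<close>
  have big: "L (k # \<alpha>) m = L (K # \<alpha>) K" if "length \<alpha> = n" "k \<ge> K" "m \<ge> K" for \<alpha> k m
  proof
    have "L (k # \<alpha>) m \<subseteq> L (max k m # \<alpha>) (max k m)"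
      using mono_k[of \<alpha> k "max k m" m] mono_m[of "max k m # \<alpha>" m "max k m"] that by force
    then show "L (k # \<alpha>) m \<subseteq> L (K # \<alpha>) K" using K[of \<alpha> "max k m"] that by auto
    show "L (K # \<alpha>) K \<subseteq> L (k # \<alpha>) m"
      using mono_k[of \<alpha> K k K] mono_m[of "k # \<alpha>" K m] that by force
  qed
  define B where "B = Max (insert K (M ` {..<K}))"
  have B: "K \<le> B" "\<And>k. k < K \<Longrightarrow> M k \<le> B" by (auto simp: B_def)
  have "L \<alpha> m = L \<alpha> B" if "length \<alpha> = Suc n" "m \<ge> B" for \<alpha> m
  proof -
    obtain k \<alpha>' where \<alpha>: "\<alpha> = k # \<alpha>'" "length \<alpha>' = n" using \<open>length \<alpha> = Suc n\<close> by (cases \<alpha>) auto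
    show ?thesis
    proof (cases "k < K")
      case True
      then show ?thesis using M[OF \<alpha>(2), of k m] M[OF \<alpha>(2), of k B] B(2)[of k] that \<alpha> by simp
    next
      case False
      then show ?thesis using big[OF \<alpha>(2), of k m] big[OF \<alpha>(2), of k B] B(1) that \<alpha> by simp
    qed
  qed
  then show ?case by blast
qed


section \<open>One-sided ideals\<close>

context ring
begin

text \<open>Negatives come from multiplication by \<open>\<ominus> \<one>\<close>.\<close>

lemma right_idealI:
  assumes "I \<subseteq> carrier R" "\<zero> \<in> I" "\<And>a b. a \<in> I \<Longrightarrow> b \<in> I \<Longrightarrow> a \<oplus> b \<in> I"
    "\<And>a b. a \<in> I \<Longrightarrow> b \<in> carrier R \<Longrightarrow> a \<otimes> b \<in> I"
  shows "right_ideal I R"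
  unfolding right_ideal_def
proof
  have "\<ominus> a \<in> I" if "a \<in> I" for a
    using assms(4)[OF that, of "\<ominus> \<one>"] that assms(1) by (auto simp: r_minus)
  then show "additive_subgroup I R"
    using assms by (intro additive_subgroupI add.subgroupI) (auto simp: a_inv_def)
qed (use assms in auto)

lemma left_idealI:
  assumes "I \<subseteq> carrier R" "\<zero> \<in> I" "\<And>a b. a \<in> I \<Longrightarrow> b \<in> I \<Longrightarrow> a \<oplus> b \<in> I"
    "\<And>a b. a \<in> I \<Longrightarrow> b \<in> carrier R \<Longrightarrow> b \<otimes> a \<in> I"
  shows "left_ideal I R"
  unfolding left_ideal_def
proof
  have "\<ominus> a \<in> I" if "a \<in> I" for a
    using assms(4)[OF that, of "\<ominus> \<one>"] that assms(1) by (auto simp: l_minus)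
  then show "additive_subgroup I R"
    using assms by (intro additive_subgroupI add.subgroupI) (auto simp: a_inv_def)
qed (use assms in auto)

lemma right_idealD:
  assumes "right_ideal I R"
  shows "I \<subseteq> carrier R" "\<zero> \<in> I" "\<And>a b. a \<in> I \<Longrightarrow> b \<in> I \<Longrightarrow> a \<oplus> b \<in> I"
    "\<And>a b. a \<in> I \<Longrightarrow> b \<in> carrier R \<Longrightarrow> a \<otimes> b \<in> I" "\<And>a. a \<in> I \<Longrightarrow> \<ominus> a \<in> I"
proof -
  have I: "additive_subgroup I R" using assms by (simp add: right_ideal_def)
  show "I \<subseteq> carrier R" by (rule additive_subgroup.a_subset[OF I])
  show "\<zero> \<in> I" by (rule additive_subgroup.zero_closed[OF I])
  show "a \<oplus> b \<in> I" if "a \<in> I" "b \<in> I" for a b using that by (rule additive_subgroup.a_closed[OF I])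
  show r: "a \<otimes> b \<in> I" if "a \<in> I" "b \<in> carrier R" for a b
    using that assms by (simp add: right_ideal_def)
  show "\<ominus> a \<in> I" if "a \<in> I" for a
    using r[OF that, of "\<ominus> \<one>"] that \<open>I \<subseteq> carrier R\<close> by (auto simp: r_minus)
qed

end


section \<open>A Hilbert basis theorem\<close>

text \<open>The maps \<open>\<sigma>\<close> and \<open>\<delta>\<close>, which
  \<open>PBW_bijective\<close> only asserts to exist for each variable, are fixed here as families
  indexed by the variable.\<close>

locale bijective_PBW_data = ring A for A :: "('a, 'm) ring_scheme" (structure) +
  fixes R :: "'a set" and xs :: "'a list" and \<sigma> \<delta> :: "nat \<Rightarrow> 'a \<Rightarrow> 'a"
  assumes subring: "subring R A"
    and xs: "set xs \<subseteq> carrier A"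
    and maps: "\<And>i. i < length xs \<Longrightarrow> skew_maps A R (xs ! i) (\<sigma> i) (\<delta> i)"
    and bij: "\<And>i. i < length xs \<Longrightarrow> bij_betw (\<sigma> i) R R"
    and swap: "\<And>i j. j < length xs \<Longrightarrow> i < j \<Longrightarrow>
      \<exists>d. PBW_coeff A R xs i j d \<and> d \<in> Units (A\<lparr>carrier := R\<rparr>)"
    and spanning: "\<And>a. a \<in> carrier A \<Longrightarrow>
      \<exists>F c. finite F \<and> F \<subseteq> {\<alpha>. length \<alpha> = length xs} \<and> c \<in> F \<rightarrow> R \<and>
        a = (\<Oplus>\<alpha>\<in>F. c \<alpha> \<otimes> PBW_monomial A xs \<alpha>)"
begin

lemma R_carrier: "r \<in> R \<Longrightarrow> r \<in> carrier A"
  using subringE(1)[OF subring] by blast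

lemma R_subset: "R \<subseteq> carrier A"
  by (rule subringE(1)[OF subring])

lemmas R_closed = subringE(2,3,5-7)[OF subring]

lemma xs_carrier: "i < length xs \<Longrightarrow> xs ! i \<in> carrier A"
  using xs nth_mem by blast

lemma \<sigma>_closed: "i < length xs \<Longrightarrow> r \<in> R \<Longrightarrow> \<sigma> i r \<in> R"
  using maps[of i] unfolding skew_maps_def ring_hom_def by auto

lemma \<delta>_closed: "i < length xs \<Longrightarrow> r \<in> R \<Longrightarrow> \<delta> i r \<in> R"
  using maps[of i] unfolding skew_maps_def by auto

lemma commute: "i < length xs \<Longrightarrow> r \<in> R \<Longrightarrow> xs ! i \<otimes> r = \<sigma> i r \<otimes> xs ! i \<oplus> \<delta> i r"
  using maps[of i] unfolding skew_maps_def by auto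

abbreviation "U \<equiv> Units (A\<lparr>carrier := R\<rparr>)"

lemma U_iff: "d \<in> U \<longleftrightarrow> d \<in> R \<and> (\<exists>e\<in>R. e \<otimes> d = \<one> \<and> d \<otimes> e = \<one>)"
  by (auto simp: Units_def)

lemma one_U: "\<one> \<in> U"
  using R_closed by (force simp: U_iff)

lemma U_mult: "d \<in> U \<Longrightarrow> e \<in> U \<Longrightarrow> d \<otimes> e \<in> U"
  using monoid.Units_m_closed[OF ring.is_monoid[OF subring_is_ring[OF subring]], of d e] by simp

lemma U_R: "d \<in> U \<Longrightarrow> d \<in> R"
  by (simp add: U_iff)

lemma \<sigma>_U: 
  assumes "i < length xs" "d \<in> U"
  shows "\<sigma> i d \<in> U"
proof -
  have h: "\<sigma> i \<in> ring_hom (A\<lparr>carrier := R\<rparr>) (A\<lparr>carrier := R\<rparr>)"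
    using maps[OF assms(1)] by (simp add: skew_maps_def)
  obtain e where e: "e \<in> R" "e \<otimes> d = \<one>" "d \<otimes> e = \<one>" "d \<in> R" using assms(2) by (auto simp: U_iff)
  then show ?thesis
    using ring_hom_mult[OF h, of d e] ring_hom_mult[OF h, of e d] ring_hom_one[OF h]
      \<sigma>_closed[OF assms(1)] by (auto simp: U_iff intro!: bexI[of _ "\<sigma> i e"])
qed

section \<open>Products over arbitrary words and their straightening\<close>

definition mon :: "nat list \<Rightarrow> 'a" where
  "mon w = foldr (\<otimes>) (map ((!) xs) w) \<one>"

abbreviation words :: "nat list set" where
  "words \<equiv> {w. set w \<subseteq> {..<length xs}}"

lemma mon_Nil [simp]: "mon [] = \<one>"
  and mon_Cons [simp]: "mon (i # w) = xs ! i \<otimes> mon w"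
  by (simp_all add: mon_def)

lemma mon_carrier [simp]: "w \<in> words \<Longrightarrow> mon w \<in> carrier A"
  using xs unfolding mon_def by (intro foldr_mult_closed) (auto intro: xs_carrier)

lemma mon_append: "v \<in> words \<Longrightarrow> w \<in> words \<Longrightarrow> mon (v @ w) = mon v \<otimes> mon w"
  unfolding mon_def map_append by (intro foldr_mult_append) (auto intro: xs_carrier)

lemma PBW_monomial_eq_mon:
  assumes "length \<alpha> = length xs"
  shows "PBW_monomial A xs \<alpha> = mon (word_of \<alpha>)"
proof -
  have "map ((!) xs) (word_of \<alpha>) = concat (map2 (\<lambda>i k. replicate k (xs ! i)) [0..<length \<alpha>] \<alpha>)"
    by (simp add: word_of_def map_concat comp_def case_prod_unfold)
  also have "map2 (\<lambda>i k. replicate k (xs ! i)) [0..<length \<alpha>] \<alpha> = map2 (\<lambda>x k. replicate k x) xs \<alpha>"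
    using assms by (intro nth_equalityI) auto
  finally have "mon (word_of \<alpha>) =
      foldr (\<otimes>) (map (\<lambda>l. foldr (\<otimes>) l \<one>) (map2 (\<lambda>x k. replicate k x) xs \<alpha>)) \<one>"
    unfolding mon_def using xs
    by (simp only:) (rule foldr_mult_concat, auto dest!: set_zip_leftD split: if_splits)
  also have "map (\<lambda>l. foldr (\<otimes>) l \<one>) (map2 (\<lambda>x k. replicate k x) xs \<alpha>) = map2 (\<lambda>x k. x [^] k) xs \<alpha>"
    using assms xs_carrier by (intro nth_equalityI) (auto simp: foldr_mult_replicate simp del: foldr_replicate)
  finally show ?thesis by (simp add: PBW_monomial_def)
qed

text \<open>The filtration by word length, with the strict bound \<open>length w < m\<close>: the
  error terms of a rewriting step applied to a word \<open>w\<close> lie in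
  \<open>W (length w)\<close>.\<close>

definition W :: "nat \<Rightarrow> 'a set" where
  "W m = lspan A R (mon ` {w \<in> words. length w < m})"

lemma monW: "mon ` {w \<in> words. length w < m} \<subseteq> carrier A"
  by auto

lemma W_carrier: "u \<in> W m \<Longrightarrow> u \<in> carrier A"
  unfolding W_def using lspan_carrier R_subset monW by blast

lemma W_mono: "u \<in> W m \<Longrightarrow> m \<le> m' \<Longrightarrow> u \<in> W m'"
  unfolding W_def by (erule lspan_mono) auto

lemma W_add: "u \<in> W m \<Longrightarrow> v \<in> W m \<Longrightarrow> u \<oplus> v \<in> W m"
  unfolding W_def by (rule lspan_add) (use R_subset in auto)

lemma W_lmult: "r \<in> R \<Longrightarrow> u \<in> W m \<Longrightarrow> r \<otimes> u \<in> W m"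
  unfolding W_def by (rule lspan_lmult) (use subring in auto)

lemma W_base: "r \<in> R \<Longrightarrow> w \<in> words \<Longrightarrow> length w < m \<Longrightarrow> r \<otimes> mon w \<in> W m"
  unfolding W_def by (rule lspan_base) (use R_subset in auto)

lemma W_mon: "w \<in> words \<Longrightarrow> length w < m \<Longrightarrow> mon w \<in> W m"
  using W_base[of \<one> w m] R_closed by simp

lemma W_zero: "\<zero> \<in> W m"
  unfolding W_def by (rule lspan.zero)

text \<open>Moving \<open>x\<^sub>i\<close> past a coefficient gives a
  \<open>\<sigma>\<^sub>i\<close> term with one more letter and a \<open>\<delta>\<^sub>i\<close>
  term with the same word, so the length grows by at most one.\<close>

lemma mult_W:
  assumes "i < length xs" "u \<in> W m"
  shows "xs ! i \<otimes> u \<in> W (Suc m)"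
  using assms(2) unfolding W_def
proof (induction rule: lspan.induct)
  case zero
  then show ?case using xs_carrier[OF assms(1)] lspan.zero by simp
next
  case (step r x u)
  then obtain w where w: "x = mon w" "w \<in> words" "length w < m" by auto
  have u: "u \<in> carrier A" using lspan_carrier[OF step(3)] R_subset monW by blast
  have "xs ! i \<otimes> (r \<otimes> x \<oplus> u) = (xs ! i \<otimes> r) \<otimes> mon w \<oplus> xs ! i \<otimes> u"
    using u w xs_carrier[OF assms(1)] R_carrier[OF step(1)] by (simp add: r_distr m_assoc)
  also have "(xs ! i \<otimes> r) \<otimes> mon w = \<sigma> i r \<otimes> mon (i # w) \<oplus> \<delta> i r \<otimes> mon w"
    using w xs_carrier[OF assms(1)] R_carrier \<sigma>_closed[OF assms(1)] \<delta>_closed[OF assms(1)] step(1)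
    by (simp add: commute[OF assms(1)] l_distr m_assoc)
  finally have "xs ! i \<otimes> (r \<otimes> x \<oplus> u) = (\<sigma> i r \<otimes> mon (i # w) \<oplus> \<delta> i r \<otimes> mon w) \<oplus> xs ! i \<otimes> u" .
  moreover have "xs ! i \<otimes> u \<in> W (Suc m)" using step.IH by (simp add: W_def)
  moreover have "\<sigma> i r \<otimes> mon (i # w) \<in> W (Suc m)" "\<delta> i r \<otimes> mon w \<in> W (Suc m)"
    using w assms step(1) by (auto intro!: W_base \<sigma>_closed \<delta>_closed simp del: mon_Cons)
  ultimately have "xs ! i \<otimes> (r \<otimes> x \<oplus> u) \<in> W (Suc m)" using W_add by metis
  then show ?case unfolding W_def .
qed

lemma W_mult_mon:
  assumes "u \<in> W m" "v \<in> words"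
  shows "u \<otimes> mon v \<in> W (m + length v)"
  using assms(1) unfolding W_def
proof (rule lspan_rmult)
  fix x assume "x \<in> mon ` {w \<in> words. length w < m}"
  then obtain w where w: "x = mon w" "w \<in> words" "length w < m" by auto
  then have "x \<otimes> mon v = mon (w @ v)" using assms mon_append by simp
  then show "x \<otimes> mon v \<in> lspan A R (mon ` {w \<in> words. length w < m + length v})"
    using W_mon[of "w @ v" "m + length v"] w assms by (simp add: W_def)
qed (use assms subring in auto)

text \<open>The twist that a coefficient undergoes when it is moved from the right of a word to its
  left; the last letter is crossed first.\<close>

fun sig :: "nat list \<Rightarrow> 'a \<Rightarrow> 'a" where
  "sig [] r = r"
| "sig (i # w) r = \<sigma> i (sig w r)"

lemma sig_closed: "w \<in> words \<Longrightarrow> r \<in> R \<Longrightarrow> sig w r \<in> R"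
  by (induction w) (auto intro: \<sigma>_closed)

lemma sig_surj: "w \<in> words \<Longrightarrow> s \<in> R \<Longrightarrow> \<exists>r\<in>R. sig w r = s"
proof (induction w arbitrary: s)
  case (Cons i w)
  then have "s \<in> \<sigma> i ` R" using bij[of i] by (auto simp: bij_betw_def)
  then obtain s' where "s' \<in> R" "\<sigma> i s' = s" by blast
  then show ?case using Cons.IH[of s'] Cons.prems by auto
qed auto

lemma mon_mult_R:
  assumes "w \<in> words" "r \<in> R"
  shows "\<exists>u\<in>W (length w). mon w \<otimes> r = sig w r \<otimes> mon w \<oplus> u"
  using assms(1)
proof (induction w)
  case Nil
  then show ?case using assms R_carrier by (auto intro!: bexI[of _ \<zero>] W_zero)
next
  case (Cons i w)
  then have i: "i < length xs" and w: "w \<in> words" by auto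
  obtain u where u: "u \<in> W (length w)" "mon w \<otimes> r = sig w r \<otimes> mon w \<oplus> u" using Cons by auto
  let ?s = "sig w r"
  have s: "?s \<in> R" by (rule sig_closed[OF w assms(2)])
  note c = xs_carrier[OF i] R_carrier[OF s] W_carrier[OF u(1)] R_carrier[OF assms(2)]
    R_carrier[OF \<sigma>_closed[OF i s]] R_carrier[OF \<delta>_closed[OF i s]] mon_carrier[OF w]
  have "mon (i # w) \<otimes> r = xs ! i \<otimes> (?s \<otimes> mon w \<oplus> u)"
    using c u(2) by (simp add: m_assoc)
  also have "\<dots> = (xs ! i \<otimes> ?s) \<otimes> mon w \<oplus> xs ! i \<otimes> u"
    using c by (simp add: r_distr m_assoc)
  also have "\<dots> = sig (i # w) r \<otimes> mon (i # w) \<oplus> (\<delta> i ?s \<otimes> mon w \<oplus> xs ! i \<otimes> u)"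
    using c by (simp add: commute[OF i s] l_distr m_assoc a_assoc)
  finally have "mon (i # w) \<otimes> r =
    sig (i # w) r \<otimes> mon (i # w) \<oplus> (\<delta> i ?s \<otimes> mon w \<oplus> xs ! i \<otimes> u)" .
  moreover have "\<delta> i ?s \<otimes> mon w \<oplus> xs ! i \<otimes> u \<in> W (length (i # w))"
    using W_add[OF W_base[OF \<delta>_closed[OF i s] w] mult_W[OF i u(1)]] by simp
  ultimately show ?case by blast
qed

text \<open>The correction terms in the commutation of two variables involve only words of length at
  most one.\<close>

lemma affine_W: "PBW_affine A R xs \<subseteq> W 2"
proof
  fix a assume "a \<in> PBW_affine A R xs"
  then obtain r0 r where r: "r0 \<in> R" "r \<in> {..<length xs} \<rightarrow> R"
    and a: "a = r0 \<oplus> (\<Oplus>k\<in>{..<length xs}. r k \<otimes> xs ! k)"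
    unfolding PBW_affine_def by auto
  have "r0 \<in> W 2" using W_base[of r0 "[]" 2] r R_carrier by simp
  moreover have "(\<Oplus>k\<in>{..<length xs}. r k \<otimes> xs ! k) \<in> W 2"
    unfolding W_def
  proof (rule lspan_finsum)
    fix k assume "k \<in> {..<length xs}"
    then show "xs ! k \<in> mon ` {w \<in> words. length w < 2}"
      using xs_carrier by (intro image_eqI[of _ _ "[k]"]) auto
  qed (use r R_subset in auto)
  ultimately show "a \<in> W 2" unfolding a by (rule W_add)
qed

text \<open>Equality up to a left unit and shorter words. The error is measured by the left word,
  which is why transitivity asks for equal lengths.\<close>

definition sim :: "nat list \<Rightarrow> nat list \<Rightarrow> bool" (infix \<open>\<leadsto>\<close> 50) where
  "w \<leadsto> w' \<longleftrightarrow> (\<exists>d\<in>U. \<exists>u\<in>W (length w). mon w = d \<otimes> mon w' \<oplus> u)"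

lemma sim_refl: "w \<in> words \<Longrightarrow> w \<leadsto> w"
  unfolding sim_def using one_U W_zero by (intro bexI[of _ \<one>] bexI[of _ \<zero>]) auto

lemma sim_trans:
  assumes "w \<leadsto> w'" "w' \<leadsto> w''" "length w = length w'" "w'' \<in> words"
  shows "w \<leadsto> w''"
proof -
  obtain d u where 1: "d \<in> U" "u \<in> W (length w)" "mon w = d \<otimes> mon w' \<oplus> u"
    using assms(1) unfolding sim_def by blast
  obtain e v where 2: "e \<in> U" "v \<in> W (length w)" "mon w' = e \<otimes> mon w'' \<oplus> v"
    using assms(2,3) unfolding sim_def by auto
  have "mon w = (d \<otimes> e) \<otimes> mon w'' \<oplus> (d \<otimes> v \<oplus> u)"
    using 1 2 assms W_carrier[OF 1(2)] W_carrier[OF 2(2)] R_carrier[OF U_R[OF 1(1)]] R_carrier[OF U_R[OF 2(1)]]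
    by (simp add: r_distr m_assoc a_assoc)
  moreover have "d \<otimes> v \<oplus> u \<in> W (length w)" using 1 2 by (intro W_add W_lmult U_R)
  ultimately show ?thesis using U_mult[OF 1(1) 2(1)] unfolding sim_def by blast
qed

text \<open>The unit \<open>d\<close> becomes \<open>\<sigma>\<^sub>i(d)\<close>, a unit because
  \<open>\<sigma>\<^sub>i\<close> is a ring homomorphism, and the term with
  \<open>\<delta>\<^sub>i(d)\<close> lacks the letter \<open>i\<close>, so it is an error
  term.\<close>

lemma sim_Cons:
  assumes "w \<leadsto> w'" "i < length xs" "length w = length w'" "w' \<in> words"
  shows "i # w \<leadsto> i # w'"
proof -
  obtain d u where 1: "d \<in> U" "u \<in> W (length w)" "mon w = d \<otimes> mon w' \<oplus> u"
    using assms(1) unfolding sim_def by blast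
  note d = U_R[OF 1(1)]
  note c = xs_carrier[OF assms(2)] R_carrier[OF d] W_carrier[OF 1(2)]
    R_carrier[OF \<sigma>_closed[OF assms(2) d]] R_carrier[OF \<delta>_closed[OF assms(2) d]] mon_carrier[OF assms(4)]
  have "mon (i # w) = (xs ! i \<otimes> d) \<otimes> mon w' \<oplus> xs ! i \<otimes> u"
    using c 1(3) by (simp add: r_distr m_assoc)
  also have "\<dots> = \<sigma> i d \<otimes> mon (i # w') \<oplus> (\<delta> i d \<otimes> mon w' \<oplus> xs ! i \<otimes> u)"
    using c by (simp add: commute[OF assms(2) d] l_distr m_assoc a_assoc)
  finally have "mon (i # w) = \<sigma> i d \<otimes> mon (i # w') \<oplus> (\<delta> i d \<otimes> mon w' \<oplus> xs ! i \<otimes> u)" .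
  moreover have "\<delta> i d \<otimes> mon w' \<oplus> xs ! i \<otimes> u \<in> W (length (i # w))"
    using W_add[OF W_base[OF \<delta>_closed[OF assms(2) d] assms(4)] mult_W[OF assms(2) 1(2)]] assms(3) by simp
  ultimately show ?thesis using \<sigma>_U[OF assms(2) 1(1)] unfolding sim_def by blast
qed

text \<open>A descent \<open>j, i\<close> with \<open>i < j\<close> is removed. Insertion sort uses
  only such swaps, hence only the coefficients \<open>d\<^sub>i\<^sub>,\<^sub>j\<close> that are
  known to be units.\<close>

lemma sim_swap:
  assumes "j < length xs" "i < j" "w \<in> words"
  shows "j # i # w \<leadsto> i # j # w"
proof -
  have i: "i < length xs" using assms by simp
  obtain d where d: "PBW_coeff A R xs i j d" "d \<in> U" using swap assms by blast
  let ?a = "xs ! j \<otimes> xs ! i" and ?b = "d \<otimes> (xs ! i \<otimes> xs ! j)"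
  have u: "?a \<ominus> ?b \<in> W 2" using d(1) affine_W unfolding PBW_coeff_def by blast
  note c = xs_carrier[OF i] xs_carrier[OF assms(1)] R_carrier[OF U_R[OF d(2)]] mon_carrier[OF assms(3)]
  have "?a = ?b \<oplus> (?a \<ominus> ?b)" using c by (simp add: a_minus_def a_lcomm r_neg)
  have "mon (j # i # w) = ?a \<otimes> mon w" using c by (simp add: m_assoc)
  also have "\<dots> = (?b \<oplus> (?a \<ominus> ?b)) \<otimes> mon w" using \<open>?a = ?b \<oplus> (?a \<ominus> ?b)\<close> by simp
  also have "\<dots> = ?b \<otimes> mon w \<oplus> (?a \<ominus> ?b) \<otimes> mon w"
    using c W_carrier[OF u] by (intro l_distr) auto
  also have "?b \<otimes> mon w = d \<otimes> mon (i # j # w)" using c by (simp add: m_assoc)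
  finally have "mon (j # i # w) = d \<otimes> mon (i # j # w) \<oplus> (?a \<ominus> ?b) \<otimes> mon w" .
  moreover have "(?a \<ominus> ?b) \<otimes> mon w \<in> W (length (j # i # w))"
    using W_mult_mon[OF u assms(3)] by simp
  ultimately show ?thesis using d(2) unfolding sim_def by blast
qed

lemma sim_insort:
  assumes "i < length xs" "w \<in> words"
  shows "i # w \<leadsto> insort i w"
  using assms(2)
proof (induction w)
  case Nil
  then show ?case using assms(1) by (auto intro: sim_refl)
next
  case (Cons j w)
  have w: "w \<in> words" "j < length xs" using Cons by auto
  have ins: "insort i w \<in> words" using w assms by (auto simp: set_insort_key)
  show ?case
  proof (cases "i \<le> j")
    case True
    then show ?thesis using w assms(1) sim_refl[of "i # j # w"] by simp
  next
    case False
    then have "i # j # w \<leadsto> j # i # w" using sim_swap assms(1) w by auto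
    moreover have "j # i # w \<leadsto> j # insort i w" using Cons w ins by (intro sim_Cons) auto
    ultimately have "i # j # w \<leadsto> j # insort i w"
      using ins w by (auto elim!: sim_trans)
    then show ?thesis using False by simp
  qed
qed

lemma sim_sort: "w \<in> words \<Longrightarrow> w \<leadsto> sort w"
proof (induction w)
  case Nil
  then show ?case by (simp add: sim_refl)
next
  case (Cons i w)
  then have "i # w \<leadsto> i # sort w" by (intro sim_Cons) auto
  moreover have "i # sort w \<leadsto> insort i (sort w)" using Cons by (intro sim_insort) auto
  ultimately show ?case
    using Cons.prems by (auto elim!: sim_trans simp: set_insort_key)
qed

section \<open>Leading terms in the degree-lexicographic order\<close>

abbreviation M :: "nat list \<Rightarrow> 'a" where
  "M \<alpha> \<equiv> mon (word_of \<alpha>)"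

lemma word_of_words: "length \<alpha> = length xs \<Longrightarrow> word_of \<alpha> \<in> words"
  using set_word_of[of \<alpha>] by auto

definition low :: "nat list \<Rightarrow> 'a set" where
  "low \<alpha> = lspan A R (M ` {\<beta>. length \<beta> = length xs \<and> (\<beta>, \<alpha>) \<in> deg_lex})"

lemma M_low: "M ` {\<beta>. length \<beta> = length xs \<and> P \<beta>} \<subseteq> carrier A"
  using word_of_words by auto

text \<open>A word is a unit times its sorted word plus shorter words, and the shorter words are
  sorted by induction on the length bound.\<close>

lemma W_subset_lspan:
  "u \<in> W m \<Longrightarrow> u \<in> lspan A R (M ` {\<beta>. length \<beta> = length xs \<and> sum_list \<beta> < m})"
proof (induction m arbitrary: u)
  case 0
  show ?case using 0 by (simp add: W_def)
next
  case (Suc m)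
  let ?Y = "M ` {\<beta>. length \<beta> = length xs \<and> sum_list \<beta> < Suc m}"
  have "mon w \<in> lspan A R ?Y" if w: "w \<in> words" "length w < Suc m" for w
  proof -
    let ?\<beta> = "map (count (mset w)) [0..<length xs]"
    have \<beta>: "sort w = word_of ?\<beta>" using w by (intro sort_eq_word_of) auto
    then have s: "sum_list ?\<beta> = length w" by (metis length_sort length_word_of)
    obtain d u where d: "d \<in> U" "u \<in> W (length w)" "mon w = d \<otimes> M ?\<beta> \<oplus> u"
      using sim_sort[OF w(1)] unfolding \<beta> sim_def by blast
    have "u \<in> W m" using d(2) w by (auto elim!: W_mono)
    then have "u \<in> lspan A R ?Y" by (rule lspan_mono[OF Suc.IH]) auto
    moreover have "M ?\<beta> \<in> ?Y" using s w by (intro imageI) auto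
    ultimately show ?thesis unfolding d(3) using U_R[OF d(1)] by (intro lspan.step) auto
  qed
  then have "mon ` {w \<in> words. length w < Suc m} \<subseteq> lspan A R ?Y" by blast
  then show ?case by (rule lspan_subset[OF Suc.prems[unfolded W_def] subring monW M_low])
qed

text \<open>Degree is compared first, so errors of smaller degree lie below \<open>\<alpha>\<close>
  whatever their exponents are.\<close>

lemma W_subset_low:
  assumes "u \<in> W (sum_list \<alpha>)"
  shows "u \<in> low \<alpha>"
  unfolding low_def by (rule lspan_mono[OF W_subset_lspan[OF assms]]) (auto intro: deg_lexI)

lemma low_carrier: "u \<in> low \<alpha> \<Longrightarrow> u \<in> carrier A"
  unfolding low_def using lspan_carrier R_subset M_low by blast

lemma low_add: "u \<in> low \<alpha> \<Longrightarrow> v \<in> low \<alpha> \<Longrightarrow> u \<oplus> v \<in> low \<alpha>"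
  unfolding low_def by (rule lspan_add) (use R_subset M_low in auto)

lemma low_lmult: "r \<in> R \<Longrightarrow> u \<in> low \<alpha> \<Longrightarrow> r \<otimes> u \<in> low \<alpha>"
  unfolding low_def by (rule lspan_lmult[OF _ _ subring M_low])

lemma low_minus: "u \<in> low \<alpha> \<Longrightarrow> \<ominus> u \<in> low \<alpha>"
  unfolding low_def by (rule lspan_minus[OF _ subring M_low])

lemma low_zero: "\<zero> \<in> low \<alpha>"
  unfolding low_def by (rule lspan.zero)

lemma low_base: "r \<in> R \<Longrightarrow> length \<beta> = length xs \<Longrightarrow> (\<beta>, \<alpha>) \<in> deg_lex \<Longrightarrow> r \<otimes> M \<beta> \<in> low \<alpha>"
  unfolding low_def by (rule lspan_base[OF _ _ R_subset M_low]) auto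

lemma low_trans: "u \<in> low \<beta> \<Longrightarrow> (\<beta>, \<alpha>) \<in> deg_lex \<Longrightarrow> u \<in> low \<alpha>"
  unfolding low_def using transD[OF trans_deg_lex] by (elim lspan_mono) blast

lemma M_mult_R:
  assumes "length \<beta> = length xs" "r \<in> R"
  shows "\<exists>u\<in>low \<beta>. M \<beta> \<otimes> r = sig (word_of \<beta>) r \<otimes> M \<beta> \<oplus> u"
  using mon_mult_R[OF word_of_words[OF assms(1)] assms(2)] W_subset_low by auto

lemma low_mult_R:
  assumes "u \<in> low \<alpha>" "r \<in> R"
  shows "u \<otimes> r \<in> low \<alpha>"
  using assms(1) unfolding low_def
proof (rule lspan_rmult[OF _ R_carrier[OF assms(2)] subring M_low M_low], unfold low_def[symmetric])
  fix x assume "x \<in> M ` {\<beta>. length \<beta> = length xs \<and> (\<beta>, \<alpha>) \<in> deg_lex}"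
  then obtain \<beta> where \<beta>: "x = M \<beta>" "length \<beta> = length xs" "(\<beta>, \<alpha>) \<in> deg_lex" by blast
  show "x \<otimes> r \<in> low \<alpha>"
    using M_mult_R[OF \<beta>(2) assms(2)] \<beta> low_base[OF sig_closed[OF word_of_words[OF \<beta>(2)] assms(2)] \<beta>(2,3)]
      low_add low_trans by auto
qed

text \<open>Appending the letter \<open>i\<close> to a sorted word and sorting again raises the
  exponent of \<open>x\<^sub>i\<close> by one, at the cost of a unit and lower terms.\<close>

lemma M_mult_x:
  assumes "length \<beta> = length xs" "i < length xs"
  shows "\<exists>d\<in>U. \<exists>u\<in>low (incr i \<beta>). M \<beta> \<otimes> xs ! i = d \<otimes> M (incr i \<beta>) \<oplus> u"
proof -
  have w: "word_of \<beta> @ [i] \<in> words" using word_of_words assms by auto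
  have "sort (word_of \<beta> @ [i]) = word_of (incr i \<beta>)" using assms by (intro sort_word_of_snoc) auto
  then obtain d u where d: "d \<in> U" "u \<in> W (Suc (sum_list \<beta>))" "mon (word_of \<beta> @ [i]) = d \<otimes> M (incr i \<beta>) \<oplus> u"
    using sim_sort[OF w] unfolding sim_def by auto
  have "u \<in> low (incr i \<beta>)" using d(2) assms by (intro W_subset_low) (simp add: sum_list_incr)
  moreover have "mon (word_of \<beta> @ [i]) = M \<beta> \<otimes> xs ! i"
    using mon_append[of "word_of \<beta>" "[i]"] word_of_words assms xs_carrier by auto
  ultimately show ?thesis using d by metis
qed

lemma low_mult_x:
  assumes "u \<in> low \<alpha>" "i < length xs" "length \<alpha> = length xs"
  shows "u \<otimes> xs ! i \<in> low (incr i \<alpha>)"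
  unfolding low_def[of "incr i \<alpha>"]
proof (rule lspan_rmult[OF assms(1)[unfolded low_def] xs_carrier[OF assms(2)] subring M_low M_low],
    unfold low_def[symmetric])
  fix x assume "x \<in> M ` {\<beta>. length \<beta> = length xs \<and> (\<beta>, \<alpha>) \<in> deg_lex}"
  then obtain \<beta> where \<beta>: "x = M \<beta>" "length \<beta> = length xs" "(\<beta>, \<alpha>) \<in> deg_lex" by blast
  have "(incr i \<beta>, incr i \<alpha>) \<in> deg_lex" using \<beta> assms by (intro deg_lex_incr) auto
  then show "x \<otimes> xs ! i \<in> low (incr i \<alpha>)"
    using M_mult_x[OF \<beta>(2) assms(2)] \<beta> low_base[of _ "incr i \<beta>" "incr i \<alpha>"] low_add low_trans U_R
    by fastforce
qed

lemma M_carrier: "length \<alpha> = length xs \<Longrightarrow> M \<alpha> \<in> carrier A"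
  using mon_carrier[OF word_of_words] .

text \<open>The order is total on the exponents at hand, so each new summand merges with the top
  term, drops below it or replaces it. Merging may cancel, so the top coefficient \<open>r\<close>
  can be zero.\<close>

lemma top_term:
  assumes "z \<in> lspan A R (M ` S)" "\<And>\<beta>. \<beta> \<in> S \<Longrightarrow> length \<beta> = length xs"
  shows "z = \<zero> \<or> (\<exists>\<beta>\<in>S. \<exists>r\<in>R. \<exists>v\<in>low \<beta>. z = r \<otimes> M \<beta> \<oplus> v)"
  using assms(1)
proof induction
  case zero
  then show ?case by simp
next
  case (step r x u)
  then obtain \<gamma> where \<gamma>: "x = M \<gamma>" "\<gamma> \<in> S" by blast
  note c = R_carrier[OF step(1)] M_carrier[OF assms(2)[OF \<gamma>(2)]]
  from step.IH show ?case
  proof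
    assume "u = \<zero>"
    then show ?thesis using \<gamma> step(1) low_zero by blast
  next
    assume "\<exists>\<beta>\<in>S. \<exists>r\<in>R. \<exists>v\<in>low \<beta>. u = r \<otimes> M \<beta> \<oplus> v"
    then obtain \<beta> s v where \<beta>: "\<beta> \<in> S" "s \<in> R" "v \<in> low \<beta>" "u = s \<otimes> M \<beta> \<oplus> v" by blast
    note c' = R_carrier[OF \<beta>(2)] M_carrier[OF assms(2)[OF \<beta>(1)]] low_carrier[OF \<beta>(3)]
    consider "\<gamma> = \<beta>" | "(\<gamma>, \<beta>) \<in> deg_lex" | "(\<beta>, \<gamma>) \<in> deg_lex"
      using total_deg_lex assms(2) \<gamma> \<beta> by metis
    then show ?thesis
    proof cases
      case 1
      then have "r \<otimes> x \<oplus> u = (r \<oplus> s) \<otimes> M \<beta> \<oplus> v" using \<gamma> \<beta> c c' by (simp add: l_distr a_assoc)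
      then show ?thesis using \<beta> step(1) R_closed by blast
    next
      case 2
      have "r \<otimes> x \<oplus> u = s \<otimes> M \<beta> \<oplus> (r \<otimes> M \<gamma> \<oplus> v)" using \<gamma> \<beta> c c' by (simp add: a_lcomm)
      moreover have "r \<otimes> M \<gamma> \<oplus> v \<in> low \<beta>"
        using step(1) assms(2) \<gamma> 2 \<beta> by (intro low_add low_base) auto
      ultimately show ?thesis using \<beta> by blast
    next
      case 3
      have "s \<otimes> M \<beta> \<oplus> v \<in> low \<gamma>" using assms(2) \<beta> 3 low_trans by (intro low_add low_base) auto
      then show ?thesis using \<gamma> \<beta> step(1) by blast
    qed
  qed
qed

lemma spanning_M: "a \<in> carrier A \<Longrightarrow> a \<in> lspan A R (M ` {\<alpha>. length \<alpha> = length xs})"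
proof -
  assume "a \<in> carrier A"
  then obtain F c where F: "finite F" "F \<subseteq> {\<alpha>. length \<alpha> = length xs}" "c \<in> F \<rightarrow> R"
    and a: "a = (\<Oplus>\<alpha>\<in>F. c \<alpha> \<otimes> PBW_monomial A xs \<alpha>)" using spanning by blast
  show ?thesis unfolding a
    by (rule lspan_finsum) (use F PBW_monomial_eq_mon R_subset M_low[of "\<lambda>_. True"] in auto)
qed

text \<open>The coefficient at \<open>\<alpha>\<close> may be zero, so sums need no case distinction
  on cancellation of leading terms.\<close>

definition lead :: "'a set \<Rightarrow> nat list \<Rightarrow> 'a set" where
  "lead I \<alpha> = {r \<in> R. \<exists>u\<in>low \<alpha>. r \<otimes> M \<alpha> \<oplus> u \<in> I}"

context
  fixes I assumes I: "right_ideal I A"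
begin

lemma lead_right_ideal:
  assumes "length \<alpha> = length xs"
  shows "right_ideal (lead I \<alpha>) (A\<lparr>carrier := R\<rparr>)"
proof (rule ring.right_idealI[OF subring_is_ring[OF subring]], simp_all)
  note D = right_idealD[OF I]
  note cM = M_carrier[OF assms]
  show "lead I \<alpha> \<subseteq> R" by (auto simp: lead_def)
  show "\<zero> \<in> lead I \<alpha>"
    using D(2) low_zero cM R_closed by (auto simp: lead_def intro!: bexI[of _ \<zero>])
  show "r \<oplus> s \<in> lead I \<alpha>" if rs: "r \<in> lead I \<alpha>" "s \<in> lead I \<alpha>" for r s
  proof -
    from rs obtain u v where u: "r \<in> R" "s \<in> R" "u \<in> low \<alpha>" "r \<otimes> M \<alpha> \<oplus> u \<in> I"
      "v \<in> low \<alpha>" "s \<otimes> M \<alpha> \<oplus> v \<in> I" unfolding lead_def by blast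
    have "(r \<otimes> M \<alpha> \<oplus> u) \<oplus> (s \<otimes> M \<alpha> \<oplus> v) = (r \<oplus> s) \<otimes> M \<alpha> \<oplus> (u \<oplus> v)"
      using cM R_carrier[OF u(1)] R_carrier[OF u(2)] low_carrier[OF u(3)] low_carrier[OF u(5)]
      by (simp add: l_distr a_ac)
    then show ?thesis using D(3)[OF u(4,6)] u R_closed low_add[OF u(3,5)] unfolding lead_def by auto
  qed
  show "r \<otimes> s \<in> lead I \<alpha>" if rs: "r \<in> lead I \<alpha>" "s \<in> R" for r s
  proof -
    from rs obtain u where u: "r \<in> R" "u \<in> low \<alpha>" "r \<otimes> M \<alpha> \<oplus> u \<in> I"
      unfolding lead_def by blast
    \<comment> \<open>Right multiplication by \<open>s\<close> itself would produce
      \<open>r \<otimes> sig (word_of \<alpha>) s\<close>; a preimage of \<open>s\<close> under the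
      twist is used instead.\<close>
    obtain s' where s': "s' \<in> R" "sig (word_of \<alpha>) s' = s"
      using sig_surj[OF word_of_words[OF assms] rs(2)] by blast
    obtain v where v: "v \<in> low \<alpha>" "M \<alpha> \<otimes> s' = s \<otimes> M \<alpha> \<oplus> v"
      using M_mult_R[OF assms s'(1)] s' by blast
    note c = cM R_carrier[OF u(1)] low_carrier[OF u(2)] R_carrier[OF s'(1)] R_carrier[OF rs(2)]
      low_carrier[OF v(1)]
    have "(r \<otimes> M \<alpha> \<oplus> u) \<otimes> s' = r \<otimes> (M \<alpha> \<otimes> s') \<oplus> u \<otimes> s'"
      using c by (simp add: l_distr m_assoc)
    also have "\<dots> = (r \<otimes> s) \<otimes> M \<alpha> \<oplus> (r \<otimes> v \<oplus> u \<otimes> s')"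
      unfolding v(2) using c by (simp add: r_distr m_assoc a_assoc)
    finally have "(r \<otimes> s) \<otimes> M \<alpha> \<oplus> (r \<otimes> v \<oplus> u \<otimes> s') \<in> I"
      using D(4)[OF u(3), of s'] c by simp
    moreover have "r \<otimes> v \<oplus> u \<otimes> s' \<in> low \<alpha>"
      using u v s' by (intro low_add low_lmult low_mult_R)
    ultimately show ?thesis using u(1) rs(2) R_closed unfolding lead_def by blast
  qed
qed

lemma lead_incr:
  assumes "length \<alpha> = length xs" "i < length xs"
  shows "lead I \<alpha> \<subseteq> lead I (incr i \<alpha>)"
proof
  fix r assume "r \<in> lead I \<alpha>"
  then obtain u where u: "r \<in> R" "u \<in> low \<alpha>" "r \<otimes> M \<alpha> \<oplus> u \<in> I"
    unfolding lead_def by blast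
  let ?\<beta> = "incr i \<alpha>"
  have \<beta>: "length ?\<beta> = length xs" using assms by simp
  obtain d v where d: "d \<in> U" "v \<in> low ?\<beta>" "M \<alpha> \<otimes> xs ! i = d \<otimes> M ?\<beta> \<oplus> v"
    using M_mult_x[OF assms] by blast
  obtain e where e: "d \<in> R" "e \<in> R" "d \<otimes> e = \<one>" using d(1) unfolding U_iff by blast
  note c = M_carrier[OF assms(1)] M_carrier[OF \<beta>] R_carrier[OF u(1)] low_carrier[OF u(2)]
    R_carrier[OF e(1)] R_carrier[OF e(2)] low_carrier[OF d(2)] xs_carrier[OF assms(2)]
  have "(r \<otimes> M \<alpha> \<oplus> u) \<otimes> xs ! i = r \<otimes> (M \<alpha> \<otimes> xs ! i) \<oplus> u \<otimes> xs ! i"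
    using c by (simp add: l_distr m_assoc)
  also have "\<dots> = (r \<otimes> d) \<otimes> M ?\<beta> \<oplus> (r \<otimes> v \<oplus> u \<otimes> xs ! i)"
    unfolding d(3) using c by (simp add: r_distr m_assoc a_assoc)
  finally have "(r \<otimes> d) \<otimes> M ?\<beta> \<oplus> (r \<otimes> v \<oplus> u \<otimes> xs ! i) \<in> I"
    using right_idealD(4)[OF I u(3), of "xs ! i"] c by simp
  moreover have "r \<otimes> v \<oplus> u \<otimes> xs ! i \<in> low ?\<beta>"
    using u d assms by (intro low_add low_lmult low_mult_x)
  ultimately have "r \<otimes> d \<in> lead I ?\<beta>" using u(1) e(1) R_closed unfolding lead_def by blast
  \<comment> \<open>Multiplication by \<open>x\<^sub>i\<close> has replaced \<open>r\<close> by
    \<open>r \<otimes> d\<close>. As \<open>lead\<close> at the new exponent is a right ideal, the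
    inverse of the unit \<open>d\<close> can be multiplied back from the right.\<close>
  then have "r \<otimes> d \<otimes> e \<in> lead I ?\<beta>"
    using ring.right_idealD(4)[OF subring_is_ring[OF subring] lead_right_ideal[OF \<beta>], of "r \<otimes> d" e] e by simp
  then show "r \<in> lead I ?\<beta>" using c e by (simp add: m_assoc)
qed

end

lemma lead_mono: "I \<subseteq> J \<Longrightarrow> lead I \<alpha> \<subseteq> lead J \<alpha>"
  by (auto simp: lead_def)

text \<open>Division by \<open>I\<close>: an element of \<open>J\<close> is reduced by an element of
  \<open>I\<close> with the same leading coefficient, and the difference is treated by well-founded
  induction on the exponent.\<close>

lemma eq_of_lead_eq:
  assumes I: "right_ideal I A" and J: "right_ideal J A" and "I \<subseteq> J"
    and lead: "\<And>\<alpha>. length \<alpha> = length xs \<Longrightarrow> lead J \<alpha> = lead I \<alpha>"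
  shows "J = I"
proof -
  have *: "z \<in> I" if "length \<alpha> = length xs" "r \<in> R" "v \<in> low \<alpha>" "z = r \<otimes> M \<alpha> \<oplus> v" "z \<in> J"
    for \<alpha> r v z
    using that
  proof (induction \<alpha> arbitrary: r v z rule: wf_induct_rule[OF wf_deg_lex])
    case (1 \<alpha>)
    then have "r \<in> lead J \<alpha>" unfolding lead_def by blast
    \<comment> \<open>An element of \<open>I\<close> with the coefficient \<open>r\<close> at
      \<open>\<alpha>\<close>; its difference \<open>?w\<close> from \<open>z\<close> lies in
      \<open>J\<close> and strictly below \<open>\<alpha>\<close>.\<close>
    then obtain u where u: "u \<in> low \<alpha>" "r \<otimes> M \<alpha> \<oplus> u \<in> I"
      using lead[OF 1(2)] unfolding lead_def by blast
    note c = M_carrier[OF 1(2)] R_carrier[OF 1(3)] low_carrier[OF 1(4)] low_carrier[OF u(1)]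
    let ?w = "v \<oplus> \<ominus> u"
    have w: "?w \<in> low \<alpha>" using 1 u by (intro low_add low_minus)
    have z: "z = (r \<otimes> M \<alpha> \<oplus> u) \<oplus> ?w"
      using c unfolding 1(5) by (simp add: a_assoc) (simp add: a_lcomm[of u] r_neg)
    have "?w = \<ominus> (r \<otimes> M \<alpha> \<oplus> u) \<oplus> z"
      unfolding z using c by (simp add: r_neg1)
    then have "?w \<in> J"
      using right_idealD(3,5)[OF J] u(2) \<open>I \<subseteq> J\<close> 1(6) by auto
    have "?w \<in> I"
    proof -
      have "?w = \<zero> \<or> (\<exists>\<beta>\<in>{\<beta>. length \<beta> = length xs \<and> (\<beta>, \<alpha>) \<in> deg_lex}.
          \<exists>r\<in>R. \<exists>v\<in>low \<beta>. ?w = r \<otimes> M \<beta> \<oplus> v)"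
        using w unfolding low_def[of \<alpha>] by (rule top_term) auto
      then show ?thesis
        using 1(1) \<open>?w \<in> J\<close> right_idealD(2)[OF I] by auto
    qed
    then show ?case unfolding z using u(2) right_idealD(3)[OF I] by blast
  qed
  have "z \<in> I" if "z \<in> J" for z
  proof -
    have "z \<in> carrier A" using that right_idealD(1)[OF J] by blast
    from top_term[OF spanning_M[OF this]] show ?thesis
      using *[of _ _ _ z] that right_idealD(2)[OF I] by auto
  qed
  then show ?thesis using \<open>I \<subseteq> J\<close> by blast
qed

theorem right_noetherian:
  assumes "right_noetherian (A\<lparr>carrier := R\<rparr>)"
  shows "right_noetherian A"
  unfolding right_noetherian_def
proof (intro conjI allI impI ring_axioms, elim conjE)
  fix I :: "nat \<Rightarrow> 'a set"
  assume I: "\<forall>n. right_ideal (I n) A" and mono: "\<forall>n. I n \<subseteq> I (Suc n)"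
  have "\<exists>N. \<forall>\<alpha>. length \<alpha> = length xs \<longrightarrow> (\<forall>m\<ge>N. lead (I m) \<alpha> = lead (I N) \<alpha>)"
  proof (rule chain_stabilizes_uniformly[where Q = "\<lambda>I. right_ideal I (A\<lparr>carrier := R\<rparr>)"])
    fix L :: "nat \<Rightarrow> 'a set"
    assume "\<forall>n. right_ideal (L n) (A\<lparr>carrier := R\<rparr>)" "\<forall>n. L n \<subseteq> L (Suc n)"
    then show "\<exists>N. \<forall>n\<ge>N. L n = L N" using assms unfolding right_noetherian_def by blast
  next
    fix \<alpha> :: "nat list" and m
    assume \<alpha>: "length \<alpha> = length xs"
    show "right_ideal (lead (I m) \<alpha>) (A\<lparr>carrier := R\<rparr>)"
      using I lead_right_ideal[OF _ \<alpha>] by blast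
    show "lead (I m) \<alpha> \<subseteq> lead (I (Suc m)) \<alpha>"
      using mono by (intro lead_mono) blast
    show "lead (I m) \<alpha> \<subseteq> lead (I m) (incr i \<alpha>)" if "i < length xs" for i
      using I lead_incr[OF _ \<alpha> that] by blast
  qed
  then obtain N where N: "\<And>\<alpha> m. length \<alpha> = length xs \<Longrightarrow> m \<ge> N \<Longrightarrow> lead (I m) \<alpha> = lead (I N) \<alpha>"
    by blast
  have "I m = I N" if "m \<ge> N" for m
  proof (rule eq_of_lead_eq)
    show "I N \<subseteq> I m" using lift_Suc_mono_le[of I N m] mono that by blast
    show "right_ideal (I N) A" using I by blast
    show "right_ideal (I m) A" using I by blast
    show "lead (I m) \<alpha> = lead (I N) \<alpha>" if "length \<alpha> = length xs" for \<alpha>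
      using N[OF that \<open>m \<ge> N\<close>] .
  qed
  then show "\<exists>N. \<forall>n\<ge>N. I n = I N" by blast
qed

end

theorem Hilbert_basis_bijective_skew_PBW:
  assumes "skew_PBW A R xs" "PBW_bijective A R xs" "right_noetherian (A\<lparr>carrier := R\<rparr>)"
  shows "right_noetherian A"
proof -
  obtain \<sigma> \<delta> where \<sigma>: "\<And>i. i < length xs \<Longrightarrow> skew_maps A R (xs ! i) (\<sigma> i) (\<delta> i) \<and> bij_betw (\<sigma> i) R R"
    using assms(2) unfolding PBW_bijective_def by metis
  have "bijective_PBW_data A R xs \<sigma> \<delta>"
    using assms \<sigma> unfolding bijective_PBW_data_def bijective_PBW_data_axioms_def
    by (simp add: skew_PBW_def PBW_bijective_def free_left_basis_def)
  then show ?thesis by (rule bijective_PBW_data.right_noetherian) (rule assms(3))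
qed


section \<open>The free algebra\<close>

lemma ring_ring_of_type_algebra: "ring (ring_of_type_algebra :: 'a :: ring_1 ring)"
proof -
  have "\<exists>y. x + y = 0" for x :: 'a
    using add.right_inverse by blast
  then show ?thesis
    unfolding ring_of_type_algebra_def using add.right_inverse
    by unfold_locales (auto simp: algebra_simps Units_def)
qed

lemma ring_of_type_algebra_simps [simp]:
  "carrier ring_of_type_algebra = UNIV"
  "a \<otimes>\<^bsub>ring_of_type_algebra\<^esub> b = a * b"
  "a \<oplus>\<^bsub>ring_of_type_algebra\<^esub> b = a + b"
  "\<one>\<^bsub>ring_of_type_algebra\<^esub> = 1"
  "\<zero>\<^bsub>ring_of_type_algebra\<^esub> = 0"
  by (simp_all add: ring_of_type_algebra_def)

lemma a_inv_ring_of_type_algebra [simp]: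
  "\<ominus>\<^bsub>ring_of_type_algebra\<^esub> a = - (a :: 'a :: ring_1)"
proof -
  interpret ring "ring_of_type_algebra :: 'a ring" by (rule ring_ring_of_type_algebra)
  show ?thesis using minus_equality[of "- a" a] by simp
qed

lemma a_minus_ring_of_type_algebra [simp]:
  "a \<ominus>\<^bsub>ring_of_type_algebra\<^esub> b = a - (b :: 'a :: ring_1)"
  by (simp add: a_minus_def)

lemma poly_mapping_single_induct [case_names single add]:
  fixes u :: "'a \<Rightarrow>\<^sub>0 'b :: comm_monoid_add"
  assumes "\<And>w c. P (Poly_Mapping.single w c)" "\<And>u v. P u \<Longrightarrow> P v \<Longrightarrow> P (u + v)"
  shows "P u"
proof (induction u rule: update_induct)
  case const
  show ?case using assms(1)[of _ 0] by simp
next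
  case (update f a b)
  have "Poly_Mapping.update a b f = f + Poly_Mapping.single a b"
    using update(1)
    by (intro poly_mapping_eqI) (auto simp: lookup_update lookup_add lookup_single when_def in_keys_iff)
  then show ?case using assms update by simp
qed

lemma fconst_0 [simp]: "fconst 0 = 0"
  and fconst_1 [simp]: "fconst 1 = 1"
  by (simp_all add: fconst_def)

lemma fconst_add: "fconst (c + d) = fconst c + fconst d"
  and fconst_mult: "fconst (c * d) = fconst c * fconst d"
  by (simp_all add: fconst_def single_add mult_single)

lemma fconst_uminus: "fconst (- c) = - fconst c"
  by (simp add: fconst_def single_uminus)

lemma fconst_commute: "fconst c * u = u * fconst c"
  by (induction u rule: poly_mapping_single_induct)
    (simp_all add: fconst_def mult_single mult.commute algebra_simps)

lemma fconst_left_commute: "u * (fconst c * v) = fconst c * (u * v)"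
  by (metis fconst_commute mult.assoc)

text \<open>Words are built by multiplying letters on the left, which suits the left action defined
  below.\<close>

lemma free_alg_induct [case_names one add const var]:
  fixes u :: "('g, 'k :: field) free_alg"
  assumes one: "P 1" and add: "\<And>u v. P u \<Longrightarrow> P v \<Longrightarrow> P (u + v)"
    and const: "\<And>c u. P u \<Longrightarrow> P (fconst c * u)" and var: "\<And>g u. P u \<Longrightarrow> P (fvar g * u)"
  shows "P u"
proof (induction u rule: poly_mapping_single_induct)
  case (single w c)
  have "P (Poly_Mapping.single (Word l) 1)" for l
  proof (induction l)
    case Nil
    then show ?case using one by (metis single_one zero_free_word_def)
  next
    case (Cons g l)
    have "Poly_Mapping.single (Word (g # l)) 1 = fvar g * Poly_Mapping.single (Word l) (1 :: 'k)"
      by (simp add: fvar_def mult_single plus_free_word_def)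
    then show ?case using var Cons by simp
  qed
  from const[OF this[of "letters w"], of c] show ?case by (simp add: fconst_def mult_single)
qed (rule add)

lemma feval_eq_sum:
  assumes "Polynomial.degree p \<le> n"
  shows "feval p a = (\<Sum>i\<le>n. fconst (Polynomial.coeff p i) * a ^ i)"
  unfolding feval_def
  by (rule sum.mono_neutral_left) (use assms in \<open>auto simp: Polynomial.coeff_eq_0\<close>)

lemma feval_0 [simp]: "feval 0 a = 0"
  by (simp add: feval_def)

lemma feval_pCons [simp]: "feval (pCons c p) a = fconst c + a * feval p a"
proof -
  have "feval (pCons c p) a = (\<Sum>i\<le>Suc (Polynomial.degree p). fconst (Polynomial.coeff (pCons c p) i) * a ^ i)"
    by (rule feval_eq_sum) (rule degree_pCons_le)
  also have "\<dots> = fconst c + (\<Sum>i\<le>Polynomial.degree p. fconst (Polynomial.coeff p i) * a ^ Suc i)"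
    by (subst sum.atMost_Suc_shift) simp
  also have "\<dots> = fconst c + a * feval p a"
    by (simp add: feval_def sum_distrib_left fconst_left_commute)
  finally show ?thesis .
qed

lemma feval_1 [simp]: "feval 1 a = 1"
  by (simp add: one_pCons)

lemma feval_add: "feval (p + q) a = feval p a + feval q a"
  by (induction p q rule: poly_induct2) (simp_all add: fconst_add algebra_simps)

lemma feval_smult: "feval (Polynomial.smult c p) a = fconst c * feval p a"
  by (induction p) (simp_all add: fconst_mult distrib_left fconst_left_commute)

lemma feval_mult: "feval (p * q) a = feval p a * feval q a"
  by (induction p) (simp_all add: feval_add feval_smult algebra_simps)

lemma feval_uminus: "feval (- p) a = - feval p a"
  using feval_smult[of "- 1" p a] by (simp add: fconst_uminus)

lemma feval_diff: "feval (p - q) a = feval p a - feval q a"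
  using feval_add[of p "- q" a] by (simp add: feval_uminus)


section \<open>A representation of the generalized Heisenberg algebra\<close>

text \<open>The iterates of \<open>f\<close> under composition, starting with the polynomial
  \<open>t\<close>. They arise from \<open>p(t) x^a = x^a p(f^a(t))\<close>.\<close>

primrec fiter :: "'k :: field poly \<Rightarrow> nat \<Rightarrow> 'k poly" where
  "fiter f 0 = [:0, 1:]"
| "fiter f (Suc n) = pcompose f (fiter f n)"

text \<open>The recursion puts \<open>f\<close> outermost; since iterates of \<open>f\<close>
  commute, it may also be innermost, the form that moving one more \<open>x\<close> or
  \<open>y\<close> produces.\<close>

lemma pcompose_fiter: "pcompose (fiter f n) f = fiter f (Suc n)"
  by (induction n) (simp_all add: pcompose_pCons pcompose_assoc[symmetric])

lemma pcompose_fiter': "pcompose (pcompose p (fiter f n)) f = pcompose p (fiter f (Suc n))"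
  by (simp only: pcompose_assoc[symmetric] pcompose_fiter)

text \<open>The array \<open>m\<close> stands for the formal sum of the elements \<open>x\<^sup>a r(t) y\<^sup>k\<close> with
  \<open>r = m a k\<close>, and \<open>gop f g\<close> is left multiplication by the generator \<open>g\<close>.\<close>

primrec gop :: "'k :: field poly \<Rightarrow> heis_gen \<Rightarrow> (nat \<Rightarrow> nat \<Rightarrow> 'k poly) \<Rightarrow> nat \<Rightarrow> nat \<Rightarrow> 'k poly" where
  "gop f GX = (\<lambda>m a k. case a of 0 \<Rightarrow> 0 | Suc a' \<Rightarrow> m a' k)"
| "gop f GT = (\<lambda>m a k. fiter f a * m a k)"
| "gop f GY = (\<lambda>m a k. (case k of 0 \<Rightarrow> 0 | Suc k' \<Rightarrow> pcompose (m a k') f) +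
      (fiter f (Suc a) - [:0, 1:]) * m (Suc a) k)"

lemma gop_add: "gop f g (\<lambda>a k. m a k + n a k) = (\<lambda>a k. gop f g m a k + gop f g n a k)"
  by (cases g) (auto simp: fun_eq_iff algebra_simps pcompose_add split: nat.split)

lemma gop_smult:
  "gop f g (\<lambda>a k. Polynomial.smult c (m a k)) = (\<lambda>a k. Polynomial.smult c (gop f g m a k))"
  by (cases g) (auto simp: fun_eq_iff algebra_simps pcompose_smult smult_add_right smult_diff_right
      split: nat.split)

definition act :: "'k :: field poly \<Rightarrow> (heis_gen, 'k) free_alg \<Rightarrow> (nat \<Rightarrow> nat \<Rightarrow> 'k poly) \<Rightarrow>
    nat \<Rightarrow> nat \<Rightarrow> 'k poly" where
  "act f u m a k = (\<Sum>w\<in>Poly_Mapping.keys u.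
     Polynomial.smult (Poly_Mapping.lookup u w) (foldr (gop f) (letters w) m a k))"

lemma act_single: "act f (Poly_Mapping.single w c) m a k =
    Polynomial.smult c (foldr (gop f) (letters w) m a k)"
  by (simp add: act_def)

lemma act_add: "act f (u + v) m = (\<lambda>a k. act f u m a k + act f v m a k)"
proof (intro ext)
  fix a k
  let ?g = "\<lambda>u w. Polynomial.smult (Poly_Mapping.lookup u w) (foldr (gop f) (letters w) m a k)"
  let ?S = "Poly_Mapping.keys u \<union> Poly_Mapping.keys v"
  have *: "act f u' m a k = (\<Sum>w\<in>?S. ?g u' w)" if "Poly_Mapping.keys u' \<subseteq> ?S" for u'
    unfolding act_def by (rule sum.mono_neutral_left) (use that in \<open>auto simp: in_keys_iff\<close>)
  have "act f (u + v) m a k = (\<Sum>w\<in>?S. ?g (u + v) w)"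
    by (rule *) (rule keys_add)
  also have "\<dots> = act f u m a k + act f v m a k"
    by (simp add: * lookup_add smult_add_left sum.distrib)
  finally show "act f (u + v) m a k = act f u m a k + act f v m a k" .
qed

lemma act_fconst_mult: "act f (fconst c * u) m = (\<lambda>a k. Polynomial.smult c (act f u m a k))"
proof (induction u rule: poly_mapping_single_induct)
  case (single w d)
  then show ?case by (simp add: fconst_def mult_single act_single fun_eq_iff)
next
  case (add u v)
  then show ?case by (simp add: distrib_left act_add smult_add_right)
qed

lemma act_fvar_mult: "act f (fvar g * u) m = gop f g (act f u m)"
proof (induction u rule: poly_mapping_single_induct)
  case (single w d)
  have "act f (Poly_Mapping.single w d) m = (\<lambda>a k. Polynomial.smult d (foldr (gop f) (letters w) m a k))"
    by (simp add: act_single fun_eq_iff)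
  then show ?case by (simp add: fvar_def mult_single act_single fun_eq_iff plus_free_word_def gop_smult)
next
  case (add u v)
  then show ?case by (simp add: distrib_left act_add gop_add)
qed

lemma act_1 [simp]: "act f 1 m = m"
  by (simp add: single_one[symmetric] act_single fun_eq_iff zero_free_word_def del: single_one)

lemma act_0 [simp]: "act f 0 m = (\<lambda>a k. 0)"
  by (simp add: act_def fun_eq_iff)

lemma act_mult: "act f (u * v) m = act f u (act f v m)"
  by (induction u rule: free_alg_induct)
    (simp_all add: distrib_right act_add act_fconst_mult act_fvar_mult mult.assoc)

lemma act_fconst [simp]: "act f (fconst c) m = (\<lambda>a k. Polynomial.smult c (m a k))"
  using act_fconst_mult[of f c 1] by simp

lemma act_fvar [simp]: "act f (fvar g) m = gop f g m"
  using act_fvar_mult[of f g 1] by simp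

lemma act_diff: "act f (u - v) m = (\<lambda>a k. act f u m a k - act f v m a k)"
  using act_add[of f "u - v" v m] by (simp add: fun_eq_iff)

lemma act_feval: "act f (feval p (fvar GT)) m a k = pcompose p (fiter f a) * m a k"
  by (induction p) (simp_all add: act_add act_mult pcompose_pCons algebra_simps)

text \<open>The operators satisfy the defining relations. In the third one, at first exponent
  \<open>a\<close>, the factors \<open>f^(a+1) - t\<close> from \<open>yx\<close> and
  \<open>f^a - t\<close> from \<open>xy\<close> leave \<open>f^(a+1) - f^a\<close>, which is how
  \<open>f - t\<close> acts there; for \<open>a = 0\<close> the second factor vanishes.\<close>

lemma act_relators:
  assumes "u \<in> heis_relators f"
  shows "act f u m a k = 0"
proof -
  let ?x = "fvar GX" and ?y = "fvar GY" and ?t = "fvar GT" and ?ft = "feval f (fvar GT)"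
  consider "u = ?t * ?x - ?x * ?ft" | "u = ?y * ?t - ?ft * ?y" | "u = (?y * ?x - ?x * ?y) - (?ft - ?t)"
    using assms unfolding heis_relators_def Let_def by blast
  then show ?thesis
  proof cases
    case 1
    show ?thesis unfolding 1 by (auto simp: act_diff act_mult act_feval split: nat.split)
  next
    case 2
    show ?thesis unfolding 2
      by (auto simp: act_diff act_mult act_feval pcompose_mult pcompose_fiter algebra_simps split: nat.split)
  next
    case 3
    show ?thesis unfolding 3 act_diff act_mult
      by (auto simp: act_diff act_mult act_feval pcompose_mult pcompose_diff pcompose_fiter
          pcompose_pCons algebra_simps split: nat.split)
  qed
qed

lemma ideal_heis_ideal: "ideal (heis_ideal f) ring_of_type_algebra"
  unfolding heis_ideal_def by (rule ring.genideal_ideal[OF ring_ring_of_type_algebra]) simp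

lemma relators_subset: "heis_relators f \<subseteq> heis_ideal f"
  unfolding heis_ideal_def by (rule ring.genideal_self[OF ring_ring_of_type_algebra]) simp

lemma heis_ideal_closed:
  shows "0 \<in> heis_ideal f"
    and "u \<in> heis_ideal f \<Longrightarrow> v \<in> heis_ideal f \<Longrightarrow> u + v \<in> heis_ideal f"
    and "u \<in> heis_ideal f \<Longrightarrow> - u \<in> heis_ideal f"
    and "u \<in> heis_ideal f \<Longrightarrow> a * u * b \<in> heis_ideal f"
proof -
  interpret ideal "heis_ideal f" ring_of_type_algebra by (rule ideal_heis_ideal)
  show "0 \<in> heis_ideal f" using additive_subgroup.zero_closed[OF is_additive_subgroup] by simp
  show "u \<in> heis_ideal f \<Longrightarrow> v \<in> heis_ideal f \<Longrightarrow> u + v \<in> heis_ideal f" using additive_subgroup.a_closed[OF is_additive_subgroup, of u v] by simp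
  show "u \<in> heis_ideal f \<Longrightarrow> - u \<in> heis_ideal f" using additive_subgroup.a_inv_closed[OF is_additive_subgroup, of u] by simp
  show "u \<in> heis_ideal f \<Longrightarrow> a * u * b \<in> heis_ideal f"
    using I_r_closed[of "a * u" b] I_l_closed[of u a] by simp
qed

text \<open>The annihilator of a module is a two-sided ideal; this one contains the
  relators.\<close>

lemma act_heis_ideal:
  assumes "u \<in> heis_ideal f"
  shows "act f u m a k = 0"
proof -
  let ?I = "{u. \<forall>m. act f u m = (\<lambda>a k. 0)}"
  interpret ring "ring_of_type_algebra :: (heis_gen, 'a) free_alg ring"
    by (rule ring_ring_of_type_algebra)
  have minus: "act f (- u) m = (\<lambda>a k. 0)" if "u \<in> ?I" for u m
    using act_diff[of f 0 u m] that by simp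
  have 0: "act f v (\<lambda>a k. 0) = (\<lambda>a k. 0)" for v
    using act_mult[of f v 0 "\<lambda>a k. 0"] by simp
  have "subgroup ?I (add_monoid ring_of_type_algebra)"
  proof (rule add.subgroupI)
    show "\<ominus>\<^bsub>ring_of_type_algebra\<^esub> u \<in> ?I" if "u \<in> ?I" for u
      using minus[OF that] by simp
  qed (auto simp: act_add intro: exI[of _ 0])
  then have "ideal ?I ring_of_type_algebra"
    by (rule idealI[OF ring_axioms]) (simp_all add: act_mult 0)
  then have "heis_ideal f \<subseteq> ?I" unfolding heis_ideal_def
    by (intro ring.genideal_minimal[OF ring_ring_of_type_algebra]) (auto simp: act_relators fun_eq_iff)
  then show ?thesis using assms by fastforce
qed

text \<open>Computations take place on representatives in the free algebra; cosets return only once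
  normal forms are available.\<close>

definition cong :: "'k :: field poly \<Rightarrow> (heis_gen, 'k) free_alg \<Rightarrow> (heis_gen, 'k) free_alg \<Rightarrow> bool" where
  "cong f u v \<longleftrightarrow> u - v \<in> heis_ideal f"

lemma cong_refl [simp]: "cong f u u"
  by (simp add: cong_def heis_ideal_closed)

lemma cong_sym: "cong f u v \<Longrightarrow> cong f v u"
  unfolding cong_def using heis_ideal_closed(3)[of "u - v"] by simp

lemma cong_trans [trans]: "cong f u v \<Longrightarrow> cong f v w \<Longrightarrow> cong f u w"
  unfolding cong_def using heis_ideal_closed(2)[of "u - v" f "v - w"] by simp

lemma cong_add: "cong f u v \<Longrightarrow> cong f u' v' \<Longrightarrow> cong f (u + u') (v + v')"
  unfolding cong_def using heis_ideal_closed(2)[of "u - v" f "u' - v'"] by (simp add: algebra_simps)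

lemma cong_mult_both: "cong f u v \<Longrightarrow> cong f (a * u * b) (a * v * b)"
  unfolding cong_def using heis_ideal_closed(4)[of "u - v" f a b] by (simp add: algebra_simps)

lemma cong_lmult: "cong f u v \<Longrightarrow> cong f (a * u) (a * v)"
  using cong_mult_both[of f u v a 1] by simp

lemma cong_rmult: "cong f u v \<Longrightarrow> cong f (u * b) (v * b)"
  using cong_mult_both[of f u v 1 b] by simp

lemma cong_sum: "(\<And>i. i \<in> I \<Longrightarrow> cong f (u i) (v i)) \<Longrightarrow> cong f (sum u I) (sum v I)"
  by (induction I rule: infinite_finite_induct) (auto intro: cong_add)

section \<open>Straightening rules and normal forms \<open>x^a p(t) y^k\<close>\<close>

abbreviation gx :: "(heis_gen, 'k :: field) free_alg" where "gx \<equiv> fvar GX"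
abbreviation gy :: "(heis_gen, 'k :: field) free_alg" where "gy \<equiv> fvar GY"
abbreviation gt :: "(heis_gen, 'k :: field) free_alg" where "gt \<equiv> fvar GT"
abbreviation tpoly :: "'k :: field poly \<Rightarrow> (heis_gen, 'k) free_alg" where "tpoly p \<equiv> feval p gt"

lemma cong_relations:
  shows "cong f (gt * gx) (gx * tpoly f)"
    and "cong f (gy * gt) (tpoly f * gy)"
    and "cong f (gy * gx) (gx * gy + tpoly (f - [:0, 1:]))"
  using relators_subset[of f] unfolding heis_relators_def Let_def cong_def
  by (simp_all add: feval_diff algebra_simps)

lemma tpoly_gx: "cong f (tpoly p * gx) (gx * tpoly (pcompose p f))"
proof (induction p)
  case 0
  then show ?case by simp
next
  case (pCons c p)
  have "tpoly (pCons c p) * gx = fconst c * gx + gt * (tpoly p * gx)"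
    by (simp add: distrib_right mult.assoc)
  also have "cong f \<dots> (fconst c * gx + gt * (gx * tpoly (pcompose p f)))"
    by (intro cong_add cong_lmult pCons.IH cong_refl)
  also have "fconst c * gx + gt * (gx * tpoly (pcompose p f)) = fconst c * gx + gt * gx * tpoly (pcompose p f)"
    by (simp add: mult.assoc)
  also have "cong f \<dots> (fconst c * gx + gx * tpoly f * tpoly (pcompose p f))"
    by (intro cong_add cong_rmult cong_relations cong_refl)
  also have "fconst c * gx + gx * tpoly f * tpoly (pcompose p f) = gx * tpoly (pcompose (pCons c p) f)"
    by (simp add: pcompose_pCons feval_add feval_mult distrib_left mult.assoc fconst_commute)
  finally show ?case .
qed

lemma gy_tpoly: "cong f (gy * tpoly p) (tpoly (pcompose p f) * gy)"
proof (induction p)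
  case 0
  then show ?case by simp
next
  case (pCons c p)
  have "gy * tpoly (pCons c p) = fconst c * gy + gy * gt * tpoly p"
    by (simp add: distrib_left mult.assoc fconst_commute)
  also have "cong f \<dots> (fconst c * gy + tpoly f * gy * tpoly p)"
    by (intro cong_add cong_rmult cong_relations cong_refl)
  also have "fconst c * gy + tpoly f * gy * tpoly p = fconst c * gy + tpoly f * (gy * tpoly p)"
    by (simp add: mult.assoc)
  also have "cong f \<dots> (fconst c * gy + tpoly f * (tpoly (pcompose p f) * gy))"
    by (intro cong_add cong_lmult pCons.IH cong_refl)
  also have "fconst c * gy + tpoly f * (tpoly (pcompose p f) * gy) = tpoly (pcompose (pCons c p) f) * gy"
    by (simp add: pcompose_pCons feval_add feval_mult distrib_right mult.assoc)
  finally show ?case .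
qed

lemma tpoly_gx_power: "cong f (tpoly p * gx ^ a) (gx ^ a * tpoly (pcompose p (fiter f a)))"
proof (induction a)
  case (Suc a)
  have "tpoly p * gx ^ Suc a = tpoly p * gx ^ a * gx"
    by (simp add: mult.assoc power_commutes)
  also have "cong f \<dots> (gx ^ a * tpoly (pcompose p (fiter f a)) * gx)"
    by (intro cong_rmult Suc.IH)
  also have "gx ^ a * tpoly (pcompose p (fiter f a)) * gx = gx ^ a * (tpoly (pcompose p (fiter f a)) * gx)"
    by (simp add: mult.assoc)
  also have "cong f \<dots> (gx ^ a * (gx * tpoly (pcompose (pcompose p (fiter f a)) f)))"
    by (intro cong_lmult tpoly_gx)
  also have "gx ^ a * (gx * tpoly (pcompose (pcompose p (fiter f a)) f)) =
      gx ^ Suc a * tpoly (pcompose p (fiter f (Suc a)))"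
    by (simp only: pcompose_fiter' power_Suc2 mult.assoc)
  finally show ?case .
qed simp

lemma gy_gx_power:
  "cong f (gy * gx ^ Suc a) (gx ^ Suc a * gy + gx ^ a * tpoly (fiter f (Suc a) - [:0, 1:]))"
proof (induction a)
  case 0
  then show ?case using cong_relations(3)[of f] by simp
next
  case (Suc a)
  let ?p = "fiter f (Suc a) - [:0, 1:]" and ?x = "gx ^ Suc a"
  have "gy * gx ^ Suc (Suc a) = gy * ?x * gx"
    by (simp add: mult.assoc power_commutes)
  also have "cong f \<dots> ((?x * gy + gx ^ a * tpoly ?p) * gx)"
    by (intro cong_rmult Suc.IH)
  also have "(?x * gy + gx ^ a * tpoly ?p) * gx = ?x * (gy * gx) + gx ^ a * (tpoly ?p * gx)"
    by (simp add: distrib_right mult.assoc)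
  also have "cong f \<dots> (?x * (gx * gy + tpoly (f - [:0, 1:])) + gx ^ a * (gx * tpoly (pcompose ?p f)))"
    by (intro cong_add cong_lmult cong_relations tpoly_gx)
  also have "?x * (gx * gy + tpoly (f - [:0, 1:])) + gx ^ a * (gx * tpoly (pcompose ?p f)) =
      gx ^ Suc (Suc a) * gy + ?x * (tpoly (f - [:0, 1:]) + tpoly (pcompose ?p f))"
    by (simp only: power_Suc2 distrib_left mult.assoc add.assoc)
  \<comment> \<open>The sum telescopes because substituting \<open>f\<close> into \<open>t\<close>
    gives \<open>f\<close>, which cancels the \<open>f\<close> of the first summand.\<close>
  also have "tpoly (f - [:0, 1:]) + tpoly (pcompose ?p f) = tpoly (fiter f (Suc (Suc a)) - [:0, 1:])"
  proof -
    have "pcompose [:0, 1:] f = f" by (simp add: pcompose_pCons)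
    moreover have "f - u + (v - f) = v - u" for u v :: "'a poly" by simp
    ultimately show ?thesis by (simp only: feval_add[symmetric] pcompose_diff pcompose_fiter)
  qed
  finally show ?case .
qed

definition bas :: "nat \<Rightarrow> 'k :: field poly \<Rightarrow> nat \<Rightarrow> (heis_gen, 'k) free_alg" where
  "bas a p k = gx ^ a * tpoly p * gy ^ k"

lemma bas_0 [simp]: "bas a 0 k = 0"
  by (simp add: bas_def)

lemma bas_add: "bas a (p + q) k = bas a p k + bas a q k"
  by (simp add: bas_def feval_add algebra_simps)

lemma fconst_bas: "fconst c * bas a p k = bas a (Polynomial.smult c p) k"
  by (simp add: bas_def feval_smult mult.assoc fconst_left_commute)

lemma gx_bas: "gx * bas a p k = bas (Suc a) p k"
  by (simp add: bas_def mult.assoc)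

lemma tpoly_bas: "cong f (tpoly q * bas a p k) (bas a (pcompose q (fiter f a) * p) k)"
  using cong_rmult[OF tpoly_gx_power[of f q a], of "tpoly p * gy ^ k"]
  by (simp add: bas_def mult.assoc feval_mult)

lemma gt_bas: "cong f (gt * bas a p k) (bas a (fiter f a * p) k)"
  using tpoly_bas[of f "[:0, 1:]" a p k] by (simp add: pcompose_pCons)

lemma gy_tpoly_gy_power: "cong f (gy * tpoly p * gy ^ k) (tpoly (pcompose p f) * gy ^ Suc k)"
  using cong_rmult[OF gy_tpoly[of f p], of "gy ^ k"] by (simp add: mult.assoc)

lemma gy_bas_0: "cong f (gy * bas 0 p k) (bas 0 (pcompose p f) (Suc k))"
  using gy_tpoly_gy_power[of f p k] by (simp add: bas_def mult.assoc)

lemma gy_bas_Suc: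
  "cong f (gy * bas (Suc a) p k)
     (bas (Suc a) (pcompose p f) (Suc k) + bas a ((fiter f (Suc a) - [:0, 1:]) * p) k)"
proof -
  let ?q = "fiter f (Suc a) - [:0, 1:]"
  have "gy * bas (Suc a) p k = gy * gx ^ Suc a * (tpoly p * gy ^ k)"
    by (simp add: bas_def mult.assoc)
  also have "cong f \<dots> ((gx ^ Suc a * gy + gx ^ a * tpoly ?q) * (tpoly p * gy ^ k))"
    by (intro cong_rmult gy_gx_power)
  also have "(gx ^ Suc a * gy + gx ^ a * tpoly ?q) * (tpoly p * gy ^ k) =
      gx ^ Suc a * (gy * tpoly p * gy ^ k) + bas a (?q * p) k"
    by (simp only: bas_def feval_mult mult.assoc distrib_right)
  also have "cong f \<dots> (gx ^ Suc a * (tpoly (pcompose p f) * gy ^ Suc k) + bas a (?q * p) k)"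
    by (intro cong_add cong_lmult gy_tpoly_gy_power cong_refl)
  also have "gx ^ Suc a * (tpoly (pcompose p f) * gy ^ Suc k) = bas (Suc a) (pcompose p f) (Suc k)"
    by (simp only: bas_def mult.assoc)
  finally show ?thesis .
qed

definition unit_array :: "nat \<Rightarrow> 'k :: field poly \<Rightarrow> nat \<Rightarrow> nat \<Rightarrow> nat \<Rightarrow> 'k poly" where
  "unit_array i p j = (\<lambda>a k. if a = i \<and> k = j then p else 0)"

text \<open>The array of \<open>1\<close> acted upon by \<open>u\<close>; by \<open>nf_bas\<close>
  and \<open>cong_normal_form\<close> its entries are the coordinates of \<open>u\<close> with
  respect to \<open>x^a p(t) y^k\<close>.\<close>

definition nf :: "'k :: field poly \<Rightarrow> (heis_gen, 'k) free_alg \<Rightarrow> nat \<Rightarrow> nat \<Rightarrow> 'k poly" where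
  "nf f u = act f u (unit_array 0 1 0)"

lemma nf_add: "nf f (u + v) = (\<lambda>a k. nf f u a k + nf f v a k)"
  by (simp add: nf_def act_add)

lemma nf_0 [simp]: "nf f 0 = (\<lambda>a k. 0)"
  by (simp add: nf_def)

lemma nf_diff: "nf f (u - v) = (\<lambda>a k. nf f u a k - nf f v a k)"
  by (simp add: nf_def act_diff)

lemma nf_sum: "nf f (sum u I) a k = (\<Sum>i\<in>I. nf f (u i) a k)"
  by (induction I rule: infinite_finite_induct) (auto simp: nf_add)

lemma nf_mult: "nf f (u * v) = act f u (nf f v)"
  by (simp add: nf_def act_mult)

text \<open>The factors act from right to left: powers of \<open>y\<close> and polynomials in
  \<open>t\<close> act while the array still lives in row \<open>0\<close>, where \<open>t\<close>
  is plain multiplication and the correction term of \<open>y\<close> vanishes.\<close>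

lemma nf_bas: "nf f (bas i p j) = unit_array i p j"
proof -
  have y: "act f (gy ^ j) (unit_array 0 1 0) = unit_array 0 1 j"
    by (induction j)
      (auto simp: act_mult unit_array_def fun_eq_iff pcompose_1 split: nat.split)
  have t: "act f (tpoly p) (unit_array 0 1 j) = unit_array 0 p j"
    by (auto simp: act_feval unit_array_def fun_eq_iff)
  have x: "act f (gx ^ i) (unit_array 0 p j) = unit_array i p j"
    by (induction i) (auto simp: act_mult unit_array_def fun_eq_iff split: nat.split)
  show ?thesis by (simp add: nf_def bas_def act_mult y t x)
qed

lemma nf_cong: "cong f u v \<Longrightarrow> nf f u = nf f v"
  unfolding cong_def nf_def using act_heis_ideal[of "u - v" f] by (simp add: act_diff fun_eq_iff)

text \<open>The range of summation is only required to be large enough, so that two elements can be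
  given the same range when they are added.\<close>

lemma cong_normal_form:
  "\<exists>N. \<forall>n\<ge>N. cong f u (\<Sum>a<n. \<Sum>k<n. bas a (nf f u a k) k)"
proof -
  define P where "P = (\<lambda>u. \<exists>N. \<forall>n\<ge>N. cong f u (\<Sum>a<n. \<Sum>k<n. bas a (nf f u a k) k))"
  have bas: "P (bas i p j)" for i p j
    unfolding P_def
  proof (intro exI[of _ "Suc (max i j)"] allI impI)
    fix n assume n: "Suc (max i j) \<le> n"
    have "(\<Sum>a<n. \<Sum>k<n. bas a (nf f (bas i p j) a k) k) =
        (\<Sum>a<n. \<Sum>k<n. if a = i then if k = j then bas i p j else 0 else 0)"
      by (intro sum.cong) (auto simp: nf_bas unit_array_def)
    also have "\<dots> = (\<Sum>a<n. if a = i then \<Sum>k<n. if k = j then bas i p j else 0 else 0)"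
      by (intro sum.cong) auto
    also have "\<dots> = bas i p j" proof -
      have "i < n" "j < n" using n by auto
      then show ?thesis by simp
    qed
    finally show "cong f (bas i p j) (\<Sum>a<n. \<Sum>k<n. bas a (nf f (bas i p j) a k) k)" by simp
  qed
  have add: "P (u + v)" if uv: "P u" "P v" for u v
  proof -
    obtain N N' where N: "\<And>n. n \<ge> N \<Longrightarrow> cong f u (\<Sum>a<n. \<Sum>k<n. bas a (nf f u a k) k)"
      "\<And>n. n \<ge> N' \<Longrightarrow> cong f v (\<Sum>a<n. \<Sum>k<n. bas a (nf f v a k) k)"
      using uv unfolding P_def by blast
    have "cong f (u + v) (\<Sum>a<n. \<Sum>k<n. bas a (nf f (u + v) a k) k)" if "n \<ge> max N N'" for n
      using cong_add[OF N(1)[of n] N(2)[of n]] that by (simp add: nf_add bas_add sum.distrib)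
    then show ?thesis unfolding P_def by (intro exI[of _ "max N N'"]) blast
  qed
  have 0: "P 0" using bas[of 0 0 0] by simp
  have sum: "P (sum u I)" if "\<And>i. i \<in> I \<Longrightarrow> P (u i)" for u and I :: "nat set"
    using that by (induction I rule: infinite_finite_induct) (auto intro: add 0)
  have cong: "P u" if "cong f u v" "P v" for u v
    using that(2) cong_trans[OF that(1)] unfolding P_def nf_cong[OF that(1)] by blast
  \<comment> \<open>The property respects \<open>cong\<close>, so a left factor may be distributed
    over some expansion of \<open>u\<close>; only products of a generator with a basis element then
    have to be straightened.\<close>
  have mult: "P (g * u)" if u: "P u" and g: "\<And>a p k. P (g * bas a p k)" for g u
  proof -
    obtain n where "cong f u (\<Sum>a<n. \<Sum>k<n. bas a (nf f u a k) k)" using u unfolding P_def by blast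
    then have "cong f (g * u) (g * (\<Sum>a<n. \<Sum>k<n. bas a (nf f u a k) k))" by (rule cong_lmult)
    moreover have "P (g * (\<Sum>a<n. \<Sum>k<n. bas a (nf f u a k) k))"
      unfolding sum_distrib_left by (intro sum g)
    ultimately show ?thesis by (rule cong)
  qed
  have gen: "P (fvar g * bas a p k)" for g a p k
  proof (cases g)
    case GX
    then show ?thesis by (simp add: gx_bas bas)
  next
    case GT
    then show ?thesis using cong[OF gt_bas bas] by simp
  next
    case GY
    then show ?thesis using cong[OF gy_bas_0 bas] cong[OF gy_bas_Suc add[OF bas bas]]
      by (cases a) auto
  qed
  have "P u"
  proof (induction u rule: free_alg_induct)
    case one
    show ?case using bas[of 0 1 0] by (simp add: bas_def)
  qed (auto intro: add mult gen simp: fconst_bas bas)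
  then show ?thesis by (simp add: P_def)
qed

text \<open>Equality in the algebra becomes equality of arrays: straightening gives one direction,
  the representation the other.\<close>

lemma cong_iff_nf: "cong f u v \<longleftrightarrow> nf f u = nf f v"
proof
  assume "nf f u = nf f v"
  then have 0: "nf f (u - v) = (\<lambda>a k. 0)" by (simp add: nf_diff)
  obtain n where "cong f (u - v) (\<Sum>a<n. \<Sum>k<n. bas a (nf f (u - v) a k) k)"
    using cong_normal_form by blast
  then have "cong f (u - v) 0" by (simp add: 0)
  then show "cong f u v" by (simp add: cong_def)
qed (rule nf_cong)


section \<open>Transfer from representatives to the quotient ring\<close>

lemma heis_class_eq_iff: "heis_class f u = heis_class f v \<longleftrightarrow> cong f u v"
  using ring.quotient_eq_iff_same_a_r_cos[OF ring_ring_of_type_algebra ideal_heis_ideal, of u v f]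
  by (simp add: heis_class_def cong_def)

lemma ring_gen_heisenberg: "ring (gen_heisenberg f)"
  unfolding gen_heisenberg_def by (rule ideal.quotient_is_ring[OF ideal_heis_ideal])

lemma heis_class_hom: "heis_class f \<in> ring_hom ring_of_type_algebra (gen_heisenberg f)"
  using ideal.rcos_ring_hom[OF ideal_heis_ideal, of f]
  by (simp add: gen_heisenberg_def heis_class_def[abs_def])

lemma heis_class_mult: "heis_class f u \<otimes>\<^bsub>gen_heisenberg f\<^esub> heis_class f v = heis_class f (u * v)"
  and heis_class_add: "heis_class f u \<oplus>\<^bsub>gen_heisenberg f\<^esub> heis_class f v = heis_class f (u + v)"
  and heis_class_one: "\<one>\<^bsub>gen_heisenberg f\<^esub> = heis_class f 1"
  using ring_hom_mult[OF heis_class_hom, of u v f] ring_hom_add[OF heis_class_hom, of u v f]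
    ring_hom_one[OF heis_class_hom, of f] by simp_all

lemma heis_class_closed: "heis_class f u \<in> carrier (gen_heisenberg f)"
  using ring_hom_closed[OF heis_class_hom, of u f] by simp

lemma heis_class_zero: "\<zero>\<^bsub>gen_heisenberg f\<^esub> = heis_class f 0"
  using ring_hom_zero[OF heis_class_hom ring_ring_of_type_algebra ring_gen_heisenberg, of f] by simp

lemma heis_class_minus:
  "heis_class f u \<ominus>\<^bsub>gen_heisenberg f\<^esub> heis_class f v = heis_class f (u - v)"
proof -
  interpret ring "gen_heisenberg f" by (rule ring_gen_heisenberg)
  have "\<ominus>\<^bsub>gen_heisenberg f\<^esub> heis_class f v = heis_class f (- v)"
    by (rule minus_equality) (simp_all add: heis_class_add heis_class_zero heis_class_closed)
  then show ?thesis by (simp add: a_minus_def heis_class_add)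
qed

lemma carrier_gen_heisenberg: "carrier (gen_heisenberg f) = range (heis_class f)"
  by (auto simp: gen_heisenberg_def FactRing_def A_RCOSETS_def' a_r_coset_def' heis_class_def
      image_def)

lemma heis_class_power: "heis_class f u [^]\<^bsub>gen_heisenberg f\<^esub> (n :: nat) = heis_class f (u ^ n)"
proof -
  interpret ring "gen_heisenberg f" by (rule ring_gen_heisenberg)
  show ?thesis
    by (induction n) (simp_all add: heis_class_one heis_class_mult power_commutes)
qed

lemma heis_class_finsum:
  "finite F \<Longrightarrow> (\<Oplus>\<^bsub>gen_heisenberg f\<^esub>i\<in>F. heis_class f (u i)) = heis_class f (sum u F)"
proof (induction F rule: finite_induct)
  interpret ring "gen_heisenberg f" by (rule ring_gen_heisenberg)
  case empty
  show ?case by (simp add: heis_class_zero)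
next
  interpret ring "gen_heisenberg f" by (rule ring_gen_heisenberg)
  case (insert i F)
  then show ?case by (subst finsum_insert) (auto simp: heis_class_closed heis_class_add)
qed

lemmas heis_class_simps = heis_class_mult heis_class_add heis_class_minus heis_class_one
  heis_class_zero heis_class_power

section \<open>The case of degree different from one\<close>

definition swp :: "(nat \<Rightarrow> nat \<Rightarrow> 'a) \<Rightarrow> nat \<Rightarrow> nat \<Rightarrow> 'a" where
  "swp m = (\<lambda>a k. m k a)"

lemma fiter_1 [simp]: "fiter f (Suc 0) = f"
  by simp

text \<open>The operators of left multiplication commute with those of right multiplication, the
  latter being \<open>gop\<close> conjugated by the exchange of the exponents; checked for each pair
  of generators.\<close>

lemma gop_swp: "gop f g (swp (gop f h (swp m))) = swp (gop f h (swp (gop f g m)))"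
  by (cases g; cases h)
    (auto simp: fun_eq_iff swp_def pcompose_add pcompose_mult pcompose_diff pcompose_fiter
      pcompose_pCons algebra_simps simp del: fiter.simps(2) split: nat.split)

primrec dual :: "heis_gen \<Rightarrow> heis_gen" where
  "dual GX = GY"
| "dual GY = GX"
| "dual GT = GT"

text \<open>Exchanging \<open>x\<close> and \<open>y\<close> is an anti-automorphism, so right multiplications are the
  left multiplications \<open>gop\<close> with the two exponents exchanged.\<close>

lemma act_swp: "act f u (swp (gop f h (swp m))) = swp (gop f h (swp (act f u m)))"
proof (induction u rule: free_alg_induct)
  case (add u v)
  then show ?case using gop_add[of f h "swp (act f u m)" "swp (act f v m)"]
    by (simp add: act_add swp_def fun_eq_iff)
next
  case (const c u)
  then show ?case using gop_smult[of f h c "swp (act f u m)"]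
    by (simp add: act_fconst_mult swp_def fun_eq_iff)
next
  case (var g u)
  then show ?case by (simp add: act_fvar_mult gop_swp)
qed simp

text \<open>On the array of \<open>1\<close> left multiplication by \<open>g\<close> agrees with the
  right one, and \<open>act_swp\<close> then carries it past \<open>u\<close>.\<close>

lemma nf_mult_fvar: "swp (nf f (u * fvar g)) = gop f (dual g) (swp (nf f u))"
proof -
  have "gop f g (unit_array 0 1 0) = swp (gop f (dual g) (swp (unit_array 0 1 0)))"
    by (cases g) (auto simp: fun_eq_iff swp_def unit_array_def pcompose_1 split: nat.split)
  then have "nf f (u * fvar g) = swp (gop f (dual g) (swp (nf f u)))"
    by (simp add: nf_def act_mult act_swp)
  then show ?thesis by (simp add: swp_def)
qed

text \<open>This is \<open>p(f^i)\<close> for \<open>p = f - t\<close>, the coefficient in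
  \<open>y^i p = p(f^i) y^i\<close>.\<close>

definition fstep :: "'k :: field poly \<Rightarrow> nat \<Rightarrow> 'k poly" where
  "fstep f i = fiter f (Suc i) - fiter f i"

lemma diff_dvd_pcompose_diff: "p - q dvd pcompose r p - pcompose r (q :: 'k :: field poly)"
proof (induction r)
  case (pCons c r)
  have "pcompose (pCons c r) p - pcompose (pCons c r) q =
      (p - q) * pcompose r p + q * (pcompose r p - pcompose r q)"
    by (simp add: pcompose_pCons algebra_simps)
  then show ?case using pCons by simp
qed simp

lemma fstep_dvd: "fstep f i dvd fstep f (Suc i)"
  using diff_dvd_pcompose_diff[of "fiter f (Suc i)" "fiter f i" f] by (simp add: fstep_def)

lemma pcompose_fstep: "pcompose (fstep f i) f = fstep f (Suc i)"
  by (simp add: fstep_def pcompose_diff pcompose_fiter del: fiter.simps)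

text \<open>For constant \<open>f\<close> the second difference is zero and the first is not. For
  degree \<open>d\<close> at least two their degrees are \<open>d^2\<close> and
  \<open>d\<close>.\<close>

lemma fstep_not_dvd:
  assumes "Polynomial.degree f \<noteq> 1"
  shows "\<not> fstep f 1 dvd fstep f 0"
proof (cases "Polynomial.degree f = 0")
  case True
  then obtain c where "f = [:c:]" by (rule degree_eq_zeroE)
  then show ?thesis by (simp add: fstep_def pcompose_pCons)
next
  case False
  then have 2: "Polynomial.degree f \<ge> 2" using assms by linarith
  have "fstep f 0 = f + [:0, -1:]" by (simp add: fstep_def)
  then have d: "Polynomial.degree (fstep f 0) = Polynomial.degree f"
    using 2 by (simp only:) (rule degree_add_eq_left, simp)
  then have "Polynomial.degree (fstep f 1) = Polynomial.degree f * Polynomial.degree f"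
    using degree_pcompose[of "fstep f 0" f] by (simp add: pcompose_fstep)
  moreover have "Polynomial.degree f * 2 \<le> Polynomial.degree f * Polynomial.degree f"
    using 2 by simp
  moreover have "fstep f 0 \<noteq> 0" using d 2 by auto
  ultimately show ?thesis using dvd_imp_degree_le[of "fstep f 1" "fstep f 0"] d 2 by auto
qed

text \<open>Coordinates of the left ideal generated by \<open>p y^i\<close> with
  \<open>i \<le> n\<close>. Truncated subtraction matters: for \<open>k \<le> n\<close> the
  condition is divisibility by \<open>p\<close> alone.\<close>

definition dvd_arrays :: "'k :: field poly \<Rightarrow> nat \<Rightarrow> (nat \<Rightarrow> nat \<Rightarrow> 'k poly) set" where
  "dvd_arrays f n = {m. \<forall>a k. fstep f (k - n) dvd m a k}"

lemma pcompose_dvd: "p dvd q \<Longrightarrow> pcompose p r dvd pcompose (q :: 'k :: field poly) r"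
  by (auto simp: dvd_def pcompose_mult)

lemma gop_dvd_arrays:
  assumes "m \<in> dvd_arrays f n"
  shows "gop f g m \<in> dvd_arrays f n"
proof -
  have m: "fstep f (k - n) dvd m a k" for a k using assms by (simp add: dvd_arrays_def)
  have "fstep f (Suc k - n) dvd pcompose (m a k) f" for a k
  proof -
    \<comment> \<open>For \<open>n \<le> k\<close> the two sides agree. For \<open>k < n\<close>
      both differences of exponents are truncated to zero, and \<open>p\<close> divides
      \<open>p(f)\<close>.\<close>
    have "fstep f (Suc k - n) dvd fstep f (Suc (k - n))"
      using fstep_dvd[of f 0] by (cases "n \<le> k") (auto simp: Suc_diff_le)
    also have "\<dots> dvd pcompose (m a k) f"
      using pcompose_dvd[OF m[of k a], of f] by (simp add: pcompose_fstep)
    finally show ?thesis .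
  qed
  then show ?thesis using m
    by (cases g) (auto simp: dvd_arrays_def simp del: fiter.simps split: nat.split intro!: dvd_add dvd_mult)
qed

lemma dvd_arrays_mono: "dvd_arrays f n \<subseteq> dvd_arrays f (Suc n)"
proof
  fix m assume m: "m \<in> dvd_arrays f n"
  have "fstep f (k - Suc n) dvd fstep f (k - n)" for k
    using fstep_dvd[of f "k - Suc n"] by (cases "n < k") (auto simp: Suc_diff_Suc)
  then show "m \<in> dvd_arrays f (Suc n)" using m dvd_trans unfolding dvd_arrays_def by blast
qed

lemma unit_array_dvd_arrays: "unit_array a (fstep f 0) n \<in> dvd_arrays f n"
  by (simp add: dvd_arrays_def unit_array_def)

lemma unit_array_not_dvd_arrays:
  assumes "Polynomial.degree f \<noteq> 1"
  shows "unit_array a (fstep f 0) (Suc n) \<notin> dvd_arrays f n"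
proof
  assume "unit_array a (fstep f 0) (Suc n) \<in> dvd_arrays f n"
  then have "fstep f (Suc n - n) dvd unit_array a (fstep f 0) (Suc n) a (Suc n)"
    unfolding dvd_arrays_def by blast
  then show False using fstep_not_dvd[OF assms] by (simp add: unit_array_def)
qed

lemma dvd_arrays_add: "m \<in> dvd_arrays f n \<Longrightarrow> m' \<in> dvd_arrays f n \<Longrightarrow> (\<lambda>a k. m a k + m' a k) \<in> dvd_arrays f n"
  by (simp add: dvd_arrays_def)

lemma dvd_arrays_zero: "(\<lambda>a k. 0) \<in> dvd_arrays f n"
  by (simp add: dvd_arrays_def)

lemma dvd_arrays_smult: "m \<in> dvd_arrays f n \<Longrightarrow> (\<lambda>a k. Polynomial.smult c (m a k)) \<in> dvd_arrays f n"
  by (simp add: dvd_arrays_def dvd_smult)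

lemma not_left_noetherian:
  assumes "Polynomial.degree f \<noteq> 1"
  shows "\<not> left_noetherian (gen_heisenberg f)"
proof
  interpret ring "gen_heisenberg f" by (rule ring_gen_heisenberg)
  define I where "I n = heis_class f ` {u. nf f u \<in> dvd_arrays f n}" for n
  \<comment> \<open>Normal forms depend only on the class, so membership does not depend on the
    representative.\<close>
  have mem: "heis_class f u \<in> I n \<longleftrightarrow> nf f u \<in> dvd_arrays f n" for u n
    unfolding I_def by (auto simp: heis_class_eq_iff cong_iff_nf)
  have mult: "act f v m \<in> dvd_arrays f n" if "m \<in> dvd_arrays f n" for v m n
    by (induction v rule: free_alg_induct)
      (auto simp: that act_add act_fconst_mult act_fvar_mult gop_dvd_arrays dvd_arrays_add dvd_arrays_smult)
  have "left_ideal (I n) (gen_heisenberg f)" for n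
  proof (rule left_idealI)
    show "I n \<subseteq> carrier (gen_heisenberg f)" by (auto simp: I_def heis_class_closed)
    show "\<zero>\<^bsub>gen_heisenberg f\<^esub> \<in> I n" by (simp add: heis_class_zero mem dvd_arrays_zero)
    fix a b assume "a \<in> I n"
    then obtain u where u: "a = heis_class f u" "nf f u \<in> dvd_arrays f n" by (auto simp: I_def)
    show "a \<oplus>\<^bsub>gen_heisenberg f\<^esub> b \<in> I n" if "b \<in> I n"
    proof -
      obtain v where v: "b = heis_class f v" "nf f v \<in> dvd_arrays f n"
        using \<open>b \<in> I n\<close> by (auto simp: I_def)
      show ?thesis using dvd_arrays_add[OF u(2) v(2)] by (simp add: u(1) v(1) heis_class_add mem nf_add)
    qed
    show "b \<otimes>\<^bsub>gen_heisenberg f\<^esub> a \<in> I n" if "b \<in> carrier (gen_heisenberg f)"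
    proof -
      obtain v where v: "b = heis_class f v" using \<open>b \<in> carrier _\<close> unfolding carrier_gen_heisenberg by blast
      show ?thesis using mult[OF u(2), of v] by (simp add: u(1) v heis_class_mult mem nf_mult)
    qed
  qed
  moreover have "I n \<subseteq> I (Suc n)" for n using dvd_arrays_mono[of f n] by (auto simp: I_def)
  moreover assume "left_noetherian (gen_heisenberg f)"
  then have "(\<forall>n. left_ideal (I n) (gen_heisenberg f)) \<and> (\<forall>n. I n \<subseteq> I (Suc n)) \<longrightarrow>
      (\<exists>N. \<forall>n\<ge>N. I n = I N)"
    unfolding left_noetherian_def by (rule conjunct2[THEN spec])
  ultimately obtain N where "\<forall>n\<ge>N. I n = I N" by metis
  then have "I (Suc N) = I N" by (blast intro: le_SucI)
  \<comment> \<open>The witness is \<open>p y^(N+1)\<close>: at second exponent \<open>N+1\<close>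
    the smaller ideal would require that \<open>p(f)\<close> divides \<open>p\<close>.\<close>
  then show False
    using mem[of "bas 0 (fstep f 0) (Suc N)" N] mem[of "bas 0 (fstep f 0) (Suc N)" "Suc N"]
    by (simp add: nf_bas unit_array_dvd_arrays unit_array_not_dvd_arrays[OF assms])
qed

lemma not_right_noetherian:
  assumes "Polynomial.degree f \<noteq> 1"
  shows "\<not> right_noetherian (gen_heisenberg f)"
proof
  interpret ring "gen_heisenberg f" by (rule ring_gen_heisenberg)
  define I where "I n = heis_class f ` {u. swp (nf f u) \<in> dvd_arrays f n}" for n
  have mem: "heis_class f u \<in> I n \<longleftrightarrow> swp (nf f u) \<in> dvd_arrays f n" for u n
    unfolding I_def by (auto simp: heis_class_eq_iff cong_iff_nf)
  have sum: "swp (nf f (u + v)) \<in> dvd_arrays f n"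
    if "swp (nf f u) \<in> dvd_arrays f n" "swp (nf f v) \<in> dvd_arrays f n" for u v n
    using dvd_arrays_add[OF that] by (simp add: nf_add swp_def)
  have mult: "swp (nf f (u * v)) \<in> dvd_arrays f n" if "swp (nf f u) \<in> dvd_arrays f n" for u v n
    using that
  \<comment> \<open>Right multiplication is only known for single generators, so the letters of
    \<open>v\<close> are transferred one by one to the end of \<open>u\<close>, which therefore has
    to vary.\<close>
  proof (induction v arbitrary: u rule: free_alg_induct)
    case (add v w)
    then show ?case by (simp add: distrib_left sum)
  next
    case (const c v)
    have "swp (nf f (fconst c * u)) \<in> dvd_arrays f n"
      using dvd_arrays_smult[OF const.prems, of c] by (simp add: nf_mult swp_def)
    from const.IH[OF this] show ?case by (simp add: mult.assoc fconst_left_commute)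
  next
    case (var g v)
    have "swp (nf f (u * fvar g)) \<in> dvd_arrays f n"
      unfolding nf_mult_fvar by (rule gop_dvd_arrays[OF var.prems])
    from var.IH[OF this] show ?case by (simp add: mult.assoc)
  qed simp
  have "right_ideal (I n) (gen_heisenberg f)" for n
  proof (rule right_idealI)
    show "I n \<subseteq> carrier (gen_heisenberg f)" by (auto simp: I_def heis_class_closed)
    show "\<zero>\<^bsub>gen_heisenberg f\<^esub> \<in> I n"
      using dvd_arrays_zero[of f n] by (simp add: heis_class_zero mem swp_def)
    fix a b assume "a \<in> I n"
    then obtain u where u: "a = heis_class f u" "swp (nf f u) \<in> dvd_arrays f n" by (auto simp: I_def)
    show "a \<oplus>\<^bsub>gen_heisenberg f\<^esub> b \<in> I n" if "b \<in> I n"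
    proof -
      obtain v where v: "b = heis_class f v" "swp (nf f v) \<in> dvd_arrays f n"
        using \<open>b \<in> I n\<close> by (auto simp: I_def)
      show ?thesis using sum[OF u(2) v(2)] by (simp add: u(1) v(1) heis_class_add mem)
    qed
    show "a \<otimes>\<^bsub>gen_heisenberg f\<^esub> b \<in> I n" if "b \<in> carrier (gen_heisenberg f)"
    proof -
      obtain v where v: "b = heis_class f v" using \<open>b \<in> carrier _\<close> unfolding carrier_gen_heisenberg by blast
      show ?thesis using mult[OF u(2), of v] by (simp add: u(1) v heis_class_mult mem)
    qed
  qed
  moreover have "I n \<subseteq> I (Suc n)" for n using dvd_arrays_mono[of f n] by (auto simp: I_def)
  moreover assume "right_noetherian (gen_heisenberg f)"
  then have "(\<forall>n. right_ideal (I n) (gen_heisenberg f)) \<and> (\<forall>n. I n \<subseteq> I (Suc n)) \<longrightarrow>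
      (\<exists>N. \<forall>n\<ge>N. I n = I N)"
    unfolding right_noetherian_def by (rule conjunct2[THEN spec])
  ultimately obtain N where "\<forall>n\<ge>N. I n = I N" by metis
  then have "I (Suc N) = I N" by (blast intro: le_SucI)
  \<comment> \<open>The witness is now \<open>x^(N+1) p\<close>, whose array with exchanged
    exponents is that of \<open>p y^(N+1)\<close>.\<close>
  moreover have "swp (unit_array (Suc N) p 0) = unit_array 0 p (Suc N)" for p :: "'a poly"
    by (auto simp: swp_def unit_array_def fun_eq_iff)
  ultimately show False
    using mem[of "bas (Suc N) (fstep f 0) 0" N] mem[of "bas (Suc N) (fstep f 0) 0" "Suc N"]
    by (simp add: nf_bas unit_array_dvd_arrays unit_array_not_dvd_arrays[OF assms])
qed


section \<open>The coefficient rings\<close>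

text \<open>The union of the chain, pulled back along the surjection \<open>\<kappa>\<close>, is an
  ideal with a single generator, and this generator already lies in one member of the chain. Applied
  to \<open>K\<close> and to \<open>K[t]\<close>.\<close>

lemma right_noetherian_of_principal:
  fixes \<kappa> :: "'a :: comm_ring_1 \<Rightarrow> 'b"
  assumes "ring B" and kappa_carrier: "carrier B = range \<kappa>"
    and kappa_add: "\<And>p q. \<kappa> (p + q) = \<kappa> p \<oplus>\<^bsub>B\<^esub> \<kappa> q"
    and kappa_mult: "\<And>p q. \<kappa> (p * q) = \<kappa> p \<otimes>\<^bsub>B\<^esub> \<kappa> q" and kappa_zero: "\<kappa> 0 = \<zero>\<^bsub>B\<^esub>"
    and principal: "\<And>P :: 'a set. 0 \<in> P \<Longrightarrow> (\<And>p q. p \<in> P \<Longrightarrow> q \<in> P \<Longrightarrow> p + q \<in> P) \<Longrightarrow>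
      (\<And>p q. p \<in> P \<Longrightarrow> p * q \<in> P) \<Longrightarrow> \<exists>g\<in>P. \<forall>p\<in>P. g dvd p"
  shows "right_noetherian B"
  unfolding right_noetherian_def
proof (intro conjI allI impI assms(1), elim conjE)
  interpret ring B by fact
  fix I :: "nat \<Rightarrow> 'b set"
  assume I: "\<forall>n. right_ideal (I n) B" and mono: "\<forall>n. I n \<subseteq> I (Suc n)"
  have le: "I m \<subseteq> I n" if "m \<le> n" for m n
    using lift_Suc_mono_le[of I m n] mono that by blast
  note D = right_idealD[OF I[rule_format]]
  define P where "P = {p. \<exists>n. \<kappa> p \<in> I n}"
  have "\<exists>g\<in>P. \<forall>p\<in>P. g dvd p"
  proof (rule principal)
    show "0 \<in> P" using D(2)[of 0] unfolding P_def kappa_zero[symmetric] by blast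
    show "p + q \<in> P" if pq: "p \<in> P" "q \<in> P" for p q
    proof -
      obtain m n where "\<kappa> p \<in> I m" "\<kappa> q \<in> I n" using pq by (auto simp: P_def)
      then have "\<kappa> p \<in> I (max m n)" "\<kappa> q \<in> I (max m n)" using le by (meson max.cobounded1 max.cobounded2 subsetD)+
      then have "\<kappa> (p + q) \<in> I (max m n)" using D(3) by (simp add: kappa_add)
      then show ?thesis unfolding P_def by blast
    qed
    show "p * q \<in> P" if "p \<in> P" for p q
    proof -
      obtain n where "\<kappa> p \<in> I n" using \<open>p \<in> P\<close> by (auto simp: P_def)
      then have "\<kappa> (p * q) \<in> I n" using D(4)[of "\<kappa> p" n "\<kappa> q"] kappa_carrier by (simp add: kappa_mult)
      then show ?thesis unfolding P_def by blast
    qed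
  qed
  then obtain g N where g: "\<kappa> g \<in> I N" "\<And>p. p \<in> P \<Longrightarrow> g dvd p" by (auto simp: P_def)
  have "I n \<subseteq> I N" for n
  proof
    fix a assume a: "a \<in> I n"
    then obtain p where p: "a = \<kappa> p" using D(1)[of n] kappa_carrier by blast
    then have "g dvd p" using a g(2) by (auto simp: P_def)
    then obtain q where "p = g * q" by (auto elim: dvdE)
    then show "a \<in> I N" using D(4)[OF g(1), of "\<kappa> q"] kappa_carrier by (simp add: p kappa_mult)
  qed
  then have "I n = I N" if "n \<ge> N" for n using le[OF that] by blast
  then show "\<exists>N. \<forall>n\<ge>N. I n = I N" by blast
qed

lemma field_ideal_principal:
  fixes P :: "'k :: field set"
  assumes "0 \<in> P" "\<And>p q. p \<in> P \<Longrightarrow> p * q \<in> P"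
  shows "\<exists>g\<in>P. \<forall>p\<in>P. g dvd p"
proof (cases "P = {0}")
  case False
  then obtain g where "g \<in> P" "g \<noteq> 0" using assms(1) by blast
  then show ?thesis by (auto intro!: bexI[of _ g] simp: dvd_field_iff)
qed simp

lemma poly_ideal_principal:
  fixes P :: "'k :: field poly set"
  assumes zero: "0 \<in> P" and add: "\<And>p q. p \<in> P \<Longrightarrow> q \<in> P \<Longrightarrow> p + q \<in> P"
    and mult: "\<And>p q. p \<in> P \<Longrightarrow> p * q \<in> P"
  shows "\<exists>g\<in>P. \<forall>p\<in>P. g dvd p"
proof (cases "P = {0}")
  case False
  then have "\<exists>g. g \<in> P \<and> g \<noteq> 0" using zero by blast
  then obtain g where g: "g \<in> P" "g \<noteq> 0"
    and min: "\<And>p. p \<in> P \<and> p \<noteq> 0 \<Longrightarrow> Polynomial.degree g \<le> Polynomial.degree p"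
    using ex_has_least_nat[of "\<lambda>g. g \<in> P \<and> g \<noteq> 0" _ Polynomial.degree] by blast
  have "g dvd p" if "p \<in> P" for p
  proof -
    have "p mod g = p + g * (- (p div g))"
      using minus_mult_div_eq_mod[of p g] by simp
    then have "p mod g \<in> P" using add[OF that mult[OF g(1)]] by (simp only:)
    then have "p mod g = 0" using min degree_mod_less[OF g(2), of p] by fastforce
    then show ?thesis by (rule mod_0_imp_dvd)
  qed
  then show ?thesis using g(1) by blast
qed simp

lemma subring_heis_Kt: "subring (heis_Kt f) (gen_heisenberg f)"
  unfolding heis_Kt_def
  by (rule ring.generate_ring_is_subring[OF ring_gen_heisenberg])
    (auto simp: heis_K_def heis_class_closed)

lemma heis_Kt_eq: "heis_Kt f = range (\<lambda>p. heis_class f (tpoly p))"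
proof
  interpret ring "gen_heisenberg f" by (rule ring_gen_heisenberg)
  show "heis_Kt f \<subseteq> range (\<lambda>p. heis_class f (tpoly p))"
    unfolding heis_Kt_def
  proof (rule generate_ring_min_subring1)
    show "subring (range (\<lambda>p. heis_class f (tpoly p))) (gen_heisenberg f)"
    proof (rule subringI)
      show "\<one>\<^bsub>gen_heisenberg f\<^esub> \<in> range (\<lambda>p. heis_class f (tpoly p))"
        by (intro image_eqI[of _ _ 1]) (simp_all add: heis_class_one)
      fix a b assume "a \<in> range (\<lambda>p. heis_class f (tpoly p))" "b \<in> range (\<lambda>p. heis_class f (tpoly p))"
      then obtain p q where pq: "a = heis_class f (tpoly p)" "b = heis_class f (tpoly q)" by blast
      have "\<ominus>\<^bsub>gen_heisenberg f\<^esub> a = heis_class f (tpoly (- p))"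
        unfolding pq by (rule minus_equality)
          (simp_all add: heis_class_closed heis_class_simps feval_uminus)
      then show "\<ominus>\<^bsub>gen_heisenberg f\<^esub> a \<in> range (\<lambda>p. heis_class f (tpoly p))" by blast
      show "a \<otimes>\<^bsub>gen_heisenberg f\<^esub> b \<in> range (\<lambda>p. heis_class f (tpoly p))"
        by (intro image_eqI[of _ _ "p * q"]) (simp_all add: pq heis_class_mult feval_mult)
      show "a \<oplus>\<^bsub>gen_heisenberg f\<^esub> b \<in> range (\<lambda>p. heis_class f (tpoly p))"
        by (intro image_eqI[of _ _ "p + q"]) (simp_all add: pq heis_class_add feval_add)
    qed (auto simp: heis_class_closed)
    have "heis_class f gt = heis_class f (tpoly [:0, 1:])" by simp
    moreover have "heis_class f (fconst c) = heis_class f (tpoly [:c:])" for c by simp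
    ultimately show "insert (heis_class f gt) (heis_K f) \<subseteq> range (\<lambda>p. heis_class f (tpoly p))"
      unfolding heis_K_def by blast
  qed (auto simp: heis_K_def heis_class_closed)
  have "heis_class f (tpoly p) \<in> heis_Kt f" for p
  proof (induction p)
    case 0
    then show ?case using subringE(2)[OF subring_heis_Kt] by (simp add: heis_class_zero)
  next
    case (pCons c p)
    have "heis_class f (fconst c) \<in> heis_Kt f" "heis_class f gt \<in> heis_Kt f"
      unfolding heis_Kt_def by (auto intro!: generate_ring.incl simp: heis_K_def)
    then show ?case unfolding feval_pCons heis_class_add[symmetric] heis_class_mult[symmetric]
      by (intro subringE(6,7)[OF subring_heis_Kt] pCons.IH)
  qed
  then show "range (\<lambda>p. heis_class f (tpoly p)) \<subseteq> heis_Kt f" by blast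
qed

lemma heis_K_eq: "heis_K f = heis_class f ` range fconst"
  by (auto simp: heis_K_def)

lemma subring_heis_K: "subring (heis_K f) (gen_heisenberg f)"
proof -
  interpret ring "gen_heisenberg f" by (rule ring_gen_heisenberg)
  show ?thesis
  proof (rule subringI)
    show "\<one>\<^bsub>gen_heisenberg f\<^esub> \<in> heis_K f"
      unfolding heis_K_def by (intro image_eqI[of _ _ 1]) (simp_all add: heis_class_one)
    fix a b assume "a \<in> heis_K f" "b \<in> heis_K f"
    then obtain p q where pq: "a = heis_class f (fconst p)" "b = heis_class f (fconst q)"
      unfolding heis_K_def by blast
    have "\<ominus>\<^bsub>gen_heisenberg f\<^esub> a = heis_class f (fconst (- p))"
      unfolding pq by (rule minus_equality)
        (simp_all add: heis_class_closed heis_class_simps fconst_uminus)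
    then show "\<ominus>\<^bsub>gen_heisenberg f\<^esub> a \<in> heis_K f" unfolding heis_K_def by blast
    show "a \<otimes>\<^bsub>gen_heisenberg f\<^esub> b \<in> heis_K f"
      unfolding heis_K_def by (intro image_eqI[of _ _ "p * q"]) (simp_all add: pq heis_class_mult fconst_mult)
    show "a \<oplus>\<^bsub>gen_heisenberg f\<^esub> b \<in> heis_K f"
      unfolding heis_K_def by (intro image_eqI[of _ _ "p + q"]) (simp_all add: pq heis_class_add fconst_add)
  qed (auto simp: heis_K_def heis_class_closed)
qed

lemma right_noetherian_heis_K: "right_noetherian (gen_heisenberg f\<lparr>carrier := heis_K f\<rparr>)"
proof (rule right_noetherian_of_principal)
  show "ring (gen_heisenberg f\<lparr>carrier := heis_K f\<rparr>)"
    by (rule ring.subring_is_ring[OF ring_gen_heisenberg subring_heis_K])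
  show "carrier (gen_heisenberg f\<lparr>carrier := heis_K f\<rparr>) = range (\<lambda>c. heis_class f (fconst c))"
    by (simp add: heis_K_def)
qed (simp_all add: heis_class_simps fconst_add fconst_mult field_ideal_principal)

lemma right_noetherian_heis_Kt: "right_noetherian (gen_heisenberg f\<lparr>carrier := heis_Kt f\<rparr>)"
proof (rule right_noetherian_of_principal)
  show "ring (gen_heisenberg f\<lparr>carrier := heis_Kt f\<rparr>)"
    by (rule ring.subring_is_ring[OF ring_gen_heisenberg subring_heis_Kt])
  show "carrier (gen_heisenberg f\<lparr>carrier := heis_Kt f\<rparr>) = range (\<lambda>p. heis_class f (tpoly p))"
    by (simp add: heis_Kt_eq)
qed (simp_all add: heis_class_simps feval_add feval_mult poly_ideal_principal)

lemma heis_K_central: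
  assumes "r \<in> heis_K f" "a \<in> carrier (gen_heisenberg f)"
  shows "a \<otimes>\<^bsub>gen_heisenberg f\<^esub> r = r \<otimes>\<^bsub>gen_heisenberg f\<^esub> a"
  using assms by (auto simp: heis_K_def carrier_gen_heisenberg heis_class_mult fconst_commute)

lemma heis_K_Units: "r \<in> heis_K f - {\<zero>\<^bsub>gen_heisenberg f\<^esub>} \<Longrightarrow>
    r \<in> Units (gen_heisenberg f\<lparr>carrier := heis_K f\<rparr>)"
proof -
  assume r: "r \<in> heis_K f - {\<zero>\<^bsub>gen_heisenberg f\<^esub>}"
  then obtain c where c: "r = heis_class f (fconst c)" unfolding heis_K_def by blast
  have "c \<noteq> 0" using r unfolding c heis_class_zero by (intro notI) simp
  with c have "heis_class f (fconst (inverse c)) \<otimes>\<^bsub>gen_heisenberg f\<^esub> r = \<one>\<^bsub>gen_heisenberg f\<^esub>"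
    "r \<otimes>\<^bsub>gen_heisenberg f\<^esub> heis_class f (fconst (inverse c)) = \<one>\<^bsub>gen_heisenberg f\<^esub>"
    by (simp_all add: heis_class_simps fconst_mult[symmetric])
  moreover have "heis_class f (fconst (inverse c)) \<in> heis_K f" by (simp add: heis_K_def)
  ultimately show ?thesis using r unfolding Units_def by auto
qed

lemma right_noetherian_of_PBW_over_K:
  assumes "is_skew_PBW_extension (gen_heisenberg f) (heis_K f)"
  shows "right_noetherian (gen_heisenberg f)"
proof -
  interpret ring "gen_heisenberg f" by (rule ring_gen_heisenberg)
  note K = subringE[OF subring_heis_K[of f]]
  obtain xs where xs: "skew_PBW (gen_heisenberg f) (heis_K f) xs"
    using assms unfolding is_skew_PBW_extension_def by blast
  have "skew_maps (gen_heisenberg f) (heis_K f) (xs ! i) id (\<lambda>_. \<zero>\<^bsub>gen_heisenberg f\<^esub>)"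
    if "i < length xs" for i
  proof -
    have "xs ! i \<in> carrier (gen_heisenberg f)" using xs that by (auto simp: skew_PBW_def)
    moreover have "r \<in> carrier (gen_heisenberg f)" if "r \<in> heis_K f" for r using K(1) that by blast
    ultimately show ?thesis
      using K(2) by (auto simp: skew_maps_def ring_hom_def heis_K_central)
  qed
  note maps = this
  have "PBW_bijective (gen_heisenberg f) (heis_K f) xs"
    unfolding PBW_bijective_def
  proof (intro conjI allI impI)
    fix i assume "i < length xs"
    from maps[OF this] show "\<exists>\<sigma> \<delta>. skew_maps (gen_heisenberg f) (heis_K f) (xs ! i) \<sigma> \<delta> \<and>
        bij_betw \<sigma> (heis_K f) (heis_K f)"
      by (intro exI conjI) (assumption, rule bij_betw_id)
  next
    fix j i :: nat assume "j < length xs" "i < j"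
    then obtain d where d: "PBW_coeff (gen_heisenberg f) (heis_K f) xs i j d"
      using xs order.strict_trans[of i j] unfolding skew_PBW_def by blast
    then have "d \<in> heis_K f - {\<zero>\<^bsub>gen_heisenberg f\<^esub>}" by (simp add: PBW_coeff_def)
    from d heis_K_Units[OF this]
    show "\<exists>d. PBW_coeff (gen_heisenberg f) (heis_K f) xs i j d \<and>
        d \<in> Units (gen_heisenberg f\<lparr>carrier := heis_K f\<rparr>)" by blast
  qed
  from Hilbert_basis_bijective_skew_PBW[OF xs this right_noetherian_heis_K] show ?thesis .
qed

lemma right_noetherian_of_PBW_over_Kt:
  assumes "is_bijective_endo_skew_PBW_extension (gen_heisenberg f) (heis_Kt f)"
  shows "right_noetherian (gen_heisenberg f)"
  using assms Hilbert_basis_bijective_skew_PBW right_noetherian_heis_Kt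
  unfolding is_bijective_endo_skew_PBW_extension_def by blast


section \<open>The case of degree one\<close>

text \<open>Restates the basis property for representatives, so that it can be checked with
  \<open>cong\<close> and normal forms.\<close>

lemma free_left_basis_class:
  assumes b: "\<And>i. i \<in> I \<Longrightarrow> B i = heis_class f (b i)"
    and span: "\<And>u. \<exists>F c. finite F \<and> F \<subseteq> I \<and> c \<in> F \<rightarrow> S \<and> cong f u (\<Sum>i\<in>F. c i * b i)"
    and indep: "\<And>F c i. finite F \<Longrightarrow> F \<subseteq> I \<Longrightarrow> c \<in> F \<rightarrow> S \<Longrightarrow> cong f (\<Sum>i\<in>F. c i * b i) 0 \<Longrightarrow>
      i \<in> F \<Longrightarrow> cong f (c i) 0"
  shows "free_left_basis (gen_heisenberg f) (heis_class f ` S) I B"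
proof -
  interpret ring "gen_heisenberg f" by (rule ring_gen_heisenberg)
  have comb: "(\<Oplus>\<^bsub>gen_heisenberg f\<^esub>i\<in>F. c i \<otimes>\<^bsub>gen_heisenberg f\<^esub> B i) =
      heis_class f (\<Sum>i\<in>F. d i * b i)"
    if "finite F" "F \<subseteq> I" "\<And>i. i \<in> F \<Longrightarrow> c i = heis_class f (d i)" for F c d
  proof -
    have "(\<Oplus>\<^bsub>gen_heisenberg f\<^esub>i\<in>F. c i \<otimes>\<^bsub>gen_heisenberg f\<^esub> B i) =
        (\<Oplus>\<^bsub>gen_heisenberg f\<^esub>i\<in>F. heis_class f (d i * b i))"
      using that b by (intro finsum_cong') (auto simp: heis_class_mult heis_class_closed)
    then show ?thesis using heis_class_finsum[OF that(1)] by simp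
  qed
  show ?thesis unfolding free_left_basis_def
  proof (intro conjI ballI allI impI)
    show "B \<in> I \<rightarrow> carrier (gen_heisenberg f)" using b by (auto simp: heis_class_closed)
  next
    fix a assume "a \<in> carrier (gen_heisenberg f)"
    then obtain u where u: "a = heis_class f u" unfolding carrier_gen_heisenberg by blast
    obtain F c where F: "finite F" "F \<subseteq> I" "c \<in> F \<rightarrow> S" "cong f u (\<Sum>i\<in>F. c i * b i)"
      using span[of u] by (elim exE conjE) (rule that)
    show "\<exists>F c. finite F \<and> F \<subseteq> I \<and> c \<in> F \<rightarrow> heis_class f ` S \<and>
        a = (\<Oplus>\<^bsub>gen_heisenberg f\<^esub>i\<in>F. c i \<otimes>\<^bsub>gen_heisenberg f\<^esub> B i)"
    proof (intro exI conjI)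
      show "a = (\<Oplus>\<^bsub>gen_heisenberg f\<^esub>i\<in>F. heis_class f (c i) \<otimes>\<^bsub>gen_heisenberg f\<^esub> B i)"
        unfolding comb[OF F(1,2) refl] u using F(4) by (simp add: heis_class_eq_iff)
    qed (use F in auto)
  next
    fix F c i
    assume F: "finite F" "F \<subseteq> I" "c \<in> F \<rightarrow> heis_class f ` S" "i \<in> F"
      and 0: "(\<Oplus>\<^bsub>gen_heisenberg f\<^esub>i\<in>F. c i \<otimes>\<^bsub>gen_heisenberg f\<^esub> B i) = \<zero>\<^bsub>gen_heisenberg f\<^esub>"
    have "\<forall>i\<in>F. \<exists>d. d \<in> S \<and> c i = heis_class f d" using F(3) by blast
    then obtain d where d: "\<And>i. i \<in> F \<Longrightarrow> d i \<in> S" "\<And>i. i \<in> F \<Longrightarrow> c i = heis_class f (d i)"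
      by metis
    have "cong f (\<Sum>i\<in>F. d i * b i) 0"
      using 0 comb[OF F(1,2) d(2)] by (simp add: heis_class_zero heis_class_eq_iff)
    then have "cong f (d i) 0" using indep[OF F(1,2) _ _ F(4), of d] d(1) by blast
    then show "c i = \<zero>\<^bsub>gen_heisenberg f\<^esub>"
      using d(2)[OF F(4)] by (simp add: heis_class_zero heis_class_eq_iff)
  qed
qed

lemma PBW_coeff_class:
  assumes "d \<in> S" "\<not> cong f d 0" "e \<in> S" "\<And>k. k < length us \<Longrightarrow> s k \<in> S"
    "i < length us" "j < length us"
    and "cong f (us ! j * us ! i) (d * (us ! i * us ! j) + (e + (\<Sum>k<length us. s k * us ! k)))"
  shows "PBW_coeff (gen_heisenberg f) (heis_class f ` S) (map (heis_class f) us) i j (heis_class f d)"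
proof -
  interpret ring "gen_heisenberg f" by (rule ring_gen_heisenberg)
  have "(\<Oplus>\<^bsub>gen_heisenberg f\<^esub>k\<in>{..<length us}. heis_class f (s k) \<otimes>\<^bsub>gen_heisenberg f\<^esub> map (heis_class f) us ! k)
      = (\<Oplus>\<^bsub>gen_heisenberg f\<^esub>k\<in>{..<length us}. heis_class f (s k * us ! k))"
    by (intro finsum_cong') (auto simp: heis_class_mult heis_class_closed)
  then have "heis_class f (e + (\<Sum>k<length us. s k * us ! k)) =
      heis_class f e \<oplus>\<^bsub>gen_heisenberg f\<^esub> (\<Oplus>\<^bsub>gen_heisenberg f\<^esub>k\<in>{..<length (map (heis_class f) us)}.
        heis_class f (s k) \<otimes>\<^bsub>gen_heisenberg f\<^esub> map (heis_class f) us ! k)"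
    by (simp add: heis_class_finsum heis_class_add)
  moreover have "(\<lambda>k. heis_class f (s k)) \<in> {..<length (map (heis_class f) us)} \<rightarrow> heis_class f ` S"
    using assms(4) by auto
  ultimately have aff: "heis_class f (e + (\<Sum>k<length us. s k * us ! k)) \<in>
      PBW_affine (gen_heisenberg f) (heis_class f ` S) (map (heis_class f) us)"
    unfolding PBW_affine_def using assms(3)
    by (intro CollectI exI[of _ "heis_class f e"] exI[of _ "\<lambda>k. heis_class f (s k)"] conjI) auto
  have eq: "heis_class f (us ! j * us ! i - d * (us ! i * us ! j)) =
      heis_class f (e + (\<Sum>k<length us. s k * us ! k))"
    using assms(7) unfolding heis_class_eq_iff by (simp add: cong_def algebra_simps)
  have "heis_class f d \<in> heis_class f ` S - {heis_class f 0}"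
    using assms(1,2) by (simp add: heis_class_eq_iff imageI)
  then show ?thesis
    using assms(5,6) aff unfolding eq[symmetric] by (simp add: PBW_coeff_def heis_class_simps)
qed

lemma heis_Kt_eq_image: "heis_Kt f = heis_class f ` range (\<lambda>p. tpoly p)"
  by (auto simp: heis_Kt_eq)

text \<open>\<open>t\<close> is transcendental over \<open>K\<close> in the algebra: the entry at
  \<open>(0, 0)\<close> of the normal form of \<open>p(t)\<close> is \<open>p\<close>.\<close>

lemma heis_class_tpoly_eq_iff: "heis_class f (tpoly p) = heis_class f (tpoly q) \<longleftrightarrow> p = q"
proof -
  have "nf f (tpoly r) 0 0 = r" for r by (simp add: nf_def act_feval unit_array_def)
  then show ?thesis by (metis heis_class_eq_iff nf_cong)
qed

lemma feval_monom: "feval (Polynomial.monom 1 j) u = u ^ j"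
  by (induction j) (simp_all add: monom_Suc monom_0)

lemma bas_sum: "bas a (sum p I) k = (\<Sum>i\<in>I. bas a (p i) k)"
  by (induction I rule: infinite_finite_induct) (simp_all add: bas_add)

lemma bas_eq_sum: "bas a p k =
    (\<Sum>j\<le>Polynomial.degree p. fconst (Polynomial.coeff p j) * bas a (Polynomial.monom 1 j) k)"
  unfolding fconst_bas Polynomial.smult_monom bas_sum[symmetric]
  by (simp add: poly_as_sum_of_monoms)

section \<open>The algebra for \<open>f = a t + b\<close> over \<open>K\<close>, with variables in
  the order \<open>x, t, y\<close>\<close>

context
  fixes f :: "'k :: field poly" and a b :: 'k
  assumes f: "f = [:b, a:]" and a: "a \<noteq> 0"
begin

lemma nat_less_3: "i < 3 \<longleftrightarrow> i = 0 \<or> i = 1 \<or> i = (2 :: nat)"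
  by auto

text \<open>All ordered pairs are required. The constants for \<open>i < j\<close> come from
  \<open>tx = a xt + b x\<close>, \<open>yt = a ty + b y\<close> and
  \<open>yx = xy + (a - 1) t + b\<close>; those for \<open>j < i\<close> from solving these
  equations for the other product.\<close>

lemma PBW_coeff_over_K:
  assumes "i < 3" "j < 3"
  shows "\<exists>d. PBW_coeff (gen_heisenberg f) (heis_K f) (map (heis_class f) [gx, gt, gy]) i j d"
proof -
  let ?us = "[gx, gt, gy] :: (heis_gen, 'k) free_alg list"
  have *: "\<exists>d. PBW_coeff (gen_heisenberg f) (heis_K f) (map (heis_class f) [gx, gt, gy]) i j d"
    if "d \<noteq> 0" "cong f (?us ! j * ?us ! i) (fconst d * (?us ! i * ?us ! j) +
      (fconst s0 + (fconst s1 * gx + fconst s2 * gt + fconst s3 * gy)))"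
    for d s0 s1 s2 s3
  proof -
    have "nf f (fconst d) 0 0 = [:d:]" by (simp add: nf_def unit_array_def)
    then have "\<not> cong f (fconst d) 0" using that(1) nf_cong[of f "fconst d" 0] by auto
    then have "PBW_coeff (gen_heisenberg f) (heis_class f ` range fconst) (map (heis_class f) ?us) i j
        (heis_class f (fconst d))"
      using assms that(2)
      by (intro PBW_coeff_class[where e = "fconst s0" and
            s = "\<lambda>k. if k = 0 then fconst s1 else if k = 1 then fconst s2 else fconst s3"])
         (simp_all add: lessThan_Suc numeral_3_eq_3 add_ac)
    then show ?thesis unfolding heis_K_eq by blast
  qed
  have c: "cong g u v \<longleftrightarrow> (\<forall>a k. nf g u a k = nf g v a k)" for g :: "'k poly" and u v
    by (simp add: cong_iff_nf fun_eq_iff)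
  note simps = c nf_def act_add act_mult unit_array_def f pcompose_pCons pcompose_1 a
  consider "i = j" | "i = 0 \<and> j = 1" | "i = 1 \<and> j = 0" | "i = 1 \<and> j = 2" | "i = 2 \<and> j = 1"
    | "i = 0 \<and> j = 2" | "i = 2 \<and> j = 0" using assms unfolding nat_less_3 by auto
  then show ?thesis
  proof cases
    case 1
    show ?thesis by (rule *[of 1 0 0 0 0]) (simp_all add: 1)
  next
    case 2
    show ?thesis by (rule *[of a 0 b 0 0]) (use 2 a in \<open>auto simp: simps split: nat.split\<close>)
  next
    case 3
    show ?thesis by (rule *[of "1 / a" 0 "- b / a" 0 0]) (use 3 a in \<open>auto simp: simps split: nat.split\<close>)
  next
    case 4
    show ?thesis by (rule *[of a 0 0 0 b]) (use 4 a in \<open>auto simp: simps split: nat.split\<close>)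
  next
    case 5
    show ?thesis by (rule *[of "1 / a" 0 0 0 "- b / a"]) (use 5 a in \<open>auto simp: simps split: nat.split\<close>)
  next
    case 6
    show ?thesis by (rule *[of 1 b 0 "a - 1" 0]) (use 6 a in \<open>auto simp: simps split: nat.split\<close>)
  next
    case 7
    show ?thesis by (rule *[of 1 "- b" 0 "1 - a" 0]) (use 7 a in \<open>auto simp: simps split: nat.split\<close>)
  qed
qed


text \<open>The order \<open>x, t, y\<close> makes the PBW monomials the elements
  \<open>x^i t^j y^k\<close>, so coordinates are coefficients of the polynomials in the normal
  form.\<close>

lemma free_left_basis_over_K:
  "free_left_basis (gen_heisenberg f) (heis_K f) {\<alpha>. length \<alpha> = 3}
     (PBW_monomial (gen_heisenberg f) (map (heis_class f) [gx, gt, gy]))"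
  unfolding heis_K_eq
proof (rule free_left_basis_class)
  let ?b = "\<lambda>\<alpha>. bas (\<alpha> ! 0) (Polynomial.monom 1 (\<alpha> ! 1)) (\<alpha> ! 2)"
  show "PBW_monomial (gen_heisenberg f) (map (heis_class f) [gx, gt, gy]) \<alpha> = heis_class f (?b \<alpha>)"
    if "\<alpha> \<in> {\<alpha>. length \<alpha> = 3}" for \<alpha>
  proof -
    from that obtain i j k where "\<alpha> = [i, j, k]" by (auto simp: numeral_3_eq_3 length_Suc_conv)
    then show ?thesis
      by (simp add: PBW_monomial_def heis_class_simps bas_def feval_monom mult.assoc)
  qed
  show "\<exists>F c. finite F \<and> F \<subseteq> {\<alpha>. length \<alpha> = 3} \<and> c \<in> F \<rightarrow> range fconst \<and>
      cong f u (\<Sum>\<alpha>\<in>F. c \<alpha> * ?b \<alpha>)" for u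
  proof -
    obtain n where n: "cong f u (\<Sum>a<n. \<Sum>k<n. bas a (nf f u a k) k)"
      using cong_normal_form by blast
    let ?T = "SIGMA a:{..<n}. SIGMA k:{..<n}. {..Polynomial.degree (nf f u a k)}"
    \<comment> \<open>The range of \<open>j\<close> depends on \<open>a\<close> and
      \<open>k\<close>, so \<open>j\<close> comes last in the index set, whereas the exponent of
      \<open>t\<close> stands in the middle of the exponent list.\<close>
    let ?h = "\<lambda>(a, k, j). [a, j, k]"
    let ?c = "\<lambda>\<alpha>. fconst (Polynomial.coeff (nf f u (\<alpha> ! 0) (\<alpha> ! 2)) (\<alpha> ! 1))"
    have inj: "inj_on ?h ?T" by (auto simp: inj_on_def)
    have "(\<Sum>\<alpha>\<in>?h ` ?T. ?c \<alpha> * ?b \<alpha>) =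
        (\<Sum>(a, k, j)\<in>?T. fconst (Polynomial.coeff (nf f u a k) j) * bas a (Polynomial.monom 1 j) k)"
      by (subst sum.reindex[OF inj]) (simp add: case_prod_unfold)
    also have "\<dots> = (\<Sum>a<n. \<Sum>k<n. \<Sum>j\<le>Polynomial.degree (nf f u a k).
        fconst (Polynomial.coeff (nf f u a k) j) * bas a (Polynomial.monom 1 j) k)"
      by (simp add: sum.Sigma case_prod_unfold)
    also have "\<dots> = (\<Sum>a<n. \<Sum>k<n. bas a (nf f u a k) k)"
      by (intro sum.cong refl bas_eq_sum[symmetric])
    finally have "cong f u (\<Sum>\<alpha>\<in>?h ` ?T. ?c \<alpha> * ?b \<alpha>)" using n by simp
    moreover have "finite (?h ` ?T)" "?h ` ?T \<subseteq> {\<alpha>. length \<alpha> = 3}" "?c \<in> ?h ` ?T \<rightarrow> range fconst"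
      by auto
    ultimately show ?thesis by (intro exI conjI)
  qed
  fix F :: "nat list set" and c and \<beta>
  assume F: "finite F" "F \<subseteq> {\<alpha>. length \<alpha> = 3}" "c \<in> F \<rightarrow> range fconst"
    and 0: "cong f (\<Sum>\<alpha>\<in>F. c \<alpha> * ?b \<alpha>) 0" and \<beta>: "\<beta> \<in> F"
  have "\<forall>\<alpha>\<in>F. \<exists>d. c \<alpha> = fconst d" using F(3) by auto
  then obtain d where d: "\<And>\<alpha>. \<alpha> \<in> F \<Longrightarrow> c \<alpha> = fconst (d \<alpha>)" by metis
  \<comment> \<open>Reading off the coordinate that belongs to \<open>\<beta>\<close> isolates a
    single summand.\<close>
  have "Polynomial.coeff (nf f (c \<alpha> * ?b \<alpha>) (\<beta> ! 0) (\<beta> ! 2)) (\<beta> ! 1) = (if \<alpha> = \<beta> then d \<alpha> else 0)"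
    if "\<alpha> \<in> F" for \<alpha>
  proof -
    have "\<alpha> = \<beta> \<longleftrightarrow> \<alpha> ! 0 = \<beta> ! 0 \<and> \<alpha> ! 1 = \<beta> ! 1 \<and> \<alpha> ! 2 = \<beta> ! 2"
      using F(2) that \<beta> by (auto simp: list_eq_iff_nth_eq nat_less_3 subset_iff)
    then show ?thesis
      by (auto simp: d[OF that] fconst_bas nf_bas unit_array_def Polynomial.smult_monom)
  qed
  then have "Polynomial.coeff (nf f (\<Sum>\<alpha>\<in>F. c \<alpha> * ?b \<alpha>) (\<beta> ! 0) (\<beta> ! 2)) (\<beta> ! 1) =
      (\<Sum>\<alpha>\<in>F. if \<alpha> = \<beta> then d \<alpha> else 0)"
    unfolding nf_sum Polynomial.coeff_sum by (intro sum.cong) auto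
  then have "d \<beta> = 0" using nf_cong[OF 0] F(1) \<beta> by simp
  then show "cong f (c \<beta>) 0" using d[OF \<beta>] by simp
qed

lemma skew_PBW_over_K:
  "skew_PBW (gen_heisenberg f) (heis_K f) (map (heis_class f) [gx, gt, gy])"
  unfolding skew_PBW_def
proof (intro conjI allI impI ballI)
  let ?xs = "map (heis_class f) [gx, gt, gy]"
  show "ring (gen_heisenberg f)" by (rule ring_gen_heisenberg)
  show "subring (heis_K f) (gen_heisenberg f)" by (rule subring_heis_K)
  show xs: "set ?xs \<subseteq> carrier (gen_heisenberg f)" by (auto simp: heis_class_closed)
  show "free_left_basis (gen_heisenberg f) (heis_K f) {\<alpha>. length \<alpha> = length ?xs}
      (PBW_monomial (gen_heisenberg f) ?xs)"
    using free_left_basis_over_K by (simp add: numeral_3_eq_3)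
  show "\<exists>d. PBW_coeff (gen_heisenberg f) (heis_K f) ?xs i j d" if "i < length ?xs" "j < length ?xs" for i j
    using PBW_coeff_over_K that by simp
  fix i r assume i: "i < length ?xs" and r: "r \<in> heis_K f - {\<zero>\<^bsub>gen_heisenberg f\<^esub>}"
  interpret ring "gen_heisenberg f" by (rule ring_gen_heisenberg)
  have x: "?xs ! i \<in> carrier (gen_heisenberg f)" using xs nth_mem[OF i] by blast
  have rc: "r \<in> carrier (gen_heisenberg f)" using r subringE(1)[OF subring_heis_K] by blast
  have "?xs ! i \<otimes>\<^bsub>gen_heisenberg f\<^esub> r \<ominus>\<^bsub>gen_heisenberg f\<^esub> r \<otimes>\<^bsub>gen_heisenberg f\<^esub> ?xs ! i = \<zero>\<^bsub>gen_heisenberg f\<^esub>"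
    using heis_K_central[OF _ x] r x rc by (simp add: r_neg a_minus_def)
  then show "\<exists>c\<in>heis_K f - {\<zero>\<^bsub>gen_heisenberg f\<^esub>}. ?xs ! i \<otimes>\<^bsub>gen_heisenberg f\<^esub> r
      \<ominus>\<^bsub>gen_heisenberg f\<^esub> c \<otimes>\<^bsub>gen_heisenberg f\<^esub> ?xs ! i \<in> heis_K f"
    using r subringE(2)[OF subring_heis_K, of f] by (intro bexI[of _ r]) auto
qed

section \<open>The same algebra over \<open>K[t]\<close>, with variables \<open>x, y\<close>\<close>

definition finv :: "'k poly" where "finv = [:- b / a, 1 / a:]"

lemma pcompose_finv: "pcompose finv f = [:0, 1:]" "pcompose f finv = [:0, 1:]"
  using a by (simp_all add: finv_def f pcompose_pCons)

lemma pcompose_f_finv: "pcompose (pcompose p f) finv = p"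
  and pcompose_finv_f: "pcompose (pcompose p finv) f = p"
  by (simp_all add: pcompose_assoc[symmetric] pcompose_finv)

text \<open>The innermost \<open>f\<close> and the outermost inverse frame a smaller instance. It is
  used to move a polynomial from the right of \<open>x^n\<close> to its left.\<close>

lemma pcompose_fiter_finv: "pcompose (fiter finv n) (fiter f n) = [:0, 1:]"
proof (induction n)
  case (Suc n)
  have "pcompose (fiter finv (Suc n)) (fiter f (Suc n)) =
      pcompose finv (pcompose (pcompose (fiter finv n) (fiter f n)) f)"
    by (simp add: pcompose_assoc[symmetric] pcompose_fiter)
  then show ?case by (simp add: Suc pcompose_finv pcompose_pCons)
qed (simp add: pcompose_pCons)

lemma degree_fiter: "Polynomial.degree (fiter f n) = 1"
  by (induction n) (simp_all add: degree_pcompose f a)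

text \<open>Normal forms carry the polynomial between \<open>x^a\<close> and \<open>y^k\<close>, a
  left module basis carries it in front. The passage composes with \<open>f^a\<close>, which for
  degree one is invertible.\<close>

lemma free_left_basis_over_Kt:
  "free_left_basis (gen_heisenberg f) (heis_Kt f) {\<alpha>. length \<alpha> = 2}
     (PBW_monomial (gen_heisenberg f) (map (heis_class f) [gx, gy]))"
  unfolding heis_Kt_eq_image
proof (rule free_left_basis_class)
  let ?b = "\<lambda>\<alpha>. bas (\<alpha> ! 0) 1 (\<alpha> ! 1) :: (heis_gen, 'k) free_alg"
  have mult_b: "cong f (tpoly p * ?b \<alpha>) (bas (\<alpha> ! 0) (pcompose p (fiter f (\<alpha> ! 0))) (\<alpha> ! 1))" for p \<alpha>
    using tpoly_bas[of f p "\<alpha> ! 0" 1] by simp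
  show "PBW_monomial (gen_heisenberg f) (map (heis_class f) [gx, gy]) \<alpha> = heis_class f (?b \<alpha>)"
    if "\<alpha> \<in> {\<alpha>. length \<alpha> = 2}" for \<alpha>
  proof -
    from that obtain i k where "\<alpha> = [i, k]" by (auto simp: numeral_2_eq_2 length_Suc_conv)
    then show ?thesis
      by (simp add: PBW_monomial_def heis_class_simps bas_def)
  qed
  show "\<exists>F c. finite F \<and> F \<subseteq> {\<alpha>. length \<alpha> = 2} \<and> c \<in> F \<rightarrow> range (\<lambda>p. tpoly p) \<and>
      cong f u (\<Sum>\<alpha>\<in>F. c \<alpha> * ?b \<alpha>)" for u
  proof -
    obtain n where n: "cong f u (\<Sum>a<n. \<Sum>k<n. bas a (nf f u a k) k)"
      using cong_normal_form by blast
    let ?T = "{..<n} \<times> {..<n}"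
    let ?h = "\<lambda>(a, k). [a, k]"
    \<comment> \<open>The coefficient is composed with the inverse of \<open>f^a\<close> beforehand,
      so that crossing \<open>x^a\<close> restores the normal form.\<close>
    let ?c = "\<lambda>\<alpha>. tpoly (pcompose (nf f u (\<alpha> ! 0) (\<alpha> ! 1)) (fiter finv (\<alpha> ! 0)))"
    have inj: "inj_on ?h ?T" by (auto simp: inj_on_def)
    have "cong f (\<Sum>\<alpha>\<in>?h ` ?T. ?c \<alpha> * ?b \<alpha>)
        (\<Sum>\<alpha>\<in>?h ` ?T. bas (\<alpha> ! 0) (nf f u (\<alpha> ! 0) (\<alpha> ! 1)) (\<alpha> ! 1))"
    proof (rule cong_sum)
      fix \<alpha>
      have "pcompose (pcompose (nf f u (\<alpha> ! 0) (\<alpha> ! 1)) (fiter finv (\<alpha> ! 0))) (fiter f (\<alpha> ! 0)) =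
          nf f u (\<alpha> ! 0) (\<alpha> ! 1)"
        by (simp add: pcompose_assoc[symmetric] pcompose_fiter_finv)
      then show "cong f (?c \<alpha> * ?b \<alpha>) (bas (\<alpha> ! 0) (nf f u (\<alpha> ! 0) (\<alpha> ! 1)) (\<alpha> ! 1))"
        using mult_b[of "pcompose (nf f u (\<alpha> ! 0) (\<alpha> ! 1)) (fiter finv (\<alpha> ! 0))" \<alpha>] by simp
    qed
    also have "(\<Sum>\<alpha>\<in>?h ` ?T. bas (\<alpha> ! 0) (nf f u (\<alpha> ! 0) (\<alpha> ! 1)) (\<alpha> ! 1)) =
        (\<Sum>a<n. \<Sum>k<n. bas a (nf f u a k) k)"
      by (subst sum.reindex[OF inj]) (simp add: case_prod_unfold sum.cartesian_product)
    finally have "cong f u (\<Sum>\<alpha>\<in>?h ` ?T. ?c \<alpha> * ?b \<alpha>)" using n cong_sym cong_trans by blast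
    moreover have "finite (?h ` ?T)" "?h ` ?T \<subseteq> {\<alpha>. length \<alpha> = 2}" "?c \<in> ?h ` ?T \<rightarrow> range (\<lambda>p. tpoly p)"
      by auto
    ultimately show ?thesis by (intro exI conjI)
  qed
  fix F :: "nat list set" and c and \<beta>
  assume F: "finite F" "F \<subseteq> {\<alpha>. length \<alpha> = 2}" "c \<in> F \<rightarrow> range (\<lambda>p. tpoly p)"
    and 0: "cong f (\<Sum>\<alpha>\<in>F. c \<alpha> * ?b \<alpha>) 0" and \<beta>: "\<beta> \<in> F"
  have "\<forall>\<alpha>\<in>F. \<exists>d. c \<alpha> = tpoly d" using F(3) by auto
  then obtain d where d: "\<And>\<alpha>. \<alpha> \<in> F \<Longrightarrow> c \<alpha> = tpoly (d \<alpha>)" by metis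
  let ?p = "pcompose (d \<beta>) (fiter f (\<beta> ! 0))"
  have "nf f (c \<alpha> * ?b \<alpha>) (\<beta> ! 0) (\<beta> ! 1) = (if \<alpha> = \<beta> then ?p else 0)"
    if "\<alpha> \<in> F" for \<alpha>
  proof -
    have "\<alpha> = \<beta> \<longleftrightarrow> \<alpha> ! 0 = \<beta> ! 0 \<and> \<alpha> ! 1 = \<beta> ! 1"
      using F(2) that \<beta> by (auto simp: list_eq_iff_nth_eq less_2_cases_iff subset_iff)
    then show ?thesis
      unfolding d[OF that] nf_cong[OF mult_b] nf_bas unit_array_def by auto
  qed
  then have "nf f (\<Sum>\<alpha>\<in>F. c \<alpha> * ?b \<alpha>) (\<beta> ! 0) (\<beta> ! 1) = (\<Sum>\<alpha>\<in>F. if \<alpha> = \<beta> then ?p else 0)"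
    unfolding nf_sum by (intro sum.cong) auto
  then have "?p = 0" using nf_cong[OF 0] F(1) \<beta> by simp
  then have "d \<beta> = 0" by (rule pcompose_eq_0) (simp add: degree_fiter)
  then show "cong f (c \<beta>) 0" using d[OF \<beta>] by simp
qed

lemma gx_tpoly: "cong f (gx * tpoly p) (tpoly (pcompose p finv) * gx)"
  using cong_sym[OF tpoly_gx[of f "pcompose p finv"]] by (simp add: pcompose_finv_f)

text \<open>For \<open>x\<close> the map \<open>\<sigma>\<close> substitutes the inverse of
  \<open>f\<close>, for \<open>y\<close> it substitutes \<open>f\<close>; \<open>g\<close> and
  \<open>h\<close> are the substitution and its inverse.\<close>

lemma commute_Kt:
  assumes "i < 2"
  obtains g h where "\<And>p. cong f ([gx, gy] ! i * tpoly p) (tpoly (pcompose p g) * [gx, gy] ! i)"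
    "\<And>p. pcompose (pcompose p g) h = p" "\<And>p. pcompose (pcompose p h) g = p"
proof (cases "i = 0")
  case True
  show ?thesis by (rule that[of finv f]) (simp_all add: True gx_tpoly pcompose_f_finv pcompose_finv_f)
next
  case False
  then have "i = 1" using assms by simp
  then show ?thesis by (intro that[of f finv]) (simp_all add: gy_tpoly pcompose_f_finv pcompose_finv_f)
qed

lemma skew_maps_over_Kt:
  assumes "i < 2"
  shows "\<exists>\<sigma>. skew_maps (gen_heisenberg f) (heis_Kt f) (map (heis_class f) [gx, gy] ! i) \<sigma>
      (\<lambda>_. \<zero>\<^bsub>gen_heisenberg f\<^esub>) \<and> bij_betw \<sigma> (heis_Kt f) (heis_Kt f)"
proof -
  obtain g h where comm: "\<And>p. cong f ([gx, gy] ! i * tpoly p) (tpoly (pcompose p g) * [gx, gy] ! i)"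
    and gh: "\<And>p. pcompose (pcompose p g) h = p" and hg: "\<And>p. pcompose (pcompose p h) g = p"
    using commute_Kt[OF assms] by metis
  define \<kappa> where "\<kappa> p = heis_class f (tpoly p)" for p
  have inj: "inj \<kappa>" by (rule injI) (simp add: \<kappa>_def heis_class_tpoly_eq_iff)
  \<comment> \<open>Substitution acts on polynomials and has to be carried to classes; this is
    unambiguous because \<open>\<kappa>\<close> is injective.\<close>
  define \<sigma> where "\<sigma> r = \<kappa> (pcompose (inv_into UNIV \<kappa> r) g)" for r
  have \<sigma>: "\<sigma> (\<kappa> p) = \<kappa> (pcompose p g)" for p by (simp add: \<sigma>_def inv_into_f_f[OF inj])
  have Kt: "heis_Kt f = range \<kappa>" by (simp add: heis_Kt_eq \<kappa>_def[abs_def])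
  have \<kappa>: "\<kappa> p \<otimes>\<^bsub>gen_heisenberg f\<^esub> \<kappa> q = \<kappa> (p * q)" "\<kappa> p \<oplus>\<^bsub>gen_heisenberg f\<^esub> \<kappa> q = \<kappa> (p + q)"
    "\<one>\<^bsub>gen_heisenberg f\<^esub> = \<kappa> 1" "\<zero>\<^bsub>gen_heisenberg f\<^esub> = \<kappa> 0" for p q
    by (simp_all add: \<kappa>_def heis_class_simps feval_add feval_mult)
  have bij: "bij_betw \<sigma> (heis_Kt f) (heis_Kt f)"
  proof (rule bij_betwI')
    fix r s assume "r \<in> heis_Kt f" "s \<in> heis_Kt f"
    then obtain p q where "r = \<kappa> p" "s = \<kappa> q" unfolding Kt by blast
    moreover have "p = q" if "pcompose p g = pcompose q g" using that gh by metis
    ultimately show "\<sigma> r = \<sigma> s \<longleftrightarrow> r = s" using inj by (auto simp: \<sigma> inj_eq)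
  next
    show "\<sigma> r \<in> heis_Kt f" if "r \<in> heis_Kt f" for r using that by (auto simp: \<sigma>_def Kt)
    fix r assume "r \<in> heis_Kt f"
    then obtain p where "r = \<kappa> p" unfolding Kt by blast
    then have "r = \<sigma> (\<kappa> (pcompose p h))" by (simp add: \<sigma> hg)
    then show "\<exists>s\<in>heis_Kt f. r = \<sigma> s" by (auto simp: Kt)
  qed
  have x: "map (heis_class f) [gx, gy] ! i = heis_class f ([gx, gy] ! i)"
    using assms by (intro nth_map) simp
  have "heis_class f ([gx, gy] ! i) \<otimes>\<^bsub>gen_heisenberg f\<^esub> \<kappa> p =
      \<sigma> (\<kappa> p) \<otimes>\<^bsub>gen_heisenberg f\<^esub> heis_class f ([gx, gy] ! i) \<oplus>\<^bsub>gen_heisenberg f\<^esub> \<zero>\<^bsub>gen_heisenberg f\<^esub>" for p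
    unfolding \<sigma> unfolding \<kappa>_def heis_class_simps heis_class_eq_iff using comm by simp
  then have "skew_maps (gen_heisenberg f) (heis_Kt f) (map (heis_class f) [gx, gy] ! i) \<sigma>
      (\<lambda>_. \<zero>\<^bsub>gen_heisenberg f\<^esub>)"
    unfolding skew_maps_def x using bij
    by (auto simp: ring_hom_def Kt \<sigma> bij_betw_def pcompose_add pcompose_mult pcompose_1 \<kappa>)
  then show ?thesis using bij by blast
qed

text \<open>\<open>yx - xy = f - t\<close> already lies in the coefficient ring \<open>K[t]\<close>,
  so the coefficient \<open>1\<close> works for either order of the variables.\<close>

lemma PBW_coeff_over_Kt:
  assumes "i < 2" "j < 2"
  shows "PBW_coeff (gen_heisenberg f) (heis_Kt f) (map (heis_class f) [gx, gy]) i j (\<one>\<^bsub>gen_heisenberg f\<^esub>)"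
proof -
  let ?us = "[gx, gy] :: (heis_gen, 'k) free_alg list"
  have "nf f 1 0 0 = 1" by (simp add: nf_def unit_array_def)
  then have 1: "\<not> cong f 1 0" using nf_cong[of f 1 0] by auto
  have *: "PBW_coeff (gen_heisenberg f) (heis_class f ` range (\<lambda>p. tpoly p)) (map (heis_class f) ?us) i j
      (heis_class f 1)" if "cong f (?us ! j * ?us ! i) (?us ! i * ?us ! j + tpoly p)" for p
    using assms that 1
    by (intro PBW_coeff_class[where e = "tpoly p" and s = "\<lambda>_. tpoly 0"])
      (auto intro: image_eqI[of _ _ 1] image_eqI[of _ _ 0] rangeI)
  have yx: "cong f (gy * gx) (gx * gy + tpoly (f - [:0, 1:]))" by (rule cong_relations)
  have xy: "cong f (gx * gy) (gy * gx + tpoly ([:0, 1:] - f))"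
    using heis_ideal_closed(3)[OF yx[unfolded cong_def]]
    by (simp add: cong_def feval_diff algebra_simps)
  consider "i = j" | "i = 0 \<and> j = 1" | "i = 1 \<and> j = 0" using assms by linarith
  then show ?thesis unfolding heis_Kt_eq_image heis_class_one
  proof cases
    case 1
    show "PBW_coeff (gen_heisenberg f) (heis_class f ` range (\<lambda>p. tpoly p)) (map (heis_class f) ?us) i j
      (heis_class f 1)" by (rule *[of 0]) (simp add: 1)
  next
    case 2
    show "PBW_coeff (gen_heisenberg f) (heis_class f ` range (\<lambda>p. tpoly p)) (map (heis_class f) ?us) i j
      (heis_class f 1)" by (rule *[of "f - [:0, 1:]"]) (use 2 yx in simp)
  next
    case 3
    show "PBW_coeff (gen_heisenberg f) (heis_class f ` range (\<lambda>p. tpoly p)) (map (heis_class f) ?us) i j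
      (heis_class f 1)" by (rule *[of "[:0, 1:] - f"]) (use 3 xy in simp)
  qed
qed

lemma skew_PBW_over_Kt:
  "skew_PBW (gen_heisenberg f) (heis_Kt f) (map (heis_class f) [gx, gy])"
  unfolding skew_PBW_def
proof (intro conjI allI impI ballI)
  let ?xs = "map (heis_class f) [gx, gy]"
  show "ring (gen_heisenberg f)" by (rule ring_gen_heisenberg)
  show "subring (heis_Kt f) (gen_heisenberg f)" by (rule subring_heis_Kt)
  show "set ?xs \<subseteq> carrier (gen_heisenberg f)" by (auto simp: heis_class_closed)
  show "free_left_basis (gen_heisenberg f) (heis_Kt f) {\<alpha>. length \<alpha> = length ?xs}
      (PBW_monomial (gen_heisenberg f) ?xs)"
    using free_left_basis_over_Kt by (simp add: numeral_2_eq_2)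
  show "\<exists>d. PBW_coeff (gen_heisenberg f) (heis_Kt f) ?xs i j d" if "i < length ?xs" "j < length ?xs" for i j
    using PBW_coeff_over_Kt[of i j] that by auto
  fix i r assume i: "i < length ?xs" and r: "r \<in> heis_Kt f - {\<zero>\<^bsub>gen_heisenberg f\<^esub>}"
  then obtain p where p: "r = heis_class f (tpoly p)" unfolding heis_Kt_eq by blast
  have "p \<noteq> 0" using r unfolding p heis_class_zero by (intro notI) simp
  obtain g h where comm: "cong f ([gx, gy] ! i * tpoly p) (tpoly (pcompose p g) * [gx, gy] ! i)"
    and gh: "pcompose (pcompose p g) h = p"
    using commute_Kt[of i] i by (metis One_nat_def Suc_1 length_Cons length_map list.size(3))
  have x: "?xs ! i = heis_class f ([gx, gy] ! i)" using i by (intro nth_map) simp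
  have 0: "\<zero>\<^bsub>gen_heisenberg f\<^esub> = heis_class f (tpoly 0)" by (simp add: heis_class_zero)
  show "\<exists>c\<in>heis_Kt f - {\<zero>\<^bsub>gen_heisenberg f\<^esub>}. ?xs ! i \<otimes>\<^bsub>gen_heisenberg f\<^esub> r
      \<ominus>\<^bsub>gen_heisenberg f\<^esub> c \<otimes>\<^bsub>gen_heisenberg f\<^esub> ?xs ! i \<in> heis_Kt f"
  proof (rule bexI)
    have "heis_class f ([gx, gy] ! i * tpoly p - tpoly (pcompose p g) * [gx, gy] ! i) = heis_class f (tpoly 0)"
      using comm by (simp add: heis_class_eq_iff cong_def)
    then show "?xs ! i \<otimes>\<^bsub>gen_heisenberg f\<^esub> r \<ominus>\<^bsub>gen_heisenberg f\<^esub>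
        heis_class f (tpoly (pcompose p g)) \<otimes>\<^bsub>gen_heisenberg f\<^esub> ?xs ! i \<in> heis_Kt f"
      unfolding x p heis_class_mult heis_class_minus heis_Kt_eq by blast
    \<comment> \<open>Substitution of \<open>g\<close> is undone by \<open>h\<close>, so it cannot
      annihilate \<open>p\<close>.\<close>
    have "pcompose p g \<noteq> 0" using gh \<open>p \<noteq> 0\<close> by auto
    then show "heis_class f (tpoly (pcompose p g)) \<in> heis_Kt f - {\<zero>\<^bsub>gen_heisenberg f\<^esub>}"
      unfolding 0 using heis_class_tpoly_eq_iff[of f "pcompose p g" 0] by (simp add: heis_Kt_eq)
  qed
qed

lemma bijective_endo_over_Kt: "is_bijective_endo_skew_PBW_extension (gen_heisenberg f) (heis_Kt f)"
  unfolding is_bijective_endo_skew_PBW_extension_def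
proof (intro exI conjI)
  let ?xs = "map (heis_class f) [gx, gy]"
  show "skew_PBW (gen_heisenberg f) (heis_Kt f) ?xs" by (rule skew_PBW_over_Kt)
  have maps: "\<exists>\<sigma>. skew_maps (gen_heisenberg f) (heis_Kt f) (?xs ! i) \<sigma>
      (\<lambda>_. \<zero>\<^bsub>gen_heisenberg f\<^esub>) \<and> bij_betw \<sigma> (heis_Kt f) (heis_Kt f)" if "i < length ?xs" for i
    using skew_maps_over_Kt that by simp
  then show "PBW_endomorphism_type (gen_heisenberg f) (heis_Kt f) ?xs"
    unfolding PBW_endomorphism_type_def by blast
  have "ring (gen_heisenberg f\<lparr>carrier := heis_Kt f\<rparr>)"
    by (rule ring.subring_is_ring[OF ring_gen_heisenberg subring_heis_Kt])
  from monoid.Units_one_closed[OF ring.is_monoid[OF this]]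
  have "\<one>\<^bsub>gen_heisenberg f\<^esub> \<in> Units (gen_heisenberg f\<lparr>carrier := heis_Kt f\<rparr>)" by simp
  then show "PBW_bijective (gen_heisenberg f) (heis_Kt f) ?xs"
    unfolding PBW_bijective_def
  proof (intro conjI allI impI)
    fix i assume "i < length ?xs"
    from maps[OF this] show "\<exists>\<sigma> \<delta>. skew_maps (gen_heisenberg f) (heis_Kt f) (?xs ! i) \<sigma> \<delta> \<and>
        bij_betw \<sigma> (heis_Kt f) (heis_Kt f)" by blast
  next
    fix j i :: nat assume "j < length ?xs" "i < j"
    then have "PBW_coeff (gen_heisenberg f) (heis_Kt f) ?xs i j (\<one>\<^bsub>gen_heisenberg f\<^esub>)"
      by (intro PBW_coeff_over_Kt) auto
    then show "\<exists>d. PBW_coeff (gen_heisenberg f) (heis_Kt f) ?xs i j d \<and>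
        d \<in> Units (gen_heisenberg f\<lparr>carrier := heis_Kt f\<rparr>)"
      using \<open>\<one>\<^bsub>gen_heisenberg f\<^esub> \<in> Units _\<close> by blast
  qed
qed

end

theorem theorem4p2:
  fixes f :: "'k :: field poly"
  shows "(is_bijective_endo_skew_PBW_extension (gen_heisenberg f) (heis_Kt f)
            \<longleftrightarrow> is_skew_PBW_extension (gen_heisenberg f) (heis_K f))
       \<and> (is_skew_PBW_extension (gen_heisenberg f) (heis_K f)
            \<longleftrightarrow> left_noetherian (gen_heisenberg f) \<or> right_noetherian (gen_heisenberg f))
       \<and> (left_noetherian (gen_heisenberg f) \<or> right_noetherian (gen_heisenberg f)
            \<longleftrightarrow> Polynomial.degree f = 1)"
proof -
  have "is_bijective_endo_skew_PBW_extension (gen_heisenberg f) (heis_Kt f) \<and>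
      is_skew_PBW_extension (gen_heisenberg f) (heis_K f)" if "Polynomial.degree f = 1"
  proof -
    obtain b p where f: "f = pCons b p" by (cases f)
    then obtain a where "p = [:a:]" using \<open>Polynomial.degree f = 1\<close>
      by (metis One_nat_def Suc_inject degree_eq_zeroE degree_pCons_eq degree_pCons_0 zero_neq_one)
    with f that have "f = [:b, a:]" "a \<noteq> 0" by auto
    then show ?thesis
      using bijective_endo_over_Kt skew_PBW_over_K unfolding is_skew_PBW_extension_def by blast
  qed
  moreover have "Polynomial.degree f = 1"
    if "left_noetherian (gen_heisenberg f) \<or> right_noetherian (gen_heisenberg f)"
    using that not_left_noetherian not_right_noetherian by blast
  \<comment> \<open>Either PBW condition gives right noetherian, which is one alternative of the
    third condition; either alternative forces degree one, and degree one gives both PBW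
    conditions.\<close>
  ultimately show ?thesis
    using right_noetherian_of_PBW_over_K right_noetherian_of_PBW_over_Kt by blast
qed

end
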